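(* Let $\vec u$ be the exact solution of the boundary value problem $$-E\vec u''(x)+A(x)\vec u(x)=\vec f(x),\quad x\in(0,1),\qquad \vec u(0),\ \vec u(1)\ \text{given},$$ where $A$ satisfies, for all $x\in[0,1]$, $a_{ii}(x)>\sum_{j\ne i}|a_{ij}(x)|$ for $1\le i\le n$, $a_{ij}(x)\le 0$ for $i\neq j$, and $0<\alpha<\min_{x\in[0,1],\,1\le i\le n}\sum_{j=1}^n a_{ij}(x)$. Let $\vec U$ be the solution on the Shishkin mesh $\{x_j\}_{j=0}^N$ (defined in the context) of the discrete problem $$-E\delta^2\vec U(x_j)+A(x_j)\vec U(x_j)=\vec f(x_j),\quad 1\le j\le N-1,\qquad \vec U(0)=\vec u(0),\ \vec U(1)=\vec u(1).$$ Then there is a constant $C>0$, independent of $\varepsilon_1,\dots,\varepsilon_n$ and $N$, such that $$\|\vec U-\vec u\|\le C\,N^{-2}(\ln N)^3,$$ where $\|\vec U-\vec u\|=\max_{1\le i\le n}\max_{0\le j\le N}|U_i(x_j)-u_i(x_j)|$.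
   Context: Setting. $n\ge1$; $E=\mathrm{diag}(\varepsilon_1,\dots,\varepsilon_n)$ with $0<\varepsilon_1<\varepsilon_2<\dots<\varepsilon_n\le 1$ (distinct parameters); $A=(a_{ij})$ is an $n\times n$ matrix function and $\vec f$ an $n$-vector function on $[0,1]$. The problem data are assumed to have whatever smoothness is required (sufficiently smooth on $[0,1]$). It is also assumed that $\max_{i}\sqrt{\varepsilon_i}\le \sqrt{\alpha}/6$. Constants $C$ may depend on $n$, $A$, $\vec f$, $\alpha$ and the given boundary vectors, but not on $\varepsilon_1,\dots,\varepsilon_n$ or $N$. Shishkin mesh. $N=2^{n+p+1}$ for a positive integer $p$. The transition parameters are $$\tau_n=\min\Big\{\tfrac14,\,2\sqrt{\varepsilon_n/\alpha}\,\ln N\Big\},\qquad \tau_k=\min\Big\{\tfrac{\tau_{k+1}}2,\,2\sqrt{\varepsilon_k/\alpha}\,\ln N\Big\},\quad k=n-1,\dots,1.$$ The mesh $0=x_0<x_1<\dots<x_N=1$ is piecewise uniform: $N/2$ equal mesh intervals on $[\tau_n,1-\tau_n]$; $N/2^{n-k+2}$ equal mesh intervals on each of $[\tau_k,\tau_{k+1}]$ and $[1-\tau_{k+1},1-\tau_k]$, $k=1,\dots,n-1$; $N/2^{n+1}$ equal mesh intervals on each of $[0,\tau_1]$ and $[1-\tau_1,1]$. Difference operator. With $h_j=x_j-x_{j-1}$ and $\bar h_j=(h_j+h_{j+1})/2$, $$\delta^2\vec U(x_j)=\frac1{\bar h_j}\left(\frac{\vec U(x_{j+1})-\vec U(x_j)}{h_{j+1}}-\frac{\vec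 U(x_j)-\vec U(x_{j-1})}{h_j}\right).$$ *)

theory Defs
  imports "HOL-Analysis.Analysis"
begin

text \<open>
  Vectors and matrices have components indexed by \<open>{1..n}\<close>; they are functions on \<open>nat\<close> whose
  values outside this range play no role. The order of the indices matters, since the transition
  parameters of the mesh are defined by recursion on them.
\<close>

text \<open>Continuous differentiability of order \<open>m\<close>, with one-sided derivatives at the end points if
  \<open>S\<close> is a closed interval.\<close>

fun C_diff_on :: "nat \<Rightarrow> (real \<Rightarrow> real) \<Rightarrow> real set \<Rightarrow> bool" where
  "C_diff_on 0 g S \<longleftrightarrow> continuous_on S g"
| "C_diff_on (Suc m) g S \<longleftrightarrow>
     (\<exists>g'. (\<forall>x\<in>S. (g has_real_derivative g' x) (at x within S)) \<and> C_diff_on m g' S)"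

definition admissible_matrix :: "nat \<Rightarrow> (nat \<Rightarrow> nat \<Rightarrow> real \<Rightarrow> real) \<Rightarrow> real \<Rightarrow> bool" where
  "admissible_matrix n A \<alpha> \<longleftrightarrow>
     (\<forall>x\<in>{0..1}. \<forall>i\<in>{1..n}. A i i x > (\<Sum>j\<in>{1..n} - {i}. \<bar>A i j x\<bar>)) \<and>
     (\<forall>x\<in>{0..1}. \<forall>i\<in>{1..n}. \<forall>j\<in>{1..n}. i \<noteq> j \<longrightarrow> A i j x \<le> 0) \<and>
     0 < \<alpha> \<and> (\<forall>x\<in>{0..1}. \<forall>i\<in>{1..n}. \<alpha> < (\<Sum>j=1..n. A i j x))"

definition admissible_parameters :: "nat \<Rightarrow> (nat \<Rightarrow> real) \<Rightarrow> real \<Rightarrow> bool" where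
  "admissible_parameters n \<epsilon> \<alpha> \<longleftrightarrow>
     0 < \<epsilon> 1 \<and> strict_mono_on {1..n} \<epsilon> \<and> \<epsilon> n \<le> 1 \<and>
     (MAX i\<in>{1..n}. sqrt (\<epsilon> i)) \<le> sqrt \<alpha> / 6"

text \<open>Classical solutions, in \<open>C[0,1] \<inter> C\<^sup>2(0,1)\<close>: continuity of the second derivative on \<open>(0,1)\<close>
  follows from the differential equation when \<open>A\<close> and \<open>f\<close> are continuous.\<close>

definition bvp_solution ::
  "nat \<Rightarrow> (nat \<Rightarrow> real) \<Rightarrow> (nat \<Rightarrow> nat \<Rightarrow> real \<Rightarrow> real) \<Rightarrow> (nat \<Rightarrow> real \<Rightarrow> real) \<Rightarrow>
   (nat \<Rightarrow> real) \<Rightarrow> (nat \<Rightarrow> real) \<Rightarrow> (nat \<Rightarrow> real \<Rightarrow> real) \<Rightarrow> bool" where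
  "bvp_solution n \<epsilon> A f g\<^sub>0 g\<^sub>1 u \<longleftrightarrow>
     (\<forall>i\<in>{1..n}. continuous_on {0..1} (u i) \<and> u i 0 = g\<^sub>0 i \<and> u i 1 = g\<^sub>1 i) \<and>
     (\<exists>u' u''. \<forall>i\<in>{1..n}. \<forall>x\<in>{0<..<1}.
        (u i has_real_derivative u' i x) (at x) \<and>
        (u' i has_real_derivative u'' i x) (at x) \<and>
        - \<epsilon> i * u'' i x + (\<Sum>j=1..n. A i j x * u j x) = f i x)"

function transition :: "nat \<Rightarrow> (nat \<Rightarrow> real) \<Rightarrow> real \<Rightarrow> nat \<Rightarrow> nat \<Rightarrow> real" where
  "transition n \<epsilon> \<alpha> N k =
     (if k \<ge> n then min (1 / 4) (2 * sqrt (\<epsilon> n / \<alpha>) * ln (real N))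
      else min (transition n \<epsilon> \<alpha> N (k + 1) / 2) (2 * sqrt (\<epsilon> k / \<alpha>) * ln (real N)))"
  by pat_completeness auto
termination
  by (relation "Wellfounded.measure (\<lambda>(n, \<epsilon>, \<alpha>, N, k). n - k)") auto

declare transition.simps [simp del]

text \<open>The right end points of the cells when \<open>[a,b]\<close> is divided into \<open>m\<close> equal cells.\<close>

definition uniform_cells :: "real \<Rightarrow> real \<Rightarrow> nat \<Rightarrow> real list" where
  "uniform_cells a b m = map (\<lambda>j. a + real j * (b - a) / real m) [1..<m+1]"

definition shishkin_points :: "nat \<Rightarrow> (nat \<Rightarrow> real) \<Rightarrow> real \<Rightarrow> nat \<Rightarrow> real list" where
  "shishkin_points n \<epsilon> \<alpha> N = (let \<tau> = transition n \<epsilon> \<alpha> N in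
     0 # uniform_cells 0 (\<tau> 1) (N div 2 ^ (n + 1))
     @ concat (map (\<lambda>k. uniform_cells (\<tau> k) (\<tau> (k + 1)) (N div 2 ^ (n - k + 2))) [1..<n])
     @ uniform_cells (\<tau> n) (1 - \<tau> n) (N div 2)
     @ concat (map (\<lambda>k. uniform_cells (1 - \<tau> (k + 1)) (1 - \<tau> k) (N div 2 ^ (n - k + 2)))
         (rev [1..<n]))
     @ uniform_cells (1 - \<tau> 1) 1 (N div 2 ^ (n + 1)))"

definition shishkin_mesh :: "nat \<Rightarrow> (nat \<Rightarrow> real) \<Rightarrow> real \<Rightarrow> nat \<Rightarrow> nat \<Rightarrow> real" where
  "shishkin_mesh n \<epsilon> \<alpha> N j = shishkin_points n \<epsilon> \<alpha> N ! j"

lemma length_shishkin_points: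
  assumes "n \<ge> 1"
  shows "length (shishkin_points n \<epsilon> \<alpha> (2 ^ (n + p + 1))) = 2 ^ (n + p + 1) + 1"
proof -
  have len: "length (uniform_cells a b m) = m" for a b m
    by (simp add: uniform_cells_def)
  have dv: "(2::nat) ^ (n + p + 1) div 2 ^ (n - k + 2) = 2 ^ (p + k - 1)" if "1 \<le> k" "k < n" for k
    using that by (subst power_diff [symmetric]) auto
  have dv1: "(2::nat) ^ (n + p + 1) div 2 ^ (n + 1) = 2 ^ p"
    by (subst power_diff [symmetric]) auto
  have geo: "(\<Sum>k=1..<m. (2::nat) ^ (p + k - 1)) + 2 ^ p = 2 ^ (p + m - 1)" if "m \<ge> 1" for m
    using that by (induction m rule: dec_induct) (auto simp: power_eq_if)
  have s: "(\<Sum>k=1..<n. 2 ^ (n + p + 1) div 2 ^ (n - k + 2)) = (\<Sum>k=1..<n. (2::nat) ^ (p + k - 1))"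
    using dv by (intro sum.cong) auto
  have half: "(2::nat) ^ (n + p + 1) = 4 * 2 ^ (p + n - 1)"
    using assms by (cases n) (auto simp: add.commute)
  have "length (shishkin_points n \<epsilon> \<alpha> (2 ^ (n + p + 1))) =
      1 + 2 * (2 ^ p + (\<Sum>k=1..<n. 2 ^ (n + p + 1) div 2 ^ (n - k + 2))) + 2 ^ (n + p + 1) div 2"
    unfolding shishkin_points_def Let_def
    by (simp only: length_append length_Cons length_concat map_map o_def len dv1
          sum_list_rev rev_map [symmetric] interv_sum_list_conv_sum_set_nat set_upt)
       simp
  also have "\<dots> = 2 ^ (n + p + 1) + 1"
    unfolding s using geo [OF assms] half by simp
  finally show ?thesis .
qed

text \<open>The operator \<open>\<delta>\<^sup>2\<close> applied to a scalar mesh function, given by its values \<open>U j\<close> at \<open>x j\<close>.\<close>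

definition second_difference :: "(nat \<Rightarrow> real) \<Rightarrow> (nat \<Rightarrow> real) \<Rightarrow> nat \<Rightarrow> real" where
  "second_difference x U j =
     (let h = (\<lambda>j. x j - x (j - 1)); hbar = (h j + h (j + 1)) / 2
      in 1 / hbar * ((U (j + 1) - U j) / h (j + 1) - (U j - U (j - 1)) / h j))"

definition discrete_solution ::
  "nat \<Rightarrow> (nat \<Rightarrow> real) \<Rightarrow> (nat \<Rightarrow> nat \<Rightarrow> real \<Rightarrow> real) \<Rightarrow> (nat \<Rightarrow> real \<Rightarrow> real) \<Rightarrow>
   (nat \<Rightarrow> real) \<Rightarrow> (nat \<Rightarrow> real) \<Rightarrow> nat \<Rightarrow> (nat \<Rightarrow> real) \<Rightarrow> (nat \<Rightarrow> nat \<Rightarrow> real) \<Rightarrow> bool" where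
  "discrete_solution n \<epsilon> A f g\<^sub>0 g\<^sub>1 N x U \<longleftrightarrow>
     (\<forall>i\<in>{1..n}. U i 0 = g\<^sub>0 i \<and> U i N = g\<^sub>1 i) \<and>
     (\<forall>i\<in>{1..n}. \<forall>j\<in>{1..N - 1}.
        - \<epsilon> i * second_difference x (U i) j + (\<Sum>k=1..n. A i k (x j) * U k j) = f i (x j))"

end

theory Submission
  imports Defs
begin

text \<open>
  The residuals \<open>y\<^sub>i = \<epsilon>\<^sub>i u\<^sub>i'' = (A u - f)\<^sub>i\<close> satisfy \<open>\<bar>y\<^sub>i\<bar> \<le> C \<epsilon>\<^sub>i (1 + \<Sum>\<^bsub>q \<ge> i\<^esub> B\<^sub>q / \<epsilon>\<^sub>q)\<close> and
  \<open>\<bar>y\<^sub>i''\<bar> \<le> C (1 + \<Sum>\<^sub>q B\<^sub>q / \<epsilon>\<^sub>q)\<close> with the layer functions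
  \<open>B\<^sub>q(x) = exp (- x sqrt (\<alpha> / \<epsilon>\<^sub>q)) + exp (- (1 - x) sqrt (\<alpha> / \<epsilon>\<^sub>q))\<close>: both \<open>u'\<close> and \<open>u''\<close> solve the
  system up to lower order terms, and an explicit supersolution is available once parameters of
  comparable size are clustered. No decomposition of \<open>u\<close> into solutions of auxiliary boundary value
  problems is needed. At a mesh point each layer is either \<open>O(N\<^sup>-\<^sup>2)\<close> on the neighbouring cells or
  resolved by them, \<open>h\<^sup>2 / \<epsilon>\<^sub>q = O(\<mu>)\<close> with \<open>\<mu> = (ln N / N)\<^sup>2\<close>. A negligible layer satisfies
  \<open>B\<^sub>q / \<epsilon>\<^sub>q = B\<^sub>q'' / \<alpha>\<close>, so adding and subtracting multiples of such layers reduces the estimates to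
  functions with one-sided bounds on the second derivative. The truncation error is then \<open>O(\<mu>)\<close> where
  the mesh is locally uniform and \<open>O(\<mu> (1 + sqrt \<epsilon>\<^sub>i / h))\<close> at the transition points, and a discrete
  barrier with kinks of width \<open>sqrt \<epsilon>\<^sub>i\<close> at the transition points bounds the error by \<open>O(\<mu>)\<close>.
\<close>

text \<open>The a priori bounds are shaped by one obstacle: component \<open>i\<close> must see only
  the layers with \<open>q \<ge> i\<close>, although the rows couple all components. A supersolution
  therefore needs nonpositive entries in the components beyond \<open>q\<close>. Such an entry gains
  through its second derivative, and the gain dominates its cost on the diagonal once
  \<open>\<epsilon> i / \<epsilon> q\<close> is at least the constant \<open>gap\<close>. Parameters
  may be arbitrarily close, so only the top of each cluster carries a profile; inside a cluster the
  ratios are bounded by powers of \<open>gap\<close>, which do not depend on the parameters. At a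
  transition point the difference operator loses its symmetry, and only the variation of
  \<open>y\<close> over two cells is available. Convexity along a chord of length
  \<open>max H (sqrt (\<epsilon> i) / 4)\<close> replaces a bound on the derivative of
  \<open>y\<close>. A kink of width \<open>sqrt (\<epsilon> i)\<close> has a slope jump of size
  \<open>2 / sqrt (\<epsilon> i)\<close>, which on cells of width \<open>H\<close> produces a term
  of just the size \<open>sqrt (\<epsilon> i) / H\<close> that has to be compensated. The bound
  reached is \<open>rate N\<close>, the square of \<open>ln N / N\<close>; since
  \<open>ln N \<ge> 1\<close>, it implies the stated one.\<close>

subsection \<open>Calculus\<close>

text \<open>Derivatives are required in the open interval only, since a classical solution is merely
  continuous at the end points. They are explicit arguments so that \<open>F2\<close> can be the
  expression supplied by the differential equation.\<close>

definition twice_deriv :: "real \<Rightarrow> real \<Rightarrow> (real \<Rightarrow> real) \<Rightarrow> (real \<Rightarrow> real) \<Rightarrow> (real \<Rightarrow> real) \<Rightarrow> bool" where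
  "twice_deriv a b F F1 F2 \<longleftrightarrow> continuous_on {a..b} F \<and>
     (\<forall>t\<in>{a<..<b}. (F has_real_derivative F1 t) (at t) \<and> (F1 has_real_derivative F2 t) (at t))"

lemma twice_derivD:
  assumes "twice_deriv a b F F1 F2"
  shows "continuous_on {a..b} F"
    and "\<And>t. a < t \<Longrightarrow> t < b \<Longrightarrow> (F has_real_derivative F1 t) (at t)"
    and "\<And>t. a < t \<Longrightarrow> t < b \<Longrightarrow> (F1 has_real_derivative F2 t) (at t)"
  using assms by (auto simp: twice_deriv_def)

lemma twice_deriv_subset:
  assumes "twice_deriv a b F F1 F2" "a \<le> c" "d \<le> b"
  shows "twice_deriv c d F F1 F2"
  using assms by (auto simp: twice_deriv_def intro: continuous_on_subset)

lemma twice_deriv_add: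
  assumes "twice_deriv a b F F1 F2" "twice_deriv a b G G1 G2"
  shows "twice_deriv a b (\<lambda>t. F t + G t) (\<lambda>t. F1 t + G1 t) (\<lambda>t. F2 t + G2 t)"
  using assms by (auto simp: twice_deriv_def intro!: continuous_intros derivative_intros)

lemma twice_deriv_diff:
  assumes "twice_deriv a b F F1 F2" "twice_deriv a b G G1 G2"
  shows "twice_deriv a b (\<lambda>t. F t - G t) (\<lambda>t. F1 t - G1 t) (\<lambda>t. F2 t - G2 t)"
  using assms by (auto simp: twice_deriv_def intro!: continuous_intros derivative_intros)

lemma twice_deriv_cmult:
  assumes "twice_deriv a b F F1 F2"
  shows "twice_deriv a b (\<lambda>t. c * F t) (\<lambda>t. c * F1 t) (\<lambda>t. c * F2 t)"
  using assms
  by (auto simp: twice_deriv_def intro!: continuous_intros derivative_eq_intros)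

lemma twice_deriv_uminus:
  assumes "twice_deriv a b F F1 F2"
  shows "twice_deriv a b (\<lambda>t. - F t) (\<lambda>t. - F1 t) (\<lambda>t. - F2 t)"
  using twice_deriv_cmult[OF assms, of "-1"] by simp

lemma twice_deriv_const: "twice_deriv a b (\<lambda>t. c) (\<lambda>t. 0) (\<lambda>t. 0)"
  by (auto simp: twice_deriv_def)

lemma twice_deriv_sum:
  assumes "finite I" "\<And>i. i \<in> I \<Longrightarrow> twice_deriv a b (F i) (F1 i) (F2 i)"
  shows "twice_deriv a b (\<lambda>t. \<Sum>i\<in>I. F i t) (\<lambda>t. \<Sum>i\<in>I. F1 i t) (\<lambda>t. \<Sum>i\<in>I. F2 i t)"
  using assms by (induction I rule: finite_induct) (auto intro: twice_deriv_const twice_deriv_add)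

text \<open>With \<open>\<sigma> = - 1\<close> this is the reflection that carries estimates from
  the left end to the right end; \<open>\<sigma> * \<sigma> = 1\<close> leaves \<open>F2\<close>
  without a factor.\<close>

lemma twice_deriv_affine:
  assumes "twice_deriv a b F F1 F2" and \<sigma>: "\<sigma> = 1 \<or> \<sigma> = (-1::real)"
    and sub: "\<And>s. c \<le> s \<Longrightarrow> s \<le> d \<Longrightarrow> a \<le> x + \<sigma> * s \<and> x + \<sigma> * s \<le> b"
  shows "twice_deriv c d (\<lambda>s. F (x + \<sigma> * s)) (\<lambda>s. \<sigma> * F1 (x + \<sigma> * s)) (\<lambda>s. F2 (x + \<sigma> * s))"
proof -
  have cont: "continuous_on {c..d} (\<lambda>s. F (x + \<sigma> * s))"
    by (rule continuous_on_compose2[OF twice_derivD(1)[OF assms(1)]])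
      (use sub in \<open>auto intro!: continuous_intros\<close>)
  have int: "a < x + \<sigma> * s \<and> x + \<sigma> * s < b" if "c < s" "s < d" for s
  proof -
    have "a \<le> x + \<sigma> * c \<and> x + \<sigma> * c \<le> b" "a \<le> x + \<sigma> * d \<and> x + \<sigma> * d \<le> b"
      using sub[of c] sub[of d] that by auto
    then show ?thesis using that \<sigma> by auto
  qed
  have ss: "\<sigma> * \<sigma> = 1" using \<sigma> by auto
  have d1: "((\<lambda>s. x + \<sigma> * s) has_real_derivative \<sigma>) (at s)" for s
    by (auto intro!: derivative_eq_intros)
  have "((\<lambda>s. F (x + \<sigma> * s)) has_real_derivative \<sigma> * F1 (x + \<sigma> * s)) (at s)" if "c < s" "s < d" for s
    using DERIV_chain2[OF twice_derivD(2)[OF assms(1)] d1, of s] int[OF that]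
    by (simp add: mult.commute)
  moreover have "((\<lambda>s. \<sigma> * F1 (x + \<sigma> * s)) has_real_derivative F2 (x + \<sigma> * s)) (at s)"
    if "c < s" "s < d" for s
  proof -
    have "((\<lambda>s. \<sigma> * F1 (x + \<sigma> * s)) has_real_derivative \<sigma> * (F2 (x + \<sigma> * s) * \<sigma>)) (at s)"
      using DERIV_cmult[OF DERIV_chain2[OF twice_derivD(3)[OF assms(1)] d1, of s], of \<sigma>] int[OF that]
      by simp
    moreover have "\<sigma> * (F2 (x + \<sigma> * s) * \<sigma>) = F2 (x + \<sigma> * s)"
      using ss by (metis mult.commute mult.left_commute mult.right_neutral)
    ultimately show ?thesis by simp
  qed
  ultimately show ?thesis using cont by (auto simp: twice_deriv_def)
qed

lemma continuous_on_of_deriv: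
  assumes "\<And>t. t \<in> S \<Longrightarrow> (F has_real_derivative F1 t) (at t)"
  shows "continuous_on S F"
  using assms by (meson DERIV_isCont continuous_at_imp_continuous_on)

lemma MVT_deriv:
  fixes F :: "real \<Rightarrow> real"
  assumes "a < b" "continuous_on {a..b} F"
    and "\<And>t. a < t \<Longrightarrow> t < b \<Longrightarrow> (F has_real_derivative F1 t) (at t)"
  obtains z where "a < z" "z < b" "F b - F a = (b - a) * F1 z"
proof -
  obtain l z where z: "a < z" "z < b" "DERIV F z :> l" "F b - F a = (b - a) * l"
    using MVT[OF assms(1,2)] assms(3) by (auto simp: real_differentiable_def)
  with assms(3)[of z] have "l = F1 z" by (auto intro: DERIV_unique)
  with z that show ?thesis by blast
qed

text \<open>At \<open>h\<close> only continuity is asked for, because \<open>h\<close> may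
  correspond to an end point of the unit interval, whereas \<open>0\<close> corresponds to an
  interior point.\<close>

lemma taylor_second_order:
  fixes F :: "real \<Rightarrow> real"
  assumes h: "0 < h" and cont: "continuous_on {0..h} F"
    and d1: "\<And>t. 0 \<le> t \<Longrightarrow> t < h \<Longrightarrow> (F has_real_derivative F1 t) (at t)"
    and d2: "\<And>t. 0 \<le> t \<Longrightarrow> t < h \<Longrightarrow> (F1 has_real_derivative F2 t) (at t)"
  obtains \<xi> where "0 < \<xi>" "\<xi> < h" "F h = F 0 + h * F1 0 + h\<^sup>2 / 2 * F2 \<xi>"
proof -
  \<comment> \<open>\<open>K\<close> makes \<open>p\<close> vanish at both ends. The mean value
    theorem for \<open>p\<close> and then for \<open>F1\<close> gives
    \<open>F2 \<xi> = 2 * K\<close>.\<close>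
  define K where "K = (F h - F 0 - h * F1 0) / h\<^sup>2"
  define p where "p t = F t - F 0 - t * F1 0 - K * t\<^sup>2" for t
  have Dp: "(p has_real_derivative F1 t - F1 0 - 2 * K * t) (at t)" if "0 < t" "t < h" for t
    unfolding p_def by (rule derivative_eq_intros d1 refl | use that in simp)+
  have "continuous_on {0..h} p"
    unfolding p_def by (intro continuous_intros cont)
  from MVT_deriv[OF h this Dp] obtain t where t: "0 < t" "t < h" "p h - p 0 = (h - 0) * (F1 t - F1 0 - 2 * K * t)" by blast
  have "p h = 0" "p 0 = 0" using h by (auto simp: p_def K_def)
  then have r: "F1 t - F1 0 - 2 * K * t = 0" using t h by simp
  have "continuous_on {0..t} F1"
    by (rule continuous_on_of_deriv[of _ _ F2]) (use d2 t in auto)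
  then obtain \<xi> where x: "0 < \<xi>" "\<xi> < t" "F1 t - F1 0 = (t - 0) * F2 \<xi>"
    by (rule MVT_deriv[OF t(1)]) (use d2 t in auto)
  then have "F2 \<xi> = 2 * K" using r t by auto
  then have "F h = F 0 + h * F1 0 + h\<^sup>2 / 2 * F2 \<xi>" using h by (simp add: K_def field_simps)
  with x t that show ?thesis by force
qed

text \<open>The even part \<open>P\<close> has derivative zero at \<open>0\<close>, and one \<xi>
  serves both sides. On a uniform mesh the same identity can therefore be applied again, to the
  second derivative at the two symmetric points.\<close>

lemma symmetric_second_difference:
  assumes h: "0 < h" and F: "twice_deriv (x - h) (x + h) F F1 F2"
  obtains \<xi> where "0 < \<xi>" "\<xi> < h"
    "F (x + h) + F (x - h) - 2 * F x = h\<^sup>2 / 2 * (F2 (x + \<xi>) + F2 (x - \<xi>))"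
proof -
  define P where "P s = F (x + s) + F (x - s)" for s
  define P1 where "P1 s = F1 (x + s) - F1 (x - s)" for s
  define P2 where "P2 s = F2 (x + s) + F2 (x - s)" for s
  have a: "twice_deriv (-h) h (\<lambda>s. F (x + s)) (\<lambda>s. F1 (x + s)) (\<lambda>s. F2 (x + s))"
    using twice_deriv_affine[OF F, of 1 "-h" h x] by simp
  have b: "twice_deriv (-h) h (\<lambda>s. F (x - s)) (\<lambda>s. - F1 (x - s)) (\<lambda>s. F2 (x - s))"
    using twice_deriv_affine[OF F, of "-1" "-h" h x] by simp
  have P: "twice_deriv (-h) h P P1 P2"
    using twice_deriv_add[OF a b] by (simp add: P_def[abs_def] P1_def[abs_def] P2_def[abs_def])
  have c: "continuous_on {0..h} P"
    by (rule continuous_on_subset[OF twice_derivD(1)[OF P]]) (use h in auto)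
  obtain \<xi> where "0 < \<xi>" "\<xi> < h" "P h = P 0 + h * P1 0 + h\<^sup>2 / 2 * P2 \<xi>"
    by (rule taylor_second_order[OF h c, of P1 P2]) (use twice_derivD(2,3)[OF P] h in auto)
  then show ?thesis using that by (simp add: P_def P1_def P2_def)
qed

lemma three_point_convexity:
  assumes G: "twice_deriv a c G G1 G2" and abc: "a < b" "b < c"
    and pos: "\<And>t. a < t \<Longrightarrow> t < c \<Longrightarrow> 0 \<le> G2 t"
  shows "(c - a) * G b \<le> (c - b) * G a + (b - a) * G c"
proof -
  note D = twice_derivD[OF G]
  obtain z where z: "a < z" "z < b" "G b - G a = (b - a) * G1 z"
    by (rule MVT_deriv[of a b G G1])
      (use abc D in \<open>auto intro: continuous_on_subset\<close>)
  obtain w where w: "b < w" "w < c" "G c - G b = (c - b) * G1 w"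
    by (rule MVT_deriv[of b c G G1])
      (use abc D in \<open>auto intro: continuous_on_subset\<close>)
  have "continuous_on {z..w} G1"
    by (rule continuous_on_of_deriv[of _ _ G2]) (use D(3) z w in auto)
  then obtain v where v: "z < v" "v < w" "G1 w - G1 z = (w - z) * G2 v"
    using MVT_deriv[of z w G1 G2] z w D(3) by (smt (verit))
  then have "0 \<le> (w - z) * G2 v" using pos[of v] z w by simp
  then have le: "G1 z \<le> G1 w" using v by linarith
  have "(c - b) * (G b - G a) = (b - a) * (c - b) * G1 z" using z by simp
  also have "\<dots> \<le> (b - a) * (c - b) * G1 w" using le abc by (intro mult_left_mono) auto
  also have "\<dots> = (b - a) * (G c - G b)" using w by simp
  finally show ?thesis by (simp add: algebra_simps)
qed

lemma second_deriv_nonneg_at_min: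
  assumes F: "twice_deriv a b F F1 F2" and x: "a < x" "x < b"
    and min: "\<And>t. a \<le> t \<Longrightarrow> t \<le> b \<Longrightarrow> F x \<le> F t"
  shows "0 \<le> F2 x"
proof (rule ccontr)
  assume "\<not> 0 \<le> F2 x"
  then obtain d where d: "d > 0" "\<And>h. h > 0 \<Longrightarrow> h < d \<Longrightarrow> F1 (x + h) < F1 x"
    using DERIV_neg_dec_right[OF twice_derivD(3)[OF F x]] by (auto simp: algebra_simps)
  have "F1 x = 0"
    by (rule DERIV_local_min[OF twice_derivD(2)[OF F x], of "Min {x - a, b - x}"])
      (use x min in auto)
  define h where "h = min d (b - x) / 2"
  have h: "h > 0" "h < d" "x + h < b" using d x by (auto simp: h_def min_def field_simps)
  obtain z where z: "x < z" "z < x + h" "F (x + h) - F x = (x + h - x) * F1 z"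
    by (rule MVT_deriv[of x "x + h" F F1])
      (use h x twice_derivD[OF F] in \<open>auto intro: continuous_on_subset\<close>)
  have "F1 (x + (z - x)) < F1 x" using d(2)[of "z - x"] z h by auto
  then have "h * F1 z < 0" using \<open>F1 x = 0\<close> h by (simp add: mult_pos_neg)
  then show False using min[of "x + h"] z h x by auto
qed

subsection \<open>Layer functions and the supersolution\<close>

text \<open>The decaying solution of \<open>- e v'' + \<alpha> v = 0\<close> with value 1 at the
  origin.\<close>

definition layer :: "real \<Rightarrow> real \<Rightarrow> real \<Rightarrow> real" where
  "layer \<alpha> e t = exp (- t * sqrt (\<alpha> / e))"

definition layers :: "real \<Rightarrow> real \<Rightarrow> real \<Rightarrow> real" where
  "layers \<alpha> e t = layer \<alpha> e t + layer \<alpha> e (1 - t)"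

abbreviation layer_load :: "real \<Rightarrow> (nat \<Rightarrow> real) \<Rightarrow> nat set \<Rightarrow> real \<Rightarrow> real" where
  "layer_load \<alpha> \<epsilon> I t \<equiv> \<Sum>q\<in>I. layers \<alpha> (\<epsilon> q) t / \<epsilon> q"

lemma layer_pos [simp]: "0 < layer \<alpha> e t"
  by (simp add: layer_def)

lemma layers_pos [simp]: "0 < layers \<alpha> e t"
  by (simp add: layers_def add_pos_pos)

lemma layer_le_1: "0 \<le> \<alpha> \<Longrightarrow> 0 < e \<Longrightarrow> 0 \<le> t \<Longrightarrow> layer \<alpha> e t \<le> 1"
  by (simp add: layer_def)

lemma layer_antimono: "0 \<le> \<alpha> \<Longrightarrow> 0 < e \<Longrightarrow> s \<le> t \<Longrightarrow> layer \<alpha> e t \<le> layer \<alpha> e s"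
  by (simp add: layer_def mult_right_mono)

lemma layer_mono_param:
  assumes "0 \<le> \<alpha>" "0 < e" "e \<le> e'" "0 \<le> t"
  shows "layer \<alpha> e t \<le> layer \<alpha> e' t"
proof -
  have "\<alpha> / e' \<le> \<alpha> / e" using assms by (intro divide_left_mono) auto
  then show ?thesis using assms by (auto simp: layer_def intro!: mult_left_mono)
qed

lemma layers_mono_param:
  assumes "0 \<le> \<alpha>" "0 < e" "e \<le> e'" "0 \<le> t" "t \<le> 1"
  shows "layers \<alpha> e t \<le> layers \<alpha> e' t"
  using layer_mono_param[OF assms(1-3), of t] layer_mono_param[OF assms(1-3), of "1 - t"] assms
  by (simp add: layers_def)

lemma layers_le_2: "0 \<le> \<alpha> \<Longrightarrow> 0 < e \<Longrightarrow> 0 \<le> t \<Longrightarrow> t \<le> 1 \<Longrightarrow> layers \<alpha> e t \<le> 2"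
  using layer_le_1[of \<alpha> e t] layer_le_1[of \<alpha> e "1 - t"] by (simp add: layers_def)

lemma layers_end: "t = 0 \<or> t = 1 \<Longrightarrow> 1 \<le> layers \<alpha> e t"
  by (auto simp: layers_def layer_def)

lemma layers_reflect: "layers \<alpha> e (1 - t) = layers \<alpha> e t"
  by (simp add: layers_def)

lemma twice_deriv_layer:
  assumes "0 \<le> \<alpha>" "0 < e"
  shows "twice_deriv a b (layer \<alpha> e) (\<lambda>t. - sqrt (\<alpha> / e) * layer \<alpha> e t) (\<lambda>t. \<alpha> / e * layer \<alpha> e t)"
proof -
  have s: "sqrt (\<alpha> / e) * sqrt (\<alpha> / e) = \<alpha> / e" using assms by simp
  have d: "(layer \<alpha> e has_real_derivative - sqrt (\<alpha> / e) * layer \<alpha> e t) (at t)" for t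
    unfolding layer_def by (auto intro!: derivative_eq_intros)
  have d2: "((\<lambda>t. - sqrt (\<alpha> / e) * layer \<alpha> e t) has_real_derivative \<alpha> / e * layer \<alpha> e t) (at t)" for t
    using DERIV_cmult[OF d, of "- sqrt (\<alpha> / e)" t] s by (simp add: mult.assoc[symmetric] del: real_sqrt_mult_self)
  show ?thesis
    unfolding twice_deriv_def
    by (intro conjI ballI d d2 continuous_on_of_deriv[OF d])
qed

lemma twice_deriv_layers:
  assumes "0 \<le> \<alpha>" "0 < e"
  obtains L1 where "twice_deriv 0 1 (layers \<alpha> e) L1 (\<lambda>t. \<alpha> / e * layers \<alpha> e t)"
proof -
  note l = twice_deriv_layer[OF assms, of 0 1]
  have "twice_deriv 0 1 (\<lambda>s. layer \<alpha> e (1 + (-1) * s)) (\<lambda>s. (-1) * (- sqrt (\<alpha> / e) * layer \<alpha> e (1 + (-1) * s)))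
     (\<lambda>s. \<alpha> / e * layer \<alpha> e (1 + (-1) * s))"
    by (rule twice_deriv_affine[OF l]) auto
  from twice_deriv_add[OF l this] show ?thesis
    by (intro that) (simp add: layers_def[abs_def] distrib_left)
qed

text \<open>\<open>\<eta>\<close> is a uniform slack in the strict inequality between \<alpha> and
  the row sums. The second derivative of a layer consumes the whole of \<alpha>, so this slack is
  what remains to dominate a source.\<close>

locale reaction_matrix =
  fixes n :: nat and A :: "nat \<Rightarrow> nat \<Rightarrow> real \<Rightarrow> real" and \<alpha> \<eta> a :: real
  assumes n: "1 \<le> n" and \<alpha>: "0 < \<alpha>" and \<eta>: "0 < \<eta>"
    and offdiag: "\<And>x i j. x \<in> {0..1} \<Longrightarrow> i \<in> {1..n} \<Longrightarrow> j \<in> {1..n} \<Longrightarrow> i \<noteq> j \<Longrightarrow> A i j x \<le> 0"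
    and rowsum: "\<And>x i. x \<in> {0..1} \<Longrightarrow> i \<in> {1..n} \<Longrightarrow> \<alpha> + \<eta> \<le> (\<Sum>j=1..n. A i j x)"
    and bound: "\<And>x i j. x \<in> {0..1} \<Longrightarrow> i \<in> {1..n} \<Longrightarrow> j \<in> {1..n} \<Longrightarrow> \<bar>A i j x\<bar> \<le> a"
begin

section \<open>Maximum and comparison principles for the differential system\<close>

lemma diag_ge:
  assumes "x \<in> {0..1}" "i \<in> {1..n}" shows "\<alpha> + \<eta> \<le> A i i x"
proof -
  have "(\<Sum>j\<in>{1..n}. A i j x) = A i i x + (\<Sum>j\<in>{1..n} - {i}. A i j x)"
    using assms by (intro sum.remove) auto
  also have "(\<Sum>j\<in>{1..n} - {i}. A i j x) \<le> 0"
    using assms by (intro sum_nonpos) (auto intro: offdiag)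
  finally show ?thesis using rowsum[OF assms] by linarith
qed

lemma a_ge: "\<alpha> + \<eta> \<le> a"
  using diag_ge[of 0 1] bound[of 0 1 1] n by auto

text \<open>Off the diagonal the entries are nonpositive, so replacing each \<open>v j\<close> by
  the smaller \<open>v i\<close> can only increase the sum, which becomes a positive row sum times a
  negative number. Both the continuous and the discrete maximum principle rest on this.\<close>

lemma row_min_bound:
  assumes "x \<in> {0..1}" "i \<in> {1..n}" "\<And>j. j \<in> {1..n} \<Longrightarrow> v i \<le> v j" "v i < 0"
  shows "(\<Sum>j=1..n. A i j x * v j) < 0"
proof -
  have "(\<Sum>j=1..n. A i j x * v j) \<le> (\<Sum>j=1..n. A i j x * v i)"
    using assms offdiag[of x i] by (intro sum_mono) (metis mult_left_mono_neg order_refl)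
  also have "\<dots> = (\<Sum>j=1..n. A i j x) * v i" by (simp add: sum_distrib_right)
  also have "\<dots> < 0" using rowsum[OF assms(1,2)] assms(4) \<alpha> \<eta> by (intro mult_pos_neg) auto
  finally show ?thesis .
qed

lemma max_principle:
  assumes eps: "\<And>i. i \<in> {1..n} \<Longrightarrow> 0 < \<epsilon> i"
    and d: "\<And>i. i \<in> {1..n} \<Longrightarrow> twice_deriv 0 1 (s i) (s1 i) (s2 i)"
    and bd: "\<And>i. i \<in> {1..n} \<Longrightarrow> 0 \<le> s i 0" "\<And>i. i \<in> {1..n} \<Longrightarrow> 0 \<le> s i 1"
    and L: "\<And>i x. i \<in> {1..n} \<Longrightarrow> x \<in> {0<..<1} \<Longrightarrow> 0 \<le> - \<epsilon> i * s2 i x + (\<Sum>j=1..n. A i j x * s j x)"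
    and i: "i \<in> {1..n}" and x: "x \<in> {0..1}"
  shows "0 \<le> s i x"
proof (rule ccontr)
  assume neg: "\<not> 0 \<le> s i x"
  have "\<exists>X\<in>{0..1}. \<forall>t\<in>{0..1}. s i X \<le> s i t" if "i \<in> {1..n}" for i
    by (rule continuous_attains_inf) (use twice_derivD(1)[OF d[OF that]] in auto)
  then obtain X where X: "\<And>i. i \<in> {1..n} \<Longrightarrow> X i \<in> {0..1}"
    "\<And>i t. i \<in> {1..n} \<Longrightarrow> t \<in> {0..1} \<Longrightarrow> s i (X i) \<le> s i t" by metis
  \<comment> \<open>The minimum is taken over points and components together: the row estimate needs
    a component that is lowest at its own minimum point.\<close>
  define k where "k = arg_min_on (\<lambda>i. s i (X i)) {1..n}"
  have k: "k \<in> {1..n}" "\<And>j. j \<in> {1..n} \<Longrightarrow> s k (X k) \<le> s j (X j)"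
    unfolding k_def using n arg_min_if_finite(1)[of "{1..n}" "\<lambda>i. s i (X i)"]
      arg_min_least[of "{1..n}" _ "\<lambda>i. s i (X i)"] by auto
  have mn: "s k (X k) \<le> s j t" if "j \<in> {1..n}" "t \<in> {0..1}" for j t
    using k(2) X(2) that by (meson order_trans)
  then have sk: "s k (X k) < 0" using neg i x by (meson not_le_imp_less order_le_less_trans)
  then have "X k \<noteq> 0" "X k \<noteq> 1" using bd[OF k(1)] by auto
  then have Xk: "0 < X k" "X k < 1" using X(1)[OF k(1)] by auto
  have "0 \<le> s2 k (X k)"
    by (rule second_deriv_nonneg_at_min[OF d[OF k(1)] Xk]) (use mn k in auto)
  moreover have "(\<Sum>j=1..n. A k j (X k) * s j (X k)) < 0"
    by (rule row_min_bound) (use Xk k sk mn in auto)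
  moreover have "0 \<le> \<epsilon> k * s2 k (X k)" using eps[OF k(1)] calculation by simp
  ultimately show False using L[OF k(1), of "X k"] Xk by auto
qed

lemma comparison:
  assumes eps: "\<And>i. i \<in> {1..n} \<Longrightarrow> 0 < \<epsilon> i"
    and s: "\<And>i. i \<in> {1..n} \<Longrightarrow> twice_deriv 0 1 (s i) (s1 i) (s2 i)"
    and b: "\<And>i. i \<in> {1..n} \<Longrightarrow> twice_deriv 0 1 (b i) (b1 i) (b2 i)"
    and bd: "\<And>i t. i \<in> {1..n} \<Longrightarrow> t = 0 \<or> t = 1 \<Longrightarrow> \<bar>s i t\<bar> \<le> b i t"
    and L: "\<And>i x. i \<in> {1..n} \<Longrightarrow> x \<in> {0<..<1} \<Longrightarrow>
       \<bar>- \<epsilon> i * s2 i x + (\<Sum>j=1..n. A i j x * s j x)\<bar> \<le> - \<epsilon> i * b2 i x + (\<Sum>j=1..n. A i j x * b j x)"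
    and i: "i \<in> {1..n}" and x: "x \<in> {0..1}"
  shows "\<bar>s i x\<bar> \<le> b i x"
proof -
  have "0 \<le> b i x - s i x"
  proof (rule max_principle[where \<epsilon> = \<epsilon> and s = "\<lambda>i x. b i x - s i x"
        and ?s1.0 = "\<lambda>i x. b1 i x - s1 i x" and ?s2.0 = "\<lambda>i x. b2 i x - s2 i x", OF eps _ _ _ _ i x])
    fix i assume i: "i \<in> {1..n}"
    show "twice_deriv 0 1 (\<lambda>x. b i x - s i x) (\<lambda>x. b1 i x - s1 i x) (\<lambda>x. b2 i x - s2 i x)"
      by (rule twice_deriv_diff[OF b[OF i] s[OF i]])
    show "0 \<le> b i 0 - s i 0" "0 \<le> b i 1 - s i 1"
      using bd[OF i, of 0] bd[OF i, of 1] by auto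
  next
    fix i x assume "i \<in> {1..n}" "x \<in> {0<..<1::real}"
    from L[OF this] show "0 \<le> - \<epsilon> i * (b2 i x - s2 i x) + (\<Sum>j=1..n. A i j x * (b j x - s j x))"
      by (simp add: algebra_simps sum_subtractf)
  qed
  moreover have "0 \<le> b i x + s i x"
  proof (rule max_principle[where \<epsilon> = \<epsilon> and s = "\<lambda>i x. b i x + s i x"
        and ?s1.0 = "\<lambda>i x. b1 i x + s1 i x" and ?s2.0 = "\<lambda>i x. b2 i x + s2 i x", OF eps _ _ _ _ i x])
    fix i assume i: "i \<in> {1..n}"
    show "twice_deriv 0 1 (\<lambda>x. b i x + s i x) (\<lambda>x. b1 i x + s1 i x) (\<lambda>x. b2 i x + s2 i x)"
      by (rule twice_deriv_add[OF b[OF i] s[OF i]])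
    show "0 \<le> b i 0 + s i 0" "0 \<le> b i 1 + s i 1"
      using bd[OF i, of 0] bd[OF i, of 1] by auto
  next
    fix i x assume "i \<in> {1..n}" "x \<in> {0<..<1::real}"
    from L[OF this] show "0 \<le> - \<epsilon> i * (b2 i x + s2 i x) + (\<Sum>j=1..n. A i j x * (b j x + s j x))"
      by (simp add: algebra_simps sum.distrib)
  qed
  ultimately show ?thesis by linarith
qed

text \<open>Consecutive parameters belong to the same cluster if their ratio is below \<open>gap\<close>; \<open>tops\<close> collects
  the largest index of each cluster.\<close>

definition gap :: real where "gap = 2 * a / \<alpha>"
text \<open>Chosen so that \<open>damp * \<alpha> / 2 = n * a + \<eta>\<close>: half of the gain
  \<open>damp * \<alpha>\<close> pays for a row of entries of size \<open>a\<close> and leaves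
  \<open>\<eta>\<close>, the other half pays for the diagonal.\<close>

definition damp :: real where "damp = 2 * (n * a + \<eta>) / \<alpha>"
text \<open>From \<open>amp - 1 = 4 * damp * gap ^ n\<close> the geometric sum of the negative
  contributions of all finer profiles is at most half of the weight of the cluster top.\<close>

definition amp :: real where "amp = 1 + 4 * damp * gap ^ n"

definition tops :: "(nat \<Rightarrow> real) \<Rightarrow> nat set" where
  "tops \<epsilon> = {q \<in> {1..n}. \<forall>i\<in>{1..n}. q < i \<longrightarrow> gap * \<epsilon> q \<le> \<epsilon> i}"

text \<open>The ratio \<open>\<epsilon> q / \<epsilon> i\<close> makes the second-derivative term
  equal to \<open>damp * \<alpha>\<close> for every \<open>i > q\<close>. Entries beyond
  \<open>q\<close> are nonpositive and can be discarded in upper bounds, which confines component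
  \<open>i\<close> to the layers \<open>q \<ge> i\<close>.\<close>

definition profile :: "(nat \<Rightarrow> real) \<Rightarrow> nat \<Rightarrow> nat \<Rightarrow> real" where
  "profile \<epsilon> q i = (if i \<le> q then 1 else - damp * \<epsilon> q / \<epsilon> i)"

lemma gap_ge: "1 \<le> gap" and damp_pos: "0 < damp"
proof -
  have "0 \<le> n * a" using a_ge \<alpha> \<eta> by simp
  then show "0 < damp" using \<alpha> \<eta> by (simp add: damp_def)
  show "1 \<le> gap" using a_ge \<alpha> \<eta> by (simp add: gap_def field_simps)
qed

text \<open>An index that is not a top has a larger index whose parameter is within the factor
  \<open>gap\<close>. At most \<open>n - i\<close> such climbs are possible, each costing one
  factor.\<close>

lemma cluster_top:
  assumes pos: "\<And>i. i \<in> {1..n} \<Longrightarrow> 0 < \<epsilon> i" and "i \<in> {1..n}"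
  shows "\<exists>c\<in>tops \<epsilon>. i \<le> c \<and> \<epsilon> c \<le> gap ^ (n - i) * \<epsilon> i"
  using assms(2)
proof (induction "n - i" arbitrary: i rule: less_induct)
  case less
  show ?case
  proof (cases "i \<in> tops \<epsilon>")
    case True
    have "1 * \<epsilon> i \<le> gap ^ (n - i) * \<epsilon> i"
      using gap_ge pos[OF less.prems] by (intro mult_right_mono) auto
    then show ?thesis using True by auto
  next
    case False
    then obtain j where j: "j \<in> {1..n}" "i < j" "\<epsilon> j < gap * \<epsilon> i"
      using less.prems by (auto simp: tops_def not_le)
    obtain c where c: "c \<in> tops \<epsilon>" "j \<le> c" "\<epsilon> c \<le> gap ^ (n - j) * \<epsilon> j"
      using less.hyps[of j] j by (meson atLeastAtMost_iff diff_less_mono2 order_less_le_trans)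
    have "gap ^ (n - j) * \<epsilon> j \<le> gap ^ (n - j) * (gap * \<epsilon> i)"
      using j gap_ge by (intro mult_left_mono) auto
    also have "\<dots> = gap ^ Suc (n - j) * \<epsilon> i" by simp
    also have "\<dots> \<le> gap ^ (n - i) * \<epsilon> i"
      using j gap_ge pos[OF less.prems] by (intro mult_right_mono power_increasing) auto
    finally show ?thesis using c j by (intro bexI[of _ c]) auto
  qed
qed

text \<open>Below the scale of a layer the row sums absorb the factor \<open>\<alpha>\<close> of its second derivative; above
  that scale the negative entries of the profile make the second derivative help.\<close>

lemma profile_row:
  assumes pos: "\<And>i. i \<in> {1..n} \<Longrightarrow> 0 < \<epsilon> i" and mono: "\<And>i j. i \<in> {1..n} \<Longrightarrow> j \<in> {1..n} \<Longrightarrow> i \<le> j \<Longrightarrow> \<epsilon> i \<le> \<epsilon> j"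
    and q: "q \<in> tops \<epsilon>" and i: "i \<in> {1..n}" and x: "x \<in> {0..1}"
  shows "\<eta> \<le> - \<epsilon> i * (\<alpha> / \<epsilon> q) * profile \<epsilon> q i + (\<Sum>j=1..n. A i j x * profile \<epsilon> q j)"
proof (cases "i \<le> q")
  case True
  have q': "q \<in> {1..n}" using q by (simp add: tops_def)
  have "(\<Sum>j=1..n. A i j x) \<le> (\<Sum>j=1..n. A i j x * profile \<epsilon> q j)"
  proof (rule sum_mono)
    fix j assume j: "j \<in> {1..n}"
    show "A i j x \<le> A i j x * profile \<epsilon> q j"
    proof (cases "j \<le> q")
      case False
      then have "A i j x \<le> 0" using offdiag[OF x i j] True by auto
      moreover have "profile \<epsilon> q j \<le> 0"
        using False damp_pos pos[OF j] pos[OF q'] by (simp add: profile_def)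
      ultimately show ?thesis by (meson order_trans mult_nonpos_nonpos)
    qed (simp add: profile_def)
  qed
  moreover have "\<epsilon> i * (\<alpha> / \<epsilon> q) \<le> \<alpha>"
    using mono[OF i q' True] \<alpha> pos[OF q'] by (simp add: field_simps)
  ultimately show ?thesis using rowsum[OF x i] True by (simp add: profile_def)
next
  case False
  have q': "q \<in> {1..n}" using q by (simp add: tops_def)
  have g: "gap * \<epsilon> q \<le> \<epsilon> i" using q False i by (auto simp: tops_def)
  have p: "- \<epsilon> i * (\<alpha> / \<epsilon> q) * profile \<epsilon> q i = damp * \<alpha>"
    using False pos[OF i] pos[OF q'] by (simp add: profile_def)
  have a0: "0 < a" using a_ge \<alpha> \<eta> by linarith
  \<comment> \<open>Entry by entry: \<open>- a\<close> covers the columns up to \<open>q\<close>; on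
    the diagonal \<open>gap\<close> bounds \<open>a * \<epsilon> q / \<epsilon> i\<close> by
    \<open>\<alpha> / 2\<close>, hence the extra term; the other columns are products of two
    nonpositive factors.\<close>
  have "(\<Sum>j=1..n. - a - (if j = i then damp * \<alpha> / 2 else 0)) \<le> (\<Sum>j=1..n. A i j x * profile \<epsilon> q j)"
  proof (rule sum_mono)
    fix j assume j: "j \<in> {1..n}"
    consider "j \<le> q" | "j > q" "j = i" | "j > q" "j \<noteq> i" by linarith
    then show "- a - (if j = i then damp * \<alpha> / 2 else 0) \<le> A i j x * profile \<epsilon> q j"
    proof cases
      case 1
      then show ?thesis using bound[OF x i j] False by (auto simp: profile_def)
    next
      case 2
      have "A i i x * (damp * \<epsilon> q / \<epsilon> i) \<le> a * (damp * \<epsilon> q / \<epsilon> i)"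
        using bound[OF x i i] damp_pos pos[OF i] pos[OF q'] by (intro mult_right_mono) auto
      also have "\<dots> = damp * (a * \<epsilon> q / \<epsilon> i)" by simp
      also have "\<dots> \<le> damp * (\<alpha> / 2)"
        using g damp_pos pos[OF i] \<alpha> by (intro mult_left_mono) (auto simp: gap_def field_simps)
      finally have "A i i x * (damp * \<epsilon> q / \<epsilon> i) \<le> damp * (\<alpha> / 2)" .
      moreover have "A i j x * profile \<epsilon> q j = - (A i i x * (damp * \<epsilon> q / \<epsilon> i))"
        using 2 by (simp add: profile_def)
      ultimately have "- a - damp * \<alpha> / 2 \<le> A i j x * profile \<epsilon> q j" using 2 a0 by linarith
      then show ?thesis using 2 by simp
    next
      case 3
      have "A i j x \<le> 0" using offdiag[OF x i j] 3 by auto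
      moreover have "profile \<epsilon> q j \<le> 0"
        using 3 damp_pos pos[OF j] pos[OF q'] by (simp add: profile_def)
      ultimately have "0 \<le> A i j x * profile \<epsilon> q j" by (simp add: mult_nonpos_nonpos)
      then show ?thesis using a0 3 by simp
    qed
  qed
  also have "(\<Sum>j=1..n. - a - (if j = i then damp * \<alpha> / 2 else 0)) = - (n * a) - damp * \<alpha> / 2"
    using i by (simp add: sum_subtractf sum.delta)
  finally have "- (n * a) - damp * \<alpha> / 2 \<le> (\<Sum>j=1..n. A i j x * profile \<epsilon> q j)" .
  moreover have "- (n * a) - damp * \<alpha> / 2 = \<eta> - damp * \<alpha>" using \<alpha> by (simp add: damp_def field_simps)
  ultimately show ?thesis unfolding p by simp
qed

text \<open>The summand \<open>2 * gap ^ n\<close> serves the boundary values; the one with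
  \<open>n / \<eta>\<close> serves the source, where the load of all layers is charged to the
  cluster tops.\<close>

definition layer_factor :: real where "layer_factor = 2 * gap ^ n * (1 + n / \<eta>)"
definition layer_const :: real where "layer_const = layer_factor * (1 / \<alpha> + amp ^ n)"

lemma amp_gt: "1 < amp" and gapn_ge: "1 \<le> gap ^ n"
proof -
  show "1 \<le> gap ^ n" using gap_ge by (rule one_le_power)
  then show "1 < amp" using damp_pos unfolding amp_def by (simp add: mult_pos_pos)
qed

lemma layer_factor_ge: "2 * gap ^ n \<le> layer_factor" "n * gap ^ n \<le> layer_factor * \<eta>" "1 \<le> layer_factor"
proof -
  show 1: "2 * gap ^ n \<le> layer_factor"
    unfolding layer_factor_def using gapn_ge \<eta> by (simp add: algebra_simps)
  then show "1 \<le> layer_factor" using gapn_ge by linarith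
  have "layer_factor * \<eta> = 2 * gap ^ n * \<eta> + 2 * (n * gap ^ n)"
    unfolding layer_factor_def using \<eta> by (simp add: field_simps)
  moreover have "0 \<le> gap ^ n * \<eta>" "0 \<le> n * gap ^ n" using gapn_ge \<eta> by auto
  ultimately show "n * gap ^ n \<le> layer_factor * \<eta>" by linarith
qed

lemma layer_const_pos: "0 < layer_const"
  unfolding layer_const_def using layer_factor_ge(3) \<alpha> amp_gt by (simp add: add_pos_pos)

text \<open>The weight \<open>e q\<close> is the height of layer \<open>q\<close>: it will be
  \<open>1 / sqrt (\<epsilon> q)\<close> for the first and \<open>1 / \<epsilon> q\<close> for the
  second derivative of the solution. In both cases \<open>e i * \<epsilon> i\<close> is
  nondecreasing, which keeps \<open>e q * \<epsilon> q / \<epsilon> i\<close>, the size of the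
  negative entries, below \<open>e i\<close>.\<close>

context
  fixes \<epsilon> e :: "nat \<Rightarrow> real"
  assumes pos: "\<And>i. i \<in> {1..n} \<Longrightarrow> 0 < \<epsilon> i"
    and mono: "\<And>i j. i \<in> {1..n} \<Longrightarrow> j \<in> {1..n} \<Longrightarrow> i \<le> j \<Longrightarrow> \<epsilon> i \<le> \<epsilon> j"
    and epos: "\<And>i. i \<in> {1..n} \<Longrightarrow> 0 < e i"
    and emono: "\<And>i j. i \<in> {1..n} \<Longrightarrow> j \<in> {1..n} \<Longrightarrow> i \<le> j \<Longrightarrow> e i * \<epsilon> i \<le> e j * \<epsilon> j"
begin

abbreviation weighted :: "nat set \<Rightarrow> real \<Rightarrow> real" where
  "weighted I t \<equiv> \<Sum>q\<in>I. e q * layers \<alpha> (\<epsilon> q) t"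

lemma cluster_top_weight:
  assumes i: "i \<in> {1..n}"
  obtains c where "c \<in> tops \<epsilon>" "i \<le> c" "\<epsilon> i \<le> \<epsilon> c" "e i \<le> gap ^ n * e c"
proof -
  obtain c where c: "c \<in> tops \<epsilon>" "i \<le> c" "\<epsilon> c \<le> gap ^ (n - i) * \<epsilon> i"
    using cluster_top[of \<epsilon>, OF pos i] by blast
  then have c': "c \<in> {1..n}" by (simp add: tops_def)
  have "gap ^ (n - i) * \<epsilon> i \<le> gap ^ n * \<epsilon> i"
    using gap_ge pos[OF i] by (intro mult_right_mono power_increasing) auto
  with c have "\<epsilon> c \<le> gap ^ n * \<epsilon> i" by linarith
  then have "e c * \<epsilon> c \<le> e c * (gap ^ n * \<epsilon> i)" using epos[OF c'] by (intro mult_left_mono) auto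
  with emono[OF i c' c(2)] have "e i * \<epsilon> i \<le> (gap ^ n * e c) * \<epsilon> i" by (simp add: mult.commute mult.left_commute)
  then have "e i \<le> gap ^ n * e c" using pos[OF i] by simp
  with c mono[OF i c' c(2)] show ?thesis by (intro that)
qed

lemma tops_subset: "tops \<epsilon> \<subseteq> {1..n}" and finite_tops: "finite (tops \<epsilon>)"
  by (auto simp: tops_def)

text \<open>Each layer lies below the layer of its cluster top, which decays no faster, and their
  weights differ by at most \<open>gap ^ n\<close>.\<close>

lemma sum_layers_le_tops:
  assumes x: "x \<in> {0..1}"
  shows "weighted {1..n} x \<le> n * gap ^ n * weighted (tops \<epsilon>) x"
proof -
  have "e q * layers \<alpha> (\<epsilon> q) x \<le> gap ^ n * weighted (tops \<epsilon>) x"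
    if q: "q \<in> {1..n}" for q
  proof -
    obtain c where c: "c \<in> tops \<epsilon>" "q \<le> c" "\<epsilon> q \<le> \<epsilon> c" "e q \<le> gap ^ n * e c"
      by (rule cluster_top_weight[OF q])
    have "layers \<alpha> (\<epsilon> q) x \<le> layers \<alpha> (\<epsilon> c) x"
      using c pos[OF q] \<alpha> x by (intro layers_mono_param) auto
    then have "e q * layers \<alpha> (\<epsilon> q) x \<le> (gap ^ n * e c) * layers \<alpha> (\<epsilon> c) x"
      using c(4) epos[OF q] by (intro mult_mono') (auto intro: less_imp_le)
    also have "e c * layers \<alpha> (\<epsilon> c) x \<le> weighted (tops \<epsilon>) x"
      using c(1) finite_tops tops_subset epos
      by (intro member_le_sum) (auto intro!: mult_nonneg_nonneg less_imp_le)
    then have "(gap ^ n * e c) * layers \<alpha> (\<epsilon> c) x \<le> gap ^ n * weighted (tops \<epsilon>) x"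
      using gapn_ge by (simp add: mult.assoc)
    finally show ?thesis .
  qed
  from sum_mono[of "{1..n}", OF this] show ?thesis by (simp add: mult.assoc)
qed

text \<open>The weights \<open>amp ^ q\<close> grow so fast that the positive entry of the profile of the cluster of
  \<open>i\<close> dominates the negative entries of all finer profiles.\<close>

lemma barrier_at_end:
  assumes i: "i \<in> {1..n}" and t: "t = 0 \<or> t = 1"
  shows "e i \<le> layer_factor * (\<Sum>q\<in>tops \<epsilon>. amp ^ q * e q * profile \<epsilon> q i * layers \<alpha> (\<epsilon> q) t)"
proof -
  obtain c where c: "c \<in> tops \<epsilon>" "i \<le> c" "\<epsilon> i \<le> \<epsilon> c" "e i \<le> gap ^ n * e c"
    by (rule cluster_top_weight[OF i])
  have c': "c \<in> {1..n}" using c tops_subset by auto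
  \<comment> \<open>Termwise lower bounds: finer layers are estimated with
    \<open>layers \<le> 2\<close>, the cluster top of \<open>i\<close> with
    \<open>layers \<ge> 1\<close> at an end point, and the remaining nonnegative terms by
    zero.\<close>
  define g where "g q = (if q < i then - 2 * damp * gap ^ n * e c * amp ^ q else 0) + (if q = c then amp ^ c * e c else 0)" for q
  have term_ge: "g q \<le> amp ^ q * e q * profile \<epsilon> q i * layers \<alpha> (\<epsilon> q) t" if q: "q \<in> tops \<epsilon>" for q
  proof -
    have q': "q \<in> {1..n}" using q tops_subset by auto
    have A: "0 < amp ^ q" using amp_gt by simp
    consider "q < i" | "i \<le> q" "q = c" | "i \<le> q" "q \<noteq> c" by linarith
    then show ?thesis
    proof cases
      case 1
      have "e q * \<epsilon> q / \<epsilon> i \<le> e i" using emono[OF q' i] 1 pos[OF i] by (simp add: field_simps)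
      also note c(4)
      finally have 2: "e q * \<epsilon> q / \<epsilon> i \<le> gap ^ n * e c" .
      have "layers \<alpha> (\<epsilon> q) t \<le> 2" using t \<alpha> pos[OF q'] by (intro layers_le_2) auto
      then have "(e q * \<epsilon> q / \<epsilon> i) * layers \<alpha> (\<epsilon> q) t \<le> (gap ^ n * e c) * 2"
        using 2 epos[OF q'] pos[OF q'] pos[OF i] by (intro mult_mono') (auto intro: less_imp_le)
      then have "(amp ^ q * damp) * ((e q * \<epsilon> q / \<epsilon> i) * layers \<alpha> (\<epsilon> q) t) \<le> (amp ^ q * damp) * ((gap ^ n * e c) * 2)"
        using A damp_pos by (intro mult_left_mono) auto
      then show ?thesis using 1 c by (simp add: g_def profile_def algebra_simps)
    next
      case 2
      have "amp ^ q * e q * 1 \<le> amp ^ q * e q * layers \<alpha> (\<epsilon> q) t"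
        using A epos[OF q'] layers_end[OF t] by (intro mult_left_mono) auto
      then show ?thesis using 2 by (simp add: g_def profile_def)
    next
      case 3
      then show ?thesis using A epos[OF q'] by (simp add: g_def profile_def less_imp_le)
    qed
  qed
  have geo: "(amp - 1) * (\<Sum>q<i. amp ^ q) \<le> amp ^ c"
  proof -
    have "(amp - 1) * (\<Sum>q<i. amp ^ q) = amp ^ i - 1" using power_diff_1_eq[of amp i] by simp
    also have "amp ^ i \<le> amp ^ c" using amp_gt c by (intro power_increasing) auto
    finally show ?thesis by linarith
  qed
  have split: "(\<Sum>q\<in>tops \<epsilon>. g q) = - 2 * damp * gap ^ n * e c * (\<Sum>q\<in>{q\<in>tops \<epsilon>. q < i}. amp ^ q) + amp ^ c * e c"
    unfolding g_def sum.distrib using finite_tops c(1)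
    by (simp add: sum.delta sum.If_cases Int_def sum_distrib_left sum_negf)
  have "(\<Sum>q\<in>{q\<in>tops \<epsilon>. q < i}. amp ^ q) \<le> (\<Sum>q<i. amp ^ q)"
    using amp_gt by (intro sum_mono2) auto
  then have "2 * damp * gap ^ n * e c * (\<Sum>q\<in>{q\<in>tops \<epsilon>. q < i}. amp ^ q) \<le> 2 * damp * gap ^ n * e c * (\<Sum>q<i. amp ^ q)"
    using damp_pos gapn_ge epos[OF c'] by (intro mult_left_mono) auto
  also have "\<dots> = e c / 2 * ((amp - 1) * (\<Sum>q<i. amp ^ q))" by (simp add: amp_def)
  also have "\<dots> \<le> e c / 2 * amp ^ c" using geo epos[OF c'] by (intro mult_left_mono) auto
  finally have "e c / 2 * amp ^ c \<le> (\<Sum>q\<in>tops \<epsilon>. g q)" unfolding split by simp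
  also have "\<dots> \<le> (\<Sum>q\<in>tops \<epsilon>. amp ^ q * e q * profile \<epsilon> q i * layers \<alpha> (\<epsilon> q) t)" (is "_ \<le> ?S")
    by (intro sum_mono term_ge)
  finally have "e c / 2 * amp ^ c \<le> ?S" .
  moreover have "e c / 2 * 1 \<le> e c / 2 * amp ^ c"
    using epos[OF c'] amp_gt by (intro mult_left_mono one_le_power) auto
  ultimately have S: "e c / 2 \<le> ?S" by linarith
  have "e i \<le> 2 * gap ^ n * (e c / 2)" using c(4) by simp
  also have "\<dots> \<le> layer_factor * ?S"
    using S layer_factor_ge(1) gapn_ge epos[OF c'] by (intro mult_mono) auto
  finally show ?thesis .
qed

text \<open>The barrier combines the weighted profiles with the constant
  \<open>1 / \<alpha>\<close>, whose row sums cover the constant part of the source. All layers may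
  act as a source, yet only the tail \<open>{i..n}\<close> survives in the conclusion, since the
  profiles of smaller index are nonpositive in component \<open>i\<close>.\<close>

lemma layer_bound:
  assumes s: "\<And>i. i \<in> {1..n} \<Longrightarrow> twice_deriv 0 1 (s i) (s1 i) (s2 i)" and c: "0 \<le> c"
    and bd: "\<And>i t. i \<in> {1..n} \<Longrightarrow> t = 0 \<or> t = 1 \<Longrightarrow> \<bar>s i t\<bar> \<le> c * e i"
    and L: "\<And>i x. i \<in> {1..n} \<Longrightarrow> x \<in> {0<..<1} \<Longrightarrow>
       \<bar>- \<epsilon> i * s2 i x + (\<Sum>j=1..n. A i j x * s j x)\<bar> \<le> c * (1 + weighted {1..n} x)"
    and i: "i \<in> {1..n}" and x: "x \<in> {0..1}"
  shows "\<bar>s i x\<bar> \<le> layer_const * c * (1 + weighted {i..n} x)"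
proof -
  define b where "b i t = c * layer_factor * (1 / \<alpha> + (\<Sum>q\<in>tops \<epsilon>. amp ^ q * e q * profile \<epsilon> q i * layers \<alpha> (\<epsilon> q) t))" for i t
  have "\<exists>L1. twice_deriv 0 1 (layers \<alpha> (\<epsilon> q)) L1 (\<lambda>t. \<alpha> / \<epsilon> q * layers \<alpha> (\<epsilon> q) t)" if "q \<in> tops \<epsilon>" for q
    using twice_deriv_layers[of \<alpha> "\<epsilon> q"] pos tops_subset that \<alpha> by (meson less_imp_le subsetD)
  then obtain L1 where L1: "\<And>q. q \<in> tops \<epsilon> \<Longrightarrow> twice_deriv 0 1 (layers \<alpha> (\<epsilon> q)) (L1 q) (\<lambda>t. \<alpha> / \<epsilon> q * layers \<alpha> (\<epsilon> q) t)"
    by metis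
  \<comment> \<open>The summand \<open>0\<close> is the second derivative of the constant
    \<open>1 / \<alpha>\<close>, kept so that the rule for sums applies literally.\<close>
  define b2 where "b2 i t = c * layer_factor * (0 + (\<Sum>q\<in>tops \<epsilon>. amp ^ q * e q * profile \<epsilon> q i * (\<alpha> / \<epsilon> q * layers \<alpha> (\<epsilon> q) t)))" for i t
  define b1 where "b1 i t = c * layer_factor * (0 + (\<Sum>q\<in>tops \<epsilon>. amp ^ q * e q * profile \<epsilon> q i * L1 q t))" for i t
  have b: "twice_deriv 0 1 (b i) (b1 i) (b2 i)" for i
    unfolding b_def b1_def b2_def
    by (intro twice_deriv_cmult twice_deriv_add twice_deriv_const twice_deriv_sum finite_tops L1)
  have lf: "0 \<le> c * layer_factor" using c layer_factor_ge(3) by simp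
  have row: "c * (1 + weighted {1..n} x) \<le> - \<epsilon> i * b2 i x + (\<Sum>j=1..n. A i j x * b j x)"
    if i: "i \<in> {1..n}" and x: "x \<in> {0<..<1}" for i x
  proof -
    let ?Lb = "- \<epsilon> i * b2 i x + (\<Sum>j=1..n. A i j x * b j x)"
    let ?row = "\<lambda>q. - \<epsilon> i * (\<alpha> / \<epsilon> q) * profile \<epsilon> q i + (\<Sum>j=1..n. A i j x * profile \<epsilon> q j)"
    have x': "x \<in> {0..1}" using x by auto
    define S where "S = weighted (tops \<epsilon>) x"
    have "?Lb
       = c * layer_factor * ((\<Sum>j=1..n. A i j x) / \<alpha> + (\<Sum>q\<in>tops \<epsilon>. amp ^ q * e q * layers \<alpha> (\<epsilon> q) x *
           ?row q))" (is "_ = _ * (_ + ?T)")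
    proof -
      have "(\<Sum>j=1..n. A i j x * b j x) = c * layer_factor * (\<Sum>j=1..n. A i j x * (1 / \<alpha>) +
         (\<Sum>q\<in>tops \<epsilon>. A i j x * (amp ^ q * e q * profile \<epsilon> q j * layers \<alpha> (\<epsilon> q) x)))"
        by (simp add: b_def sum_distrib_left algebra_simps)
      also have "\<dots> = c * layer_factor * ((\<Sum>j=1..n. A i j x) / \<alpha> +
         (\<Sum>j=1..n. \<Sum>q\<in>tops \<epsilon>. A i j x * (amp ^ q * e q * profile \<epsilon> q j * layers \<alpha> (\<epsilon> q) x)))"
        by (simp add: sum.distrib sum_divide_distrib)
      also have "(\<Sum>j=1..n. \<Sum>q\<in>tops \<epsilon>. A i j x * (amp ^ q * e q * profile \<epsilon> q j * layers \<alpha> (\<epsilon> q) x))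
         = (\<Sum>q\<in>tops \<epsilon>. amp ^ q * e q * layers \<alpha> (\<epsilon> q) x * (\<Sum>j=1..n. A i j x * profile \<epsilon> q j))"
        by (subst sum.swap) (simp add: sum_distrib_left algebra_simps)
      finally have "(\<Sum>j=1..n. A i j x * b j x) = c * layer_factor * ((\<Sum>j=1..n. A i j x) / \<alpha> +
         (\<Sum>q\<in>tops \<epsilon>. amp ^ q * e q * layers \<alpha> (\<epsilon> q) x * (\<Sum>j=1..n. A i j x * profile \<epsilon> q j)))" .
      moreover have "- \<epsilon> i * b2 i x = c * layer_factor * (\<Sum>q\<in>tops \<epsilon>. amp ^ q * e q * layers \<alpha> (\<epsilon> q) x *
           (- \<epsilon> i * (\<alpha> / \<epsilon> q) * profile \<epsilon> q i))"
        by (simp add: b2_def sum_distrib_left sum_negf algebra_simps)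
      ultimately show ?thesis by (simp only: distrib_left sum.distrib)
    qed
    moreover have "1 + \<eta> * S \<le> (\<Sum>j=1..n. A i j x) / \<alpha> + ?T"
    proof (rule add_mono)
      show "1 \<le> (\<Sum>j=1..n. A i j x) / \<alpha>" using rowsum[OF x' i] \<alpha> \<eta> by (simp add: field_simps)
      show "\<eta> * S \<le> ?T"
        unfolding S_def sum_distrib_left
      proof (rule sum_mono)
        fix q assume q: "q \<in> tops \<epsilon>"
        then have eq: "0 < e q" using epos tops_subset by auto
        have "\<eta> * (e q * layers \<alpha> (\<epsilon> q) x) = 1 * (e q * layers \<alpha> (\<epsilon> q) x) * \<eta>" by simp
        also have "\<dots> \<le> amp ^ q * (e q * layers \<alpha> (\<epsilon> q) x) *
            ?row q"
          using profile_row[OF pos mono q i x'] amp_gt \<eta> eq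
          by (intro mult_mono mult_right_mono one_le_power mult_nonneg_nonneg) (auto intro: less_imp_le)
        finally show "\<eta> * (e q * layers \<alpha> (\<epsilon> q) x) \<le> amp ^ q * e q * layers \<alpha> (\<epsilon> q) x *
            ?row q"
          by (simp add: mult.assoc)
      qed
    qed
    ultimately have "c * layer_factor * (1 + \<eta> * S) \<le> ?Lb"
      using mult_left_mono[OF _ lf] by presburger
    moreover have "c * (1 + weighted {1..n} x) \<le> c * (layer_factor * (1 + \<eta> * S))"
    proof (rule mult_left_mono[OF _ c])
      have "0 \<le> e q" if "q \<in> tops \<epsilon>" for q using epos tops_subset that by (meson less_imp_le subsetD)
      then have S0: "0 \<le> S" unfolding S_def
        by (intro sum_nonneg mult_nonneg_nonneg) (auto intro: less_imp_le)
      have "weighted {1..n} x \<le> n * gap ^ n * S"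
        unfolding S_def by (rule sum_layers_le_tops[OF x'])
      also have "\<dots> \<le> layer_factor * \<eta> * S" by (rule mult_right_mono[OF layer_factor_ge(2) S0])
      finally show "1 + weighted {1..n} x \<le> layer_factor * (1 + \<eta> * S)"
        using layer_factor_ge(3) by (simp add: distrib_left mult.assoc)
    qed
    ultimately show ?thesis by (simp add: mult.assoc)
  qed
  have "\<bar>s i x\<bar> \<le> b i x"
  proof (rule comparison[where \<epsilon> = \<epsilon>, OF pos s b _ _ i x])
    fix i t assume i: "i \<in> {1..n}" and t: "t = 0 \<or> t = (1::real)"
    have "\<bar>s i t\<bar> \<le> c * e i" by (rule bd[OF i t])
    also have "\<dots> \<le> c * (layer_factor * (\<Sum>q\<in>tops \<epsilon>. amp ^ q * e q * profile \<epsilon> q i * layers \<alpha> (\<epsilon> q) t))"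
      by (rule mult_left_mono[OF barrier_at_end[OF i t] c])
    also have "\<dots> \<le> b i t" using lf \<alpha> by (simp add: b_def distrib_left mult.assoc)
    finally show "\<bar>s i t\<bar> \<le> b i t" .
  next
    fix i x assume "i \<in> {1..n}" "x \<in> {0<..<1::real}"
    from order_trans[OF L[OF this] row[OF this]]
    show "\<bar>- \<epsilon> i * s2 i x + (\<Sum>j=1..n. A i j x * s j x)\<bar> \<le> - \<epsilon> i * b2 i x + (\<Sum>j=1..n. A i j x * b j x)" .
  qed
  also have "b i x \<le> c * layer_factor * (1 / \<alpha> + amp ^ n * weighted {i..n} x)"
  proof -
    \<comment> \<open>Here the nonpositive entries with \<open>q < i\<close> are discarded.\<close>
    have "(\<Sum>q\<in>tops \<epsilon>. amp ^ q * e q * profile \<epsilon> q i * layers \<alpha> (\<epsilon> q) x)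
       \<le> (\<Sum>q\<in>tops \<epsilon>. if i \<le> q then amp ^ n * (e q * layers \<alpha> (\<epsilon> q) x) else 0)"
    proof (rule sum_mono)
      fix q assume "q \<in> tops \<epsilon>"
      then have q: "q \<in> {1..n}" using tops_subset by auto
      show "amp ^ q * e q * profile \<epsilon> q i * layers \<alpha> (\<epsilon> q) x \<le> (if i \<le> q then amp ^ n * (e q * layers \<alpha> (\<epsilon> q) x) else 0)"
      proof (cases "i \<le> q")
        case True
        have "amp ^ q * (e q * layers \<alpha> (\<epsilon> q) x) \<le> amp ^ n * (e q * layers \<alpha> (\<epsilon> q) x)"
          using amp_gt q epos[OF q] by (intro mult_right_mono power_increasing) (auto intro: less_imp_le)
        then show ?thesis using True by (simp add: profile_def mult.assoc)
      next
        case False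
        then show ?thesis using amp_gt epos[OF q] damp_pos pos[OF q] pos[OF i]
          by (simp add: profile_def zero_le_mult_iff less_imp_le)
      qed
    qed
    also have "\<dots> = (\<Sum>q\<in>{q\<in>tops \<epsilon>. i \<le> q}. amp ^ n * (e q * layers \<alpha> (\<epsilon> q) x))"
      using finite_tops by (simp add: sum.If_cases Int_def)
    also have "\<dots> \<le> (\<Sum>q=i..n. amp ^ n * (e q * layers \<alpha> (\<epsilon> q) x))"
      using tops_subset i amp_gt epos
      by (intro sum_mono2) (auto intro!: mult_nonneg_nonneg intro: less_imp_le epos simp: less_imp_le)
    finally show ?thesis
      unfolding b_def using lf by (intro mult_left_mono add_left_mono) (auto simp: sum_distrib_left)
  qed
  also have "\<dots> \<le> c * layer_factor * ((1 / \<alpha> + amp ^ n) * (1 + weighted {i..n} x))"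
  proof (rule mult_left_mono[OF _ lf])
    have "0 \<le> weighted {i..n} x"
      using i epos by (intro sum_nonneg mult_nonneg_nonneg) (auto intro: less_imp_le)
    moreover have "0 < 1 / \<alpha>" "0 < amp ^ n" using \<alpha> amp_gt by auto
    ultimately show "1 / \<alpha> + amp ^ n * weighted {i..n} x
        \<le> (1 / \<alpha> + amp ^ n) * (1 + weighted {i..n} x)"
      by (simp add: distrib_left distrib_right)
  qed
  finally show ?thesis by (simp add: layer_const_def mult.assoc mult.left_commute)
qed

end

end

subsection \<open>A priori bounds\<close>

lemma twice_deriv_mult:
  assumes "twice_deriv a b F F1 F2" "twice_deriv a b G G1 G2"
  shows "twice_deriv a b (\<lambda>t. F t * G t) (\<lambda>t. F1 t * G t + F t * G1 t)
     (\<lambda>t. F2 t * G t + 2 * F1 t * G1 t + F t * G2 t)"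
  using assms
  by (auto simp: twice_deriv_def algebra_simps intro!: continuous_intros derivative_eq_intros)

lemma twice_deriv_divide:
  assumes "twice_deriv a b F F1 F2"
  shows "twice_deriv a b (\<lambda>t. F t / c) (\<lambda>t. F1 t / c) (\<lambda>t. F2 t / c)"
  using twice_deriv_cmult[OF assms, of "1 / c"] by simp

text \<open>On an interval of length \<open>sqrt e\<close> some slope is at most
  \<open>2 * M / sqrt e\<close>, and between that point and the end the slope changes by at most
  \<open>sqrt e * (M' / e)\<close>. This length balances the two contributions.\<close>

lemma deriv_bound_left_end:
  assumes F: "twice_deriv 0 1 F F1 F2" and F1: "continuous_on {0..1} F1"
    and e: "0 < e" "e \<le> 1"
    and M: "\<And>t. t \<in> {0..1} \<Longrightarrow> \<bar>F t\<bar> \<le> M" and M': "\<And>t. t \<in> {0<..<1} \<Longrightarrow> \<bar>F2 t\<bar> \<le> M' / e"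
  shows "\<bar>F1 0\<bar> \<le> (2 * M + M') / sqrt e"
proof -
  define l where "l = sqrt e"
  have l: "0 < l" "l \<le> 1" "e = l * l" using e by (auto simp: l_def)
  obtain z where z: "0 < z" "z < l" "F l - F 0 = (l - 0) * F1 z"
    by (rule MVT_deriv[of 0 l F F1])
      (use l twice_derivD[OF F] in \<open>auto intro: continuous_on_subset\<close>)
  obtain w where w: "0 < w" "w < z" "F1 z - F1 0 = (z - 0) * F2 w"
    by (rule MVT_deriv[of 0 z F1 F2])
      (use l z F1 twice_derivD[OF F] in \<open>auto intro: continuous_on_subset\<close>)
  have "l * \<bar>F1 z\<bar> \<le> 2 * M" using z(3) l M[of l] M[of 0] by (auto simp: abs_mult[symmetric])
  moreover have "l * \<bar>F1 z - F1 0\<bar> \<le> M'"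
  proof -
    have "l * \<bar>F1 z - F1 0\<bar> = l * z * \<bar>F2 w\<bar>" using w z by (simp add: abs_mult)
    also have "\<dots> \<le> l * l * (M' / e)" using M'[of w] w z l by (intro mult_mono) auto
    finally show ?thesis using l by simp
  qed
  moreover have "l * \<bar>F1 0\<bar> \<le> l * \<bar>F1 z\<bar> + l * \<bar>F1 z - F1 0\<bar>"
    using l by (simp add: distrib_left[symmetric])
  ultimately show ?thesis using l by (simp add: l_def[symmetric] field_simps)
qed

lemma deriv_bound_ends:
  assumes F: "twice_deriv 0 1 F F1 F2" and F1: "continuous_on {0..1} F1"
    and e: "0 < e" "e \<le> 1"
    and M: "\<And>t. t \<in> {0..1} \<Longrightarrow> \<bar>F t\<bar> \<le> M" and M': "\<And>t. t \<in> {0<..<1} \<Longrightarrow> \<bar>F2 t\<bar> \<le> M' / e"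
    and t: "t = 0 \<or> t = 1"
  shows "\<bar>F1 t\<bar> \<le> (2 * M + M') / sqrt e"
  using t
proof
  assume "t = 1"
  have "\<bar>-1 * F1 (1 + (-1) * 0)\<bar> \<le> (2 * M + M') / sqrt e"
  proof (rule deriv_bound_left_end[OF twice_deriv_affine[OF F, of "-1" 0 1 1] _ e])
    show "continuous_on {0..1} (\<lambda>s. - 1 * F1 (1 + - 1 * s))"
      by (intro continuous_intros continuous_on_compose2[OF F1]) auto
  qed (use M M' in auto)
  then show ?thesis using \<open>t = 1\<close> by simp
qed (use deriv_bound_left_end[OF assms(1-6)] in simp)

text \<open>Two derivatives of the data enter because the system is differentiated twice. A single
  constant \<open>a\<close> bounds all of them, so the constants below depend only on
  \<open>n\<close>, \<alpha>, \<eta> and \<open>a\<close>.\<close>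

locale reaction_data = reaction_matrix +
  fixes A1 A2 :: "nat \<Rightarrow> nat \<Rightarrow> real \<Rightarrow> real" and f f1 f2 :: "nat \<Rightarrow> real \<Rightarrow> real"
  assumes A_deriv: "\<And>i j. i \<in> {1..n} \<Longrightarrow> j \<in> {1..n} \<Longrightarrow> twice_deriv 0 1 (A i j) (A1 i j) (A2 i j)"
    and f_deriv: "\<And>i. i \<in> {1..n} \<Longrightarrow> twice_deriv 0 1 (f i) (f1 i) (f2 i)"
    and A1_bound: "\<And>i j x. i \<in> {1..n} \<Longrightarrow> j \<in> {1..n} \<Longrightarrow> x \<in> {0..1} \<Longrightarrow> \<bar>A1 i j x\<bar> \<le> a"
    and A2_bound: "\<And>i j x. i \<in> {1..n} \<Longrightarrow> j \<in> {1..n} \<Longrightarrow> x \<in> {0..1} \<Longrightarrow> \<bar>A2 i j x\<bar> \<le> a"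
    and f_bound: "\<And>i x. i \<in> {1..n} \<Longrightarrow> x \<in> {0..1} \<Longrightarrow> \<bar>f i x\<bar> \<le> a"
    and f1_bound: "\<And>i x. i \<in> {1..n} \<Longrightarrow> x \<in> {0..1} \<Longrightarrow> \<bar>f1 i x\<bar> \<le> a"
    and f2_bound: "\<And>i x. i \<in> {1..n} \<Longrightarrow> x \<in> {0..1} \<Longrightarrow> \<bar>f2 i x\<bar> \<le> a"
begin

lemma sum_row_bound:
  assumes "\<And>j. j \<in> {1..n} \<Longrightarrow> \<bar>c j\<bar> \<le> a" "\<And>j. j \<in> {1..n} \<Longrightarrow> \<bar>v j\<bar> \<le> M"
  shows "\<bar>\<Sum>j=1..n. c j * v j\<bar> \<le> n * a * M"
proof -
  have "\<bar>\<Sum>j=1..n. c j * v j\<bar> \<le> (\<Sum>j=1..n. \<bar>c j * v j\<bar>)" by (rule sum_abs)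
  also have "\<dots> \<le> (\<Sum>j=1..n. a * M)"
  proof (rule sum_mono)
    fix j assume j: "j \<in> {1..n}"
    show "\<bar>c j * v j\<bar> \<le> a * M"
      unfolding abs_mult using assms(1,2)[OF j] by (intro mult_mono) auto
  qed
  finally show ?thesis by (simp add: mult.assoc)
qed

text \<open>Boundary values plus source divided by \<alpha>: a constant supersolution of the
  original system.\<close>

definition sol_bound :: real where "sol_bound = a + a / \<alpha>"
definition residual_bound :: real where "residual_bound = n * a * sol_bound + a"
definition slope_bound :: real where
  "slope_bound = layer_const * (2 * sol_bound + residual_bound)"
text \<open>Bounds the lower order terms \<open>f'' - A'' u - 2 A' u'\<close> that remain when the
  system is differentiated twice.\<close>

definition source_bound :: real where
  "source_bound = residual_bound + 2 * (n * a * slope_bound)"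
definition curvature_bound :: real where
  "curvature_bound = source_bound + (n * a + 1) * (layer_const * source_bound)"

lemma a_pos: "0 < a" using a_ge \<alpha> \<eta> by linarith

lemma bounds_nonneg:
  "0 < sol_bound" "0 < residual_bound" "0 < slope_bound" "0 < source_bound" "0 < curvature_bound"
proof -
  show 1: "0 < sol_bound" using a_pos \<alpha> by (simp add: sol_bound_def add_pos_pos)
  show 2: "0 < residual_bound" using 1 a_pos by (simp add: residual_bound_def add_nonneg_pos)
  show 3: "0 < slope_bound" using 1 2 layer_const_pos by (simp add: slope_bound_def)
  show 4: "0 < source_bound" using 2 3 a_pos by (simp add: source_bound_def add_pos_nonneg)
  show "0 < curvature_bound" using 4 a_pos layer_const_pos by (simp add: curvature_bound_def add_pos_nonneg)
qed

text \<open>\<open>y i\<close> stands for \<open>\<epsilon> i\<close> times the second derivative of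
  \<open>u i\<close>. Its derivatives \<open>y1\<close> and \<open>y2\<close> are computed from
  \<open>A u - f\<close>, with second derivatives of \<open>u\<close> replaced by
  \<open>y j / \<epsilon> j\<close> once more, so the equation itself supplies the higher
  regularity.\<close>

context
  fixes \<epsilon> :: "nat \<Rightarrow> real" and u u1 y y1 y2 :: "nat \<Rightarrow> real \<Rightarrow> real"
  assumes pos: "\<And>i. i \<in> {1..n} \<Longrightarrow> 0 < \<epsilon> i" and le1: "\<And>i. i \<in> {1..n} \<Longrightarrow> \<epsilon> i \<le> 1"
    and mono: "\<And>i j. i \<in> {1..n} \<Longrightarrow> j \<in> {1..n} \<Longrightarrow> i \<le> j \<Longrightarrow> \<epsilon> i \<le> \<epsilon> j"
    and y_eq: "\<And>i x. y i x = (\<Sum>j=1..n. A i j x * u j x) - f i x"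
    and y1_eq: "\<And>i x. y1 i x = (\<Sum>j=1..n. A1 i j x * u j x + A i j x * u1 j x) - f1 i x"
    and y2_eq: "\<And>i x. y2 i x =
      (\<Sum>j=1..n. A2 i j x * u j x + 2 * A1 i j x * u1 j x + A i j x * (y j x / \<epsilon> j)) - f2 i x"
    and u_deriv: "\<And>i. i \<in> {1..n} \<Longrightarrow> twice_deriv 0 1 (u i) (u1 i) (\<lambda>x. y i x / \<epsilon> i)"
    and u1_cont: "\<And>i. i \<in> {1..n} \<Longrightarrow> continuous_on {0..1} (u1 i)"
    and u_end: "\<And>i t. i \<in> {1..n} \<Longrightarrow> t = 0 \<or> t = 1 \<Longrightarrow> \<bar>u i t\<bar> \<le> a"
begin

lemma y_deriv:
  assumes i: "i \<in> {1..n}" shows "twice_deriv 0 1 (y i) (y1 i) (y2 i)"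
proof -
  have e: "y i = (\<lambda>x. (\<Sum>j=1..n. A i j x * u j x) - f i x)"
    "y1 i = (\<lambda>x. (\<Sum>j=1..n. A1 i j x * u j x + A i j x * u1 j x) - f1 i x)"
    "y2 i = (\<lambda>x. (\<Sum>j=1..n. A2 i j x * u j x + 2 * A1 i j x * u1 j x + A i j x * (y j x / \<epsilon> j)) - f2 i x)"
    by (rule ext, rule y_eq y1_eq y2_eq)+
  have sm: "twice_deriv 0 1 (\<lambda>x. \<Sum>j=1..n. A i j x * u j x) (\<lambda>x. \<Sum>j=1..n. A1 i j x * u j x + A i j x * u1 j x)
     (\<lambda>x. \<Sum>j=1..n. A2 i j x * u j x + 2 * A1 i j x * u1 j x + A i j x * (y j x / \<epsilon> j))"
    by (rule twice_deriv_sum[OF finite_atLeastAtMost]) (rule twice_deriv_mult[OF A_deriv[OF i] u_deriv])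
  show ?thesis
    using twice_deriv_diff[OF sm f_deriv[OF i]] unfolding e[symmetric] .
qed

lemma u_bound:
  assumes "i \<in> {1..n}" "x \<in> {0..1}" shows "\<bar>u i x\<bar> \<le> sol_bound"
proof (rule comparison[where \<epsilon> = \<epsilon> and b = "\<lambda>_ _. sol_bound" and ?b1.0 = "\<lambda>_ _. 0" and ?b2.0 = "\<lambda>_ _. 0"
      and s = u and ?s1.0 = u1 and ?s2.0 = "\<lambda>i x. y i x / \<epsilon> i", OF pos u_deriv twice_deriv_const _ _ assms])
  fix i t assume "i \<in> {1..n}" "t = 0 \<or> t = (1::real)"
  then have "\<bar>u i t\<bar> \<le> a" by (rule u_end)
  then show "\<bar>u i t\<bar> \<le> sol_bound" using divide_pos_pos[OF a_pos \<alpha>] by (simp add: sol_bound_def)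
next
  fix i x assume i: "i \<in> {1..n}" and x: "x \<in> {0<..<1::real}"
  have "\<bar>- \<epsilon> i * (y i x / \<epsilon> i) + (\<Sum>j=1..n. A i j x * u j x)\<bar> = \<bar>f i x\<bar>"
    using pos[OF i] by (simp add: y_eq)
  also have "\<dots> \<le> a" using f_bound i x by simp
  also have "\<dots> \<le> \<alpha> * sol_bound" using a_pos \<alpha> by (simp add: sol_bound_def distrib_left)
  also have "\<dots> \<le> (\<Sum>j=1..n. A i j x) * sol_bound"
    using rowsum[of x i] i x \<eta> bounds_nonneg by (intro mult_right_mono) auto
  finally show "\<bar>- \<epsilon> i * (y i x / \<epsilon> i) + (\<Sum>j=1..n. A i j x * u j x)\<bar>
     \<le> - \<epsilon> i * 0 + (\<Sum>j=1..n. A i j x * sol_bound)"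
    by (simp add: sum_distrib_right)
qed

lemma y_crude_bound:
  assumes i: "i \<in> {1..n}" and x: "x \<in> {0..1}" shows "\<bar>y i x\<bar> \<le> residual_bound"
proof -
  have "\<bar>\<Sum>j=1..n. A i j x * u j x\<bar> \<le> n * a * sol_bound"
    by (rule sum_row_bound[OF bound[OF x i] u_bound[OF _ x]])
  then show ?thesis using f_bound[OF i x] by (simp add: y_eq residual_bound_def)
qed

text \<open>The derivative of \<open>u\<close> solves the same system with source
  \<open>f' - A' u\<close>, bounded by \<open>residual_bound\<close>; the weights come from the
  slope bounds at the end points.\<close>

lemma u1_bound:
  assumes i: "i \<in> {1..n}" and x: "x \<in> {0..1}"
  shows "\<bar>u1 i x\<bar> \<le> slope_bound * (1 + (\<Sum>q=i..n. 1 / sqrt (\<epsilon> q) * layers \<alpha> (\<epsilon> q) x))"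
  unfolding slope_bound_def
proof (rule layer_bound[where \<epsilon> = \<epsilon> and s = u1 and ?s1.0 = "\<lambda>i x. y i x / \<epsilon> i" and ?s2.0 = "\<lambda>i x. y1 i x / \<epsilon> i"
      and e = "\<lambda>q. 1 / sqrt (\<epsilon> q)", OF pos mono _ _ _ _ _ _ i x])
  fix i assume i: "i \<in> {1..n}"
  show "0 < 1 / sqrt (\<epsilon> i)" using pos[OF i] by simp
  show "twice_deriv 0 1 (u1 i) (\<lambda>x. y i x / \<epsilon> i) (\<lambda>x. y1 i x / \<epsilon> i)"
    using u1_cont[OF i] twice_derivD(3)[OF u_deriv[OF i]] twice_derivD(2)[OF twice_deriv_divide[OF y_deriv[OF i], of "\<epsilon> i"]]
    by (auto simp: twice_deriv_def)
next
  fix i j assume "i \<in> {1..n}" "j \<in> {1..n}" "i \<le> j"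
  then show "1 / sqrt (\<epsilon> i) * \<epsilon> i \<le> 1 / sqrt (\<epsilon> j) * \<epsilon> j"
    using mono[of i j] pos by (simp add: real_div_sqrt less_imp_le)
next
  show "0 \<le> 2 * sol_bound + residual_bound" using bounds_nonneg by simp
next
  fix i t assume i: "i \<in> {1..n}" and t: "t = 0 \<or> t = (1::real)"
  have "\<bar>u1 i t\<bar> \<le> (2 * sol_bound + residual_bound) / sqrt (\<epsilon> i)"
  proof (rule deriv_bound_ends[OF u_deriv[OF i] u1_cont[OF i] pos[OF i] le1[OF i] u_bound[OF i] _ t])
    fix t :: real assume "t \<in> {0<..<1}"
    then show "\<bar>y i t / \<epsilon> i\<bar> \<le> residual_bound / \<epsilon> i"
      using y_crude_bound[OF i, of t] pos[OF i] by (simp add: divide_right_mono)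
  qed
  then show "\<bar>u1 i t\<bar> \<le> (2 * sol_bound + residual_bound) * (1 / sqrt (\<epsilon> i))" by simp
next
  fix i x assume i: "i \<in> {1..n}" and x: "x \<in> {0<..<1::real}"
  then have x': "x \<in> {0..1}" by auto
  have "- \<epsilon> i * (y1 i x / \<epsilon> i) + (\<Sum>j=1..n. A i j x * u1 j x) = f1 i x - (\<Sum>j=1..n. A1 i j x * u j x)"
    using pos[OF i] by (simp add: y1_eq sum.distrib)
  moreover have "\<bar>\<Sum>j=1..n. A1 i j x * u j x\<bar> \<le> n * a * sol_bound"
    by (rule sum_row_bound[OF A1_bound[OF i _ x'] u_bound[OF _ x']])
  ultimately have "\<bar>- \<epsilon> i * (y1 i x / \<epsilon> i) + (\<Sum>j=1..n. A i j x * u1 j x)\<bar> \<le> residual_bound"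
    using f1_bound[OF i x'] by (simp add: residual_bound_def)
  also have "\<dots> \<le> (2 * sol_bound + residual_bound) * 1" using bounds_nonneg by simp
  also have "\<dots> \<le> (2 * sol_bound + residual_bound) * (1 + (\<Sum>q=1..n. 1 / sqrt (\<epsilon> q) * layers \<alpha> (\<epsilon> q) x))"
  proof (rule mult_left_mono)
    have "0 \<le> (\<Sum>q=1..n. 1 / sqrt (\<epsilon> q) * layers \<alpha> (\<epsilon> q) x)"
      by (rule sum_nonneg) (use pos in \<open>simp add: less_imp_le\<close>)
    then show "1 \<le> 1 + (\<Sum>q=1..n. 1 / sqrt (\<epsilon> q) * layers \<alpha> (\<epsilon> q) x)" by simp
  qed (use bounds_nonneg in simp)
  finally show "\<bar>- \<epsilon> i * (y1 i x / \<epsilon> i) + (\<Sum>j=1..n. A i j x * u1 j x)\<bar>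
     \<le> (2 * sol_bound + residual_bound) * (1 + (\<Sum>q=1..n. 1 / sqrt (\<epsilon> q) * layers \<alpha> (\<epsilon> q) x))" .
qed

lemma scaled_layers_nonneg: "q \<in> {1..n} \<Longrightarrow> 0 \<le> layers \<alpha> (\<epsilon> q) x / \<epsilon> q"
  using pos by (simp add: less_imp_le)

lemma sum_scaled_layers_nonneg: "i \<in> {1..n} \<Longrightarrow> 0 \<le> layer_load \<alpha> \<epsilon> {i..n} x"
  by (intro sum_nonneg scaled_layers_nonneg) auto

lemma tail_sum_le:
  assumes i: "i \<in> {1..n}"
  shows "layer_load \<alpha> \<epsilon> {i..n} x \<le> layer_load \<alpha> \<epsilon> {1..n} x"
  using i scaled_layers_nonneg by (intro sum_mono2) auto

text \<open>Since \<open>\<epsilon> q \<le> 1\<close>, the weights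
  \<open>1 / sqrt (\<epsilon> q)\<close> are below \<open>1 / \<epsilon> q\<close>. In this form the
  first-order terms are an admissible source in the system for the second derivative.\<close>

lemma u1_bound_weak:
  assumes i: "i \<in> {1..n}" and x: "x \<in> {0..1}"
  shows "\<bar>u1 i x\<bar> \<le> slope_bound * (1 + layer_load \<alpha> \<epsilon> {1..n} x)"
proof -
  have "(\<Sum>q=i..n. 1 / sqrt (\<epsilon> q) * layers \<alpha> (\<epsilon> q) x) \<le> layer_load \<alpha> \<epsilon> {i..n} x"
  proof (rule sum_mono)
    fix q assume "q \<in> {i..n}"
    then have q: "q \<in> {1..n}" using i by auto
    have "sqrt (\<epsilon> q) * sqrt (\<epsilon> q) \<le> sqrt (\<epsilon> q) * 1" using le1[OF q] pos[OF q] by (intro mult_left_mono) auto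
    then have "\<epsilon> q \<le> sqrt (\<epsilon> q)" using pos[OF q] by simp
    then show "1 / sqrt (\<epsilon> q) * layers \<alpha> (\<epsilon> q) x \<le> layers \<alpha> (\<epsilon> q) x / \<epsilon> q"
      using pos[OF q] by (simp add: frac_le less_imp_le)
  qed
  also note tail_sum_le[OF i, of x]
  finally have "slope_bound * (1 + (\<Sum>q=i..n. 1 / sqrt (\<epsilon> q) * layers \<alpha> (\<epsilon> q) x))
      \<le> slope_bound * (1 + layer_load \<alpha> \<epsilon> {1..n} x)"
    using bounds_nonneg by (intro mult_left_mono) auto
  with u1_bound[OF i x] show ?thesis by linarith
qed

lemma lower_order_bound:
  assumes i: "i \<in> {1..n}" and x: "x \<in> {0..1}"
  shows "\<bar>f2 i x - (\<Sum>j=1..n. A2 i j x * u j x) - 2 * (\<Sum>j=1..n. A1 i j x * u1 j x)\<bar>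
    \<le> source_bound * (1 + layer_load \<alpha> \<epsilon> {1..n} x)"
proof -
  define S where "S = 1 + layer_load \<alpha> \<epsilon> {1..n} x"
  have S: "1 \<le> S" unfolding S_def using sum_scaled_layers_nonneg[of 1 x] n by simp
  have "\<bar>\<Sum>j=1..n. A2 i j x * u j x\<bar> \<le> n * a * sol_bound"
    by (rule sum_row_bound[OF A2_bound[OF i _ x] u_bound[OF _ x]])
  moreover have "\<bar>\<Sum>j=1..n. A1 i j x * u1 j x\<bar> \<le> n * a * (slope_bound * S)"
    unfolding S_def by (rule sum_row_bound[OF A1_bound[OF i _ x] u1_bound_weak[OF _ x]])
  moreover have triangle: "\<bar>p - q - 2 * r\<bar> \<le> (X + Z) * 1 + 2 * Y" if "\<bar>p\<bar> \<le> Z" "\<bar>q\<bar> \<le> X" "\<bar>r\<bar> \<le> Y"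
    for p q r X Y Z :: real using that unfolding abs_le_iff by auto
  ultimately have "\<bar>f2 i x - (\<Sum>j=1..n. A2 i j x * u j x) - 2 * (\<Sum>j=1..n. A1 i j x * u1 j x)\<bar>
     \<le> residual_bound * 1 + 2 * (n * a * (slope_bound * S))"
    using f2_bound[OF i x] triangle[of "f2 i x"] unfolding residual_bound_def by blast
  also have "\<dots> \<le> residual_bound * S + 2 * (n * a * (slope_bound * S))"
    using S bounds_nonneg by (intro add_right_mono mult_left_mono) auto
  also have "\<dots> = source_bound * S" by (simp add: source_bound_def algebra_simps)
  finally show ?thesis unfolding S_def .
qed

text \<open>The second derivative of \<open>u\<close> solves the system up to lower order terms, and
  the equation bounds its end values by a multiple of \<open>1 / \<epsilon> i\<close>. With the
  weights \<open>1 / \<epsilon> q\<close> all products \<open>e q * \<epsilon> q\<close> equal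
  1.\<close>

lemma y_bound:
  assumes i: "i \<in> {1..n}" and x: "x \<in> {0..1}"
  shows "\<bar>y i x / \<epsilon> i\<bar> \<le> layer_const * source_bound * (1 + layer_load \<alpha> \<epsilon> {i..n} x)"
proof -
  have "\<bar>y i x / \<epsilon> i\<bar> \<le> layer_const * source_bound * (1 + (\<Sum>q=i..n. 1 / \<epsilon> q * layers \<alpha> (\<epsilon> q) x))"
  proof (rule layer_bound[where \<epsilon> = \<epsilon> and s = "\<lambda>i x. y i x / \<epsilon> i" and ?s1.0 = "\<lambda>i x. y1 i x / \<epsilon> i"
        and ?s2.0 = "\<lambda>i x. y2 i x / \<epsilon> i" and e = "\<lambda>q. 1 / \<epsilon> q",
        OF pos mono _ _ _ _ _ _ i x])
    fix i assume i: "i \<in> {1..n}"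
    show "0 < 1 / \<epsilon> i" using pos[OF i] by simp
    show "twice_deriv 0 1 (\<lambda>x. y i x / \<epsilon> i) (\<lambda>x. y1 i x / \<epsilon> i) (\<lambda>x. y2 i x / \<epsilon> i)"
      by (rule twice_deriv_divide[OF y_deriv[OF i]])
  next
    fix i j assume "i \<in> {1..n}" "j \<in> {1..n}" "i \<le> j"
    then show "1 / \<epsilon> i * \<epsilon> i \<le> 1 / \<epsilon> j * \<epsilon> j" using pos by (simp add: less_imp_neq[symmetric])
  next
    show "0 \<le> source_bound" using bounds_nonneg by simp
  next
    fix i t assume i: "i \<in> {1..n}" and t: "t = 0 \<or> t = (1::real)"
    have "\<bar>y i t\<bar> \<le> residual_bound" using y_crude_bound[OF i, of t] t by auto
    also have "\<dots> \<le> source_bound" using bounds_nonneg a_pos by (simp add: source_bound_def)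
    finally show "\<bar>y i t / \<epsilon> i\<bar> \<le> source_bound * (1 / \<epsilon> i)"
      using pos[OF i] by (simp add: divide_right_mono)
  next
    fix i x assume i: "i \<in> {1..n}" and x: "x \<in> {0<..<1::real}"
    then have x': "x \<in> {0..1}" by auto
    have "- \<epsilon> i * (y2 i x / \<epsilon> i) + (\<Sum>j=1..n. A i j x * (y j x / \<epsilon> j))
       = f2 i x - (\<Sum>j=1..n. A2 i j x * u j x) - 2 * (\<Sum>j=1..n. A1 i j x * u1 j x)"
      using pos[OF i] by (simp add: y2_eq sum.distrib sum_distrib_left mult.assoc)
    then show "\<bar>- \<epsilon> i * (y2 i x / \<epsilon> i) + (\<Sum>j=1..n. A i j x * (y j x / \<epsilon> j))\<bar>
       \<le> source_bound * (1 + (\<Sum>q=1..n. 1 / \<epsilon> q * layers \<alpha> (\<epsilon> q) x))"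
      using lower_order_bound[OF i x'] by simp
  qed
  then show ?thesis by simp
qed

lemma y_layer_bound:
  assumes i: "i \<in> {1..n}" and x: "x \<in> {0..1}"
  shows "\<bar>y i x\<bar> \<le> curvature_bound * (\<epsilon> i * (1 + layer_load \<alpha> \<epsilon> {i..n} x))"
proof -
  have S: "0 \<le> layer_load \<alpha> \<epsilon> {i..n} x" by (rule sum_scaled_layers_nonneg[OF i])
  have "0 \<le> (n * a) * (layer_const * source_bound)"
    using a_pos layer_const_pos bounds_nonneg by (intro mult_nonneg_nonneg) auto
  then have "layer_const * source_bound \<le> curvature_bound"
    unfolding curvature_bound_def using bounds_nonneg(4) by (simp add: distrib_right)
  with S have "layer_const * source_bound * (1 + layer_load \<alpha> \<epsilon> {i..n} x)
     \<le> curvature_bound * (1 + layer_load \<alpha> \<epsilon> {i..n} x)"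
    by (intro mult_right_mono) auto
  with y_bound[OF i x] have "\<bar>y i x / \<epsilon> i\<bar> \<le> curvature_bound * (1 + layer_load \<alpha> \<epsilon> {i..n} x)"
    by linarith
  then show ?thesis using pos[OF i] by (simp add: pos_divide_le_eq mult.assoc mult.commute mult.left_commute)
qed

text \<open>All layers appear here, unlike in the bound for \<open>y i\<close>, because the row in
  \<open>y2\<close> couples component \<open>i\<close> to the second derivatives of the finer
  components.\<close>

lemma y2_layer_bound:
  assumes i: "i \<in> {1..n}" and x: "x \<in> {0..1}"
  shows "\<bar>y2 i x\<bar> \<le> curvature_bound * (1 + layer_load \<alpha> \<epsilon> {1..n} x)"
proof -
  define S where "S = 1 + layer_load \<alpha> \<epsilon> {1..n} x"
  have S: "1 \<le> S" unfolding S_def using sum_scaled_layers_nonneg[of 1 x] n by simp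
  have lc: "0 \<le> layer_const * source_bound" using layer_const_pos bounds_nonneg by simp
  have "\<bar>\<Sum>j=1..n. A i j x * (y j x / \<epsilon> j)\<bar> \<le> n * a * (layer_const * source_bound * S)"
  proof (rule sum_row_bound[OF bound[OF x i]])
    fix j assume j: "j \<in> {1..n}"
    have "layer_const * source_bound * (1 + layer_load \<alpha> \<epsilon> {j..n} x) \<le> layer_const * source_bound * S"
      unfolding S_def using lc tail_sum_le[OF j, of x] by (intro mult_left_mono) auto
    with y_bound[OF j x] show "\<bar>y j x / \<epsilon> j\<bar> \<le> layer_const * source_bound * S" by linarith
  qed
  moreover have "y2 i x = (\<Sum>j=1..n. A i j x * (y j x / \<epsilon> j))
      - (f2 i x - (\<Sum>j=1..n. A2 i j x * u j x) - 2 * (\<Sum>j=1..n. A1 i j x * u1 j x))"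
    by (simp add: y2_eq sum.distrib sum_distrib_left mult.assoc)
  ultimately have "\<bar>y2 i x\<bar> \<le> n * a * (layer_const * source_bound * S) + source_bound * S"
    using lower_order_bound[OF i x] unfolding S_def by linarith
  also have "\<dots> \<le> curvature_bound * S"
    using S lc by (simp add: curvature_bound_def algebra_simps)
  finally show ?thesis unfolding S_def .
qed

end

end

subsection \<open>Shishkin meshes\<close>

text \<open>A mesh is coded by the right ends and cell numbers of its uniform pieces, the left end
  being carried along; facts about cells then become inductions over this list.\<close>

fun refine :: "real \<Rightarrow> (real \<times> nat) list \<Rightarrow> real list" where
  "refine a [] = []"
| "refine a ((b, m) # S) = uniform_cells a b m @ refine b S"

fun segments :: "real \<Rightarrow> (real \<times> nat) list \<Rightarrow> (real \<times> real \<times> nat) set" where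
  "segments a [] = {}"
| "segments a ((b, m) # S) = insert (a, b, m) (segments b S)"

fun increasing :: "real \<Rightarrow> (real \<times> nat) list \<Rightarrow> bool" where
  "increasing a [] = True"
| "increasing a ((b, m) # S) \<longleftrightarrow> a < b \<and> 0 < m \<and> increasing b S"

lemma length_uniform_cells [simp]: "length (uniform_cells a b m) = m"
  by (simp add: uniform_cells_def)

lemma nth_uniform_cells: "j < m \<Longrightarrow> uniform_cells a b m ! j = a + real (Suc j) * (b - a) / real m"
  by (simp add: uniform_cells_def del: upt_Suc)

text \<open>Prepending \<open>a\<close> makes the entries \<open>j\<close> and \<open>Suc j\<close>
  the two ends of one cell.\<close>

lemma refine_nth_cell:
  assumes "increasing a S" "j < length (refine a S)"
  shows "\<exists>c d m r. (c, d, m) \<in> segments a S \<and> r < m \<and>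
    (a # refine a S) ! j = c + real r * (d - c) / real m \<and>
    (a # refine a S) ! Suc j = c + real (Suc r) * (d - c) / real m"
  using assms
proof (induction S arbitrary: a j)
  case (Cons s S)
  obtain b m where s: "s = (b, m)" by (cases s)
  have ab: "a < b" "0 < m" "increasing b S" using Cons.prems s by auto
  show ?case
  proof (cases "j < m")
    case True
    have "(a # refine a (s # S)) ! Suc j = a + real (Suc j) * (b - a) / real m"
      using True by (simp add: s nth_append nth_uniform_cells del: of_nat_Suc)
    moreover have "(a # refine a (s # S)) ! j = a + real j * (b - a) / real m"
      using True by (cases j) (simp_all add: s nth_append nth_uniform_cells del: of_nat_Suc)
    ultimately show ?thesis using True by (auto simp: s)
  next
    case False
    define i where "i = j - m"
    have j: "j = m + i" using False by (simp add: i_def)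
    have i: "i < length (refine b S)" using Cons.prems(2) by (simp add: s j)
    have "(a # refine a (s # S)) ! Suc j = (b # refine b S) ! Suc i"
      by (simp add: s j nth_append)
    moreover have "(a # refine a (s # S)) ! j = (b # refine b S) ! i"
    proof (cases i)
      \<comment> \<open>At a junction the left end is the last point of the preceding piece, which
        appears as \<open>a + m * (b - a) / m\<close>.\<close>
      case 0
      obtain m' where "m = Suc m'" using ab by (cases m) auto
      then show ?thesis using 0 ab
        by (simp add: s j nth_append nth_uniform_cells del: of_nat_Suc)
    qed (simp add: s j nth_append)
    ultimately show ?thesis using Cons.IH[OF ab(3) i] by (auto simp: s)
  qed
qed simp

lemma segments_order:
  assumes "increasing a S" "(c, d, m) \<in> segments a S"
  shows "a \<le> c \<and> c < d \<and> d \<in> fst ` set S \<and> m \<in> snd ` set S \<and> (c = a \<or> c \<in> fst ` set S)"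
  using assms
proof (induction S arbitrary: a)
  case (Cons s S)
  then show ?case by (cases s) fastforce
qed simp

lemma increasing_less: "increasing a S \<Longrightarrow> t \<in> fst ` set S \<Longrightarrow> a < t"
proof (induction S arbitrary: a)
  case (Cons s S)
  then show ?case by (cases s) fastforce
qed simp

lemma segments_no_breakpoint:
  assumes "increasing a S" "(c, d, m) \<in> segments a S" "t = a \<or> t \<in> fst ` set S"
  shows "t \<le> c \<or> d \<le> t"
  using assms
proof (induction S arbitrary: a)
  case (Cons s S)
  obtain b k where s: "s = (b, k)" by (cases s)
  have inc: "a < b" "increasing b S" using Cons.prems by (auto simp: s)
  show ?case
  proof (cases "(c, d, m) = (a, b, k)")
    case True
    consider "t = a" | "t = b" | "t \<in> fst ` set S" using Cons.prems(3) s by force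
    then show ?thesis using True increasing_less[OF inc(2), of t] inc(1) by cases simp_all
  next
    case False
    then have "(c, d, m) \<in> segments b S" using Cons.prems by (auto simp: s)
    moreover have "t \<le> b \<or> t \<in> fst ` set S" using Cons.prems(3) inc by (auto simp: s)
    ultimately show ?thesis using Cons.IH[OF inc(2)] segments_order[OF inc(2)] by fastforce
  qed
qed simp

lemma segments_unique:
  assumes "increasing a S" "(c, d, m) \<in> segments a S" "(c', d', m') \<in> segments a S" "c < d'" "c' < d"
  shows "(c, d, m) = (c', d', m')"
  using assms
proof (induction S arbitrary: a)
  case (Cons s S)
  obtain b k where s: "s = (b, k)" by (cases s)
  have inc: "increasing b S" using Cons.prems by (auto simp: s)
  show ?case
    using Cons.prems Cons.IH[OF inc] segments_order[OF inc, of c d m] segments_order[OF inc, of c' d' m']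
    by (auto simp: s)
qed simp

lemma last_refine: "increasing a S \<Longrightarrow> last (a # refine a S) = last (a # map fst S)"
proof (induction S arbitrary: a)
  case (Cons s S)
  obtain b m where s: "s = (b, m)" by (cases s)
  have inc: "0 < m" "increasing b S" using Cons.prems by (auto simp: s)
  have "last (a # refine a (s # S)) = last (b # refine b S)"
  proof (cases "refine b S = []")
    case True
    have "uniform_cells a b m \<noteq> []" using inc by (metis length_uniform_cells list.size(3) less_numeral_extra(3))
    moreover have "last (uniform_cells a b m) = b"
      using inc calculation by (simp add: last_conv_nth nth_uniform_cells)
    ultimately show ?thesis using True by (simp add: s)
  qed (simp add: s)
  then show ?case using Cons.IH[OF inc(2)] by (simp add: s)
qed simp

text \<open>\<open>Z\<close> collects the break points, and \<open>w\<close> is the reciprocal of a lower bound for the number of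
  cells in a uniform piece.\<close>

locale piecewise_uniform_mesh =
  fixes x :: "nat \<Rightarrow> real" and N :: nat and Z :: "real set" and w :: real
  assumes x_0: "x 0 = 0" and x_N: "x N = 1"
    and x_less: "\<And>j. j < N \<Longrightarrow> x j < x (Suc j)"
    and no_breakpoint: "\<And>j t. j < N \<Longrightarrow> t \<in> Z \<Longrightarrow> t \<le> x j \<or> x (Suc j) \<le> t"
    and width_le: "\<And>j s t. j < N \<Longrightarrow> s \<in> Z \<Longrightarrow> t \<in> Z \<Longrightarrow> s \<le> x j \<Longrightarrow> x (Suc j) \<le> t \<Longrightarrow>
       x (Suc j) - x j \<le> (t - s) * w"
    and uniform: "\<And>j. Suc j < N \<Longrightarrow> x (Suc j) \<notin> Z \<Longrightarrow> x (Suc (Suc j)) - x (Suc j) = x (Suc j) - x j"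
    and finite_Z: "finite Z"

lemma refine_piecewise_uniform:
  assumes inc: "increasing 0 S" and len: "length (refine 0 S) = N"
    and last: "last (0 # map fst S) = 1" and M: "\<And>m. m \<in> snd ` set S \<Longrightarrow> M \<le> m" "0 < M"
  shows "piecewise_uniform_mesh (\<lambda>j. (0 # refine 0 S) ! j) N (insert 0 (fst ` set S)) (1 / real M)"
proof -
  define x where "x j = (0 # refine 0 S) ! j" for j
  define Z where "Z = insert 0 (fst ` set S)"
  have cell: "\<exists>c d m r. (c, d, m) \<in> segments 0 S \<and> r < m \<and>
      x j = c + real r * (d - c) / real m \<and> x (Suc j) = c + real (Suc r) * (d - c) / real m"
    if "j < N" for j
    using refine_nth_cell[OF inc, of j] that len by (simp add: x_def)
  have bracket: "c \<le> c + real r * (d - c) / real m \<and> c + real (Suc r) * (d - c) / real m \<le> d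
      \<and> c + real r * (d - c) / real m < c + real (Suc r) * (d - c) / real m"
    if "c < d" "r < m" for c d :: real and r m :: nat
  proof -
    have "real (Suc r) * (d - c) \<le> real m * (d - c)" using that by (intro mult_right_mono) auto
    then have "real (Suc r) * (d - c) / real m \<le> d - c" using that by (simp add: pos_divide_le_eq mult.commute)
    moreover have "real r * (d - c) / real m < real (Suc r) * (d - c) / real m"
      using that by (intro divide_strict_right_mono mult_strict_right_mono) auto
    moreover have "0 \<le> real r * (d - c) / real m" using that by simp
    ultimately show ?thesis by linarith
  qed
  have cellE: "\<exists>c d m r. (c, d, m) \<in> segments 0 S \<and> c < d \<and> M \<le> m \<and> r < m \<and> c \<le> x j \<and> x j < x (Suc j) \<and> x (Suc j) \<le> d
      \<and> x (Suc j) - x j = (d - c) / real m \<and> (\<forall>t\<in>Z. t \<le> c \<or> d \<le> t)"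
    if j: "j < N" for j
  proof -
    obtain c d m r where c: "(c, d, m) \<in> segments 0 S" "r < m"
      "x j = c + real r * (d - c) / real m" "x (Suc j) = c + real (Suc r) * (d - c) / real m"
      using cell[OF j] by blast
    note o = segments_order[OF inc c(1)]
    have "\<forall>t\<in>Z. t \<le> c \<or> d \<le> t" using segments_no_breakpoint[OF inc c(1)] by (auto simp: Z_def)
    moreover have "x (Suc j) - x j = (d - c) / real m"
      using c o by (simp add: field_simps)
    ultimately show ?thesis using o c bracket[of c d r m] M(1)[of m] by (intro exI[of _ c] exI[of _ d] exI[of _ m] exI[of _ r]) auto
  qed
  have segZ: "d \<in> Z \<and> c \<in> Z" if "(c, d, m) \<in> segments 0 S" for c d m
    using segments_order[OF inc that] by (auto simp: Z_def)
  have "piecewise_uniform_mesh x N Z (1 / real M)"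
  proof
    show "x 0 = 0" by (simp add: x_def)
    have "0 # refine 0 S \<noteq> []" by simp
    then have "x N = last (0 # refine 0 S)" using len by (subst last_conv_nth) (auto simp: x_def)
    then show "x N = 1" using last_refine[OF inc] last by simp
    show "finite Z" by (simp add: Z_def)
  next
    fix j assume "j < N" then show "x j < x (Suc j)" using cellE by blast
  next
    fix j t assume "j < N" "t \<in> Z" then show "t \<le> x j \<or> x (Suc j) \<le> t"
      using cellE[of j] by force
  next
    fix j s t assume *: "j < N" "s \<in> Z" "t \<in> Z" "s \<le> x j" "x (Suc j) \<le> t"
    obtain c d m where c: "c < d" "M \<le> m" "c \<le> x j" "x j < x (Suc j)" "x (Suc j) \<le> d"
      "x (Suc j) - x j = (d - c) / real m" "\<forall>t\<in>Z. t \<le> c \<or> d \<le> t"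
      using cellE[OF *(1)] by blast
    \<comment> \<open>No break point lies inside a piece, so two break points that enclose the cell
      also enclose its piece.\<close>
    have "s \<le> c" "d \<le> t" using c(7)[rule_format, OF *(2)] c(7)[rule_format, OF *(3)] * c by linarith+
    then have "(d - c) / real m \<le> (t - s) / real M" using c M by (intro frac_le) auto
    then show "x (Suc j) - x j \<le> (t - s) * (1 / real M)" using c by simp
  next
    fix j assume *: "Suc j < N" "x (Suc j) \<notin> Z"
    obtain c d m where c: "(c, d, m) \<in> segments 0 S" "c \<le> x j" "x j < x (Suc j)" "x (Suc j) \<le> d"
      "x (Suc j) - x j = (d - c) / real m"
      using cellE[of j] * by (metis Suc_lessD)
    obtain c' d' m' where c': "(c', d', m') \<in> segments 0 S" "c' \<le> x (Suc j)" "x (Suc j) < x (Suc (Suc j))"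
      "x (Suc (Suc j)) \<le> d'" "x (Suc (Suc j)) - x (Suc j) = (d' - c') / real m'"
      using cellE[of "Suc j"] * by metis
    \<comment> \<open>Ends of pieces belong to \<open>Z\<close>. A node outside \<open>Z\<close> is
      therefore interior to the pieces of both adjacent cells, which must be the same piece.\<close>
    have "x (Suc j) \<noteq> d" "x (Suc j) \<noteq> c'" using * segZ[OF c(1)] segZ[OF c'(1)] by auto
    then have "(c, d, m) = (c', d', m')" using c c' by (intro segments_unique[OF inc]) auto
    then show "x (Suc (Suc j)) - x (Suc j) = x (Suc j) - x j" using c c' by simp
  qed
  then show ?thesis by (simp add: x_def[abs_def] Z_def)
qed

text \<open>The free tail \<open>S\<close> lets the induction on \<open>n\<close> move the last
  ascending piece into the tail.\<close>

lemma refine_ascending: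
  assumes "1 \<le> n"
  shows "refine (t 1) (map (\<lambda>k. (t (k + 1), M k)) [1..<n] @ S)
    = concat (map (\<lambda>k. uniform_cells (t k) (t (k + 1)) (M k)) [1..<n]) @ refine (t n) S"
  using assms
proof (induction n arbitrary: S rule: dec_induct)
  case (step n)
  then show ?case using step.IH[of "(t (n + 1), M n) # S"] by simp
qed simp

lemma refine_descending:
  assumes "1 \<le> n"
  shows "refine (1 - t n) (map (\<lambda>k. (1 - t k, M k)) (rev [1..<n]) @ S)
    = concat (map (\<lambda>k. uniform_cells (1 - t (k + 1)) (1 - t k) (M k)) (rev [1..<n])) @ refine (1 - t 1) S"
  using assms
proof (induction n rule: dec_induct)
  case (step n)
  then show ?case by simp
qed simp

lemma increasing_ascending:
  assumes "1 \<le> n" "\<And>k. 1 \<le> k \<Longrightarrow> k < n \<Longrightarrow> t k < t (k + 1) \<and> 0 < M k" "increasing (t n) S"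
  shows "increasing (t 1) (map (\<lambda>k. (t (k + 1), M k)) [1..<n] @ S)"
  using assms
proof (induction n arbitrary: S rule: dec_induct)
  case (step n)
  then show ?case using step.IH[of "(t (n + 1), M n) # S"] by simp
qed simp

lemma increasing_descending:
  assumes "1 \<le> n" "\<And>k. 1 \<le> k \<Longrightarrow> k < n \<Longrightarrow> t k < t (k + 1) \<and> 0 < M k" "increasing (1 - t 1) S"
  shows "increasing (1 - t n :: real) (map (\<lambda>k. (1 - t k, M k)) (rev [1..<n]) @ S)"
  using assms
proof (induction n rule: dec_induct)
  case (step n)
  then show ?case by simp
qed simp

section \<open>Geometry of the Shishkin mesh and its relation to the layers\<close>

locale shishkin =
  fixes n :: nat and \<epsilon> :: "nat \<Rightarrow> real" and \<alpha> :: real and p N :: nat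
  assumes n: "1 \<le> n" and \<alpha>: "0 < \<alpha>" and pos: "\<And>i. i \<in> {1..n} \<Longrightarrow> 0 < \<epsilon> i"
    and mono: "\<And>i j. i \<in> {1..n} \<Longrightarrow> j \<in> {1..n} \<Longrightarrow> i \<le> j \<Longrightarrow> \<epsilon> i \<le> \<epsilon> j"
    and N: "N = 2 ^ (n + p + 1)"
begin

abbreviation \<tau> :: "nat \<Rightarrow> real" where "\<tau> \<equiv> transition n \<epsilon> \<alpha> N"
abbreviation lay :: "nat \<Rightarrow> real \<Rightarrow> real" where "lay q \<equiv> layer \<alpha> (\<epsilon> q)"
text \<open>The transition parameter before capping: layer \<open>k\<close> has decayed to
  \<open>1 / N^2\<close> at the distance \<open>\<sigma> k\<close> from its end point.\<close>

definition \<sigma> :: "nat \<Rightarrow> real" where "\<sigma> k = 2 * sqrt (\<epsilon> k / \<alpha>) * ln (real N)"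

lemma N_ge: "4 \<le> N"
proof -
  have "(2::nat) ^ 2 \<le> 2 ^ (n + p + 1)" using n by (intro power_increasing) auto
  then show ?thesis by (simp add: N)
qed

lemma lnN_pos: "0 < ln (real N)" using N_ge by simp

lemma \<sigma>_pos: "k \<in> {1..n} \<Longrightarrow> 0 < \<sigma> k"
  using pos \<alpha> lnN_pos by (simp add: \<sigma>_def)

lemma \<tau>_top: "\<tau> n = min (1 / 4) (\<sigma> n)"
  by (subst transition.simps) (simp add: \<sigma>_def)

lemma \<tau>_step: "k < n \<Longrightarrow> \<tau> k = min (\<tau> (k + 1) / 2) (\<sigma> k)"
  by (subst transition.simps) (simp add: \<sigma>_def)

lemma \<tau>_bounds:
  assumes "k \<in> {1..n}"
  shows "0 < \<tau> k \<and> \<tau> k \<le> 1 / 4 \<and> \<tau> k \<le> \<sigma> k"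
  using assms
proof (induction "n - k" arbitrary: k)
  case 0
  then show ?case using \<tau>_top \<sigma>_pos[of n] n by auto
next
  case (Suc d)
  have IH: "0 < \<tau> (k + 1)" "\<tau> (k + 1) \<le> 1 / 4"
    using Suc.hyps(1)[of "k + 1"] Suc.hyps(2) Suc.prems by auto
  have "\<tau> k = min (\<tau> (k + 1) / 2) (\<sigma> k)" using Suc.hyps(2) by (intro \<tau>_step) auto
  then show ?case using IH \<sigma>_pos[OF Suc.prems] by linarith
qed

lemma \<tau>_less: "1 \<le> k \<Longrightarrow> k < n \<Longrightarrow> \<tau> k < \<tau> (k + 1)"
  using \<tau>_step[of k] \<tau>_bounds[of "k + 1"] by auto

definition breakpoints :: "real set" where
  "breakpoints = {0, 1} \<union> \<tau> ` {1..n} \<union> (\<lambda>k. 1 - \<tau> k) ` {1..n}"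

text \<open>No piece has fewer than \<open>N / 2 ^ (n + 1) = 2 ^ p\<close> cells, a fixed fraction
  of \<open>N\<close> for given \<open>n\<close>.\<close>

lemma mesh: "piecewise_uniform_mesh (shishkin_mesh n \<epsilon> \<alpha> N) N breakpoints (1 / 2 ^ p)"
proof -
  define M where "M k = N div 2 ^ (n - k + 2)" for k
  define S where "S = (\<tau> 1, N div 2 ^ (n + 1)) # map (\<lambda>k. (\<tau> (k + 1), M k)) [1..<n] @
    (1 - \<tau> n, N div 2) # map (\<lambda>k. (1 - \<tau> k, M k)) (rev [1..<n]) @ [(1, N div 2 ^ (n + 1))]"
  have pts: "shishkin_points n \<epsilon> \<alpha> N = 0 # refine 0 S"
    unfolding shishkin_points_def Let_def S_def M_def
    by (simp add: refine_ascending[OF n, where t = \<tau>] refine_descending[OF n, where t = \<tau>] del: One_nat_def)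
  have div: "2 ^ p \<le> N div 2 ^ k" if "k \<le> n + 1" for k
  proof -
    have "N div 2 ^ k = 2 ^ (n + p + 1 - k)" using that by (simp add: N power_diff)
    then show ?thesis using that by (simp add: power_increasing)
  qed
  have pos_div: "0 < N div 2 ^ k" if "k \<le> n + 1" for k
    using div[OF that] by (metis less_le_trans zero_less_numeral zero_less_power)
  have M: "2 ^ p \<le> M k" "0 < M k" if "1 \<le> k" for k
    using div[of "n - k + 2"] pos_div[of "n - k + 2"] that n by (auto simp: M_def)
  have inc: "increasing 0 S"
  proof -
    have "increasing (1 - \<tau> 1) [(1, N div 2 ^ (n + 1))]"
      using \<tau>_bounds[of 1] n pos_div[of "n + 1"] by simp
    then have "increasing (1 - \<tau> n) (map (\<lambda>k. (1 - \<tau> k, M k)) (rev [1..<n]) @ [(1, N div 2 ^ (n + 1))])"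
      by (intro increasing_descending[OF n]) (use \<tau>_less M in auto)
    then have "increasing (\<tau> n) ((1 - \<tau> n, N div 2) # map (\<lambda>k. (1 - \<tau> k, M k)) (rev [1..<n]) @ [(1, N div 2 ^ (n + 1))])"
      using \<tau>_bounds[of n] n pos_div[of 1] by simp
    then have "increasing (\<tau> 1) (map (\<lambda>k. (\<tau> (k + 1), M k)) [1..<n] @
       (1 - \<tau> n, N div 2) # map (\<lambda>k. (1 - \<tau> k, M k)) (rev [1..<n]) @ [(1, N div 2 ^ (n + 1))])"
      by (intro increasing_ascending[OF n]) (use \<tau>_less M in auto)
    then show ?thesis using \<tau>_bounds[of 1] n pos_div[of "n + 1"] by (simp add: S_def)
  qed
  have "length (refine 0 S) = N"
    using length_shishkin_points[OF n, of \<epsilon> \<alpha> p] pts by (simp add: N)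
  moreover have "last (0 # map fst S) = 1" by (simp add: S_def)
  moreover have "2 ^ p \<le> m" if "m \<in> snd ` set S" for m
    using that M div[of 1] div[of "n + 1"] by (auto simp: S_def)
  ultimately have "piecewise_uniform_mesh (\<lambda>j. (0 # refine 0 S) ! j) N (insert 0 (fst ` set S)) (1 / real (2 ^ p))"
    by (intro refine_piecewise_uniform[OF inc]) auto
  moreover have "insert 0 (fst ` set S) = breakpoints"
  proof -
    have "{1..n} = insert 1 ((\<lambda>k. k + 1) ` {1..<n})"
      using n by (auto simp: image_iff)
    then have a: "\<tau> ` {1..n} = insert (\<tau> 1) ((\<lambda>k. \<tau> (k + 1)) ` {1..<n})"
      by (simp only: image_insert image_image)
    have "{1..n} = insert n {1..<n}" using n by auto
    then have b: "(\<lambda>k. 1 - \<tau> k) ` {1..n} = insert (1 - \<tau> n) ((\<lambda>k. 1 - \<tau> k) ` {1..<n})" by simp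
    show ?thesis unfolding breakpoints_def a b by (auto simp: S_def image_image image_Un)
  qed
  moreover have "shishkin_mesh n \<epsilon> \<alpha> N = (\<lambda>j. (0 # refine 0 S) ! j)"
    by (rule ext) (simp add: shishkin_mesh_def pts)
  ultimately show ?thesis by simp
qed

text \<open>A capped transition parameter passes the alternative on from the next coarser layer.\<close>

lemma negligible_or_resolved:
  assumes cells: "l < x" "x < r" "0 \<le> l"
    and bp: "\<And>k. k \<in> {1..n} \<Longrightarrow> \<tau> k \<le> l \<or> x \<le> \<tau> k" "\<And>k. k \<in> {1..n} \<Longrightarrow> \<tau> k \<le> x \<or> r \<le> \<tau> k"
    and wl: "\<And>k. k \<in> {1..n} \<Longrightarrow> x \<le> \<tau> k \<Longrightarrow> x - l \<le> \<tau> k / 2 ^ p"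
    and wr: "\<And>k. k \<in> {1..n} \<Longrightarrow> r \<le> \<tau> k \<Longrightarrow> r - x \<le> \<tau> k / 2 ^ p"
    and w: "x - l \<le> 1 / 2 ^ p" "r - x \<le> 1 / 2 ^ p"
    and q: "q \<in> {1..n}"
  shows "lay q l \<le> exp (2 ^ (n + 2)) / (real N)\<^sup>2 \<or> max (x - l) (r - x) \<le> 4 * 2 ^ (n - q) * (\<tau> q / 2 ^ p)"
  using q
proof (induction "n - q" arbitrary: q rule: less_induct)
  case less
  \<comment> \<open>If \<open>r \<le> \<tau> q\<close>, both cells have width at most
    \<open>\<tau> q / 2 ^ p\<close>. Otherwise \<open>l\<close> lies at most one such width before
    \<open>\<tau> q\<close>, where the layer has already decayed.\<close>
  have full: ?case if eq: "\<tau> q = \<sigma> q"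
  proof (cases "r \<le> \<tau> q")
    case True
    then have "max (x - l) (r - x) \<le> 1 * (\<tau> q / 2 ^ p)"
      using wl[OF less.prems] wr[OF less.prems] cells by auto
    also have "\<dots> \<le> 4 * 2 ^ (n - q) * (\<tau> q / 2 ^ p)"
    proof (rule mult_right_mono)
      have "(1::real) \<le> 2 ^ (n - q)" by simp
      then show "(1::real) \<le> 4 * 2 ^ (n - q)" by linarith
    qed (use \<tau>_bounds[OF less.prems] in simp)
    finally show ?thesis by blast
  next
    case False
    then have x: "\<tau> q \<le> x" using bp(2)[OF less.prems] by auto
    have l: "\<tau> q - \<tau> q / 2 ^ p \<le> l"
    proof (cases "\<tau> q \<le> l")
      case True
      moreover have "0 \<le> \<tau> q / 2 ^ p" using \<tau>_bounds[OF less.prems] by simp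
      ultimately show ?thesis by linarith
    next
      case False
      then have "x \<le> \<tau> q" using bp(1)[OF less.prems] by auto
      with wl[OF less.prems] x show ?thesis by linarith
    qed
    have s: "\<sigma> q * sqrt (\<alpha> / \<epsilon> q) = 2 * ln (real N)"
    proof -
      have "sqrt (\<epsilon> q / \<alpha>) * sqrt (\<alpha> / \<epsilon> q) = 1"
        using pos[OF less.prems] \<alpha> by (simp add: real_sqrt_mult[symmetric])
      then show ?thesis unfolding \<sigma>_def by (metis mult.assoc mult.commute mult.right_neutral)
    qed
    have "lay q l \<le> lay q (\<tau> q - \<tau> q / 2 ^ p)"
      using l \<alpha> pos[OF less.prems] by (intro layer_antimono) auto
    also have "\<dots> = exp (- (2 * ln (real N)) + 2 * ln (real N) / 2 ^ p)"
      unfolding layer_def eq s[symmetric] by (simp add: algebra_simps)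
    \<comment> \<open>Even the crude bound of \<open>ln N\<close> by \<open>N\<close> suffices: as
      \<open>N / 2 ^ p = 2 ^ (n + 1)\<close>, the offset by one cell costs a factor depending on
      \<open>n\<close> only.\<close>
    also have "\<dots> \<le> exp (- (2 * ln (real N)) + 2 ^ (n + 2))"
    proof -
      have "2 * ln (real N) / 2 ^ p \<le> 2 * real N / 2 ^ p"
        using ln_le_minus_one[of "real N"] N_ge by (intro divide_right_mono) auto
      also have "\<dots> = 2 ^ (n + 2)" by (simp add: N power_add)
      finally show ?thesis by simp
    qed
    also have "\<dots> = exp (2 ^ (n + 2)) / (real N)\<^sup>2"
    proof -
      have e: "exp (2 * ln (real N)) = (real N)\<^sup>2"
        using N_ge by (simp add: exp_double)
      show ?thesis unfolding exp_add exp_minus e by (simp add: divide_inverse mult.commute)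
    qed
    finally show ?thesis by blast
  qed
  show ?case
  proof (cases "q = n")
    case True
    then have "\<tau> q = \<sigma> q \<or> \<tau> q = 1 / 4" using \<tau>_top by auto
    then show ?thesis
    proof
      assume t: "\<tau> q = 1 / 4"
      \<comment> \<open>The factor 4 in the statement cancels the cap \<open>1 / 4\<close>, so the
        global width bound gives the second alternative.\<close>
      have "4 * 2 ^ (n - q) * (\<tau> q / 2 ^ p) = 1 / 2 ^ p" unfolding t using True by simp
      then show ?thesis using w by simp
    qed (rule full)
  next
    case False
    then have q: "q < n" "q + 1 \<in> {1..n}" using less.prems by auto
    then consider "\<tau> q = \<sigma> q" | "\<tau> (q + 1) = 2 * \<tau> q" using \<tau>_step[of q] by fastforce
    then show ?thesis
    proof cases
      case 2
      \<comment> \<open>The coarser layer dominates this one, and the doubling of \<tau> from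
        \<open>q\<close> to \<open>q + 1\<close> is absorbed by the power
        \<open>2 ^ (n - q)\<close>.\<close>
      have "lay q l \<le> lay (q + 1) l"
        using \<alpha> pos less.prems mono q cells by (intro layer_mono_param) auto
      moreover have "4 * 2 ^ (n - (q + 1)) * (\<tau> (q + 1) / 2 ^ p) = 4 * 2 ^ (n - q) * (\<tau> q / 2 ^ p)"
        using q 2 by (simp add: Suc_diff_Suc[symmetric])
      moreover have "lay (q + 1) l \<le> exp (2 ^ (n + 2)) / (real N)\<^sup>2 \<or>
          max (x - l) (r - x) \<le> 4 * 2 ^ (n - (q + 1)) * (\<tau> (q + 1) / 2 ^ p)"
        using q by (intro less.hyps) auto
      ultimately show ?thesis by (metis order_trans)
    qed (rule full)
  qed
qed

end

subsection \<open>Local truncation estimates\<close>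

text \<open>The difference operator as a functional of three nodes acting on functions of a real
  variable.\<close>

definition second_diff :: "real \<Rightarrow> real \<Rightarrow> real \<Rightarrow> (real \<Rightarrow> real) \<Rightarrow> real" where
  "second_diff l x r F = 1 / ((x - l + (r - x)) / 2) * ((F r - F x) / (r - x) - (F x - F l) / (x - l))"

text \<open>Taylor expansions to both sides cancel \<open>F1 x\<close> without any symmetry of the
  cells.\<close>

lemma second_diff_mean:
  assumes "l < x" "x < r" and F: "twice_deriv l r F F1 F2"
  obtains \<xi> \<zeta> where "l < \<xi>" "\<xi> < x" "x < \<zeta>" "\<zeta> < r"
    "second_diff l x r F = ((r - x) * F2 \<zeta> + (x - l) * F2 \<xi>) / (r - l)"
proof -
  define h k where "h = r - x" and "k = x - l"
  have hk: "0 < h" "0 < k" using assms by (auto simp: h_def k_def)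
  have R: "twice_deriv (-k) h (\<lambda>s. F (x + s)) (\<lambda>s. F1 (x + s)) (\<lambda>s. F2 (x + s))"
    using twice_deriv_affine[OF F, of 1 "-k" h x] by (simp add: h_def k_def)
  have L: "twice_deriv (-h) k (\<lambda>s. F (x - s)) (\<lambda>s. - F1 (x - s)) (\<lambda>s. F2 (x - s))"
    using twice_deriv_affine[OF F, of "-1" "-h" k x] by (simp add: h_def k_def)
  obtain s where s: "0 < s" "s < h" "F (x + h) = F (x + 0) + h * F1 (x + 0) + h\<^sup>2 / 2 * F2 (x + s)"
    by (rule taylor_second_order[OF hk(1), of "\<lambda>s. F (x + s)" "\<lambda>s. F1 (x + s)" "\<lambda>s. F2 (x + s)"])
      (use hk twice_derivD[OF R] in \<open>auto intro: continuous_on_subset\<close>)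
  obtain t where t: "0 < t" "t < k" "F (x - k) = F (x - 0) + k * - F1 (x - 0) + k\<^sup>2 / 2 * F2 (x - t)"
    by (rule taylor_second_order[OF hk(2), of "\<lambda>s. F (x - s)" "\<lambda>s. - F1 (x - s)" "\<lambda>s. F2 (x - s)"])
      (use hk twice_derivD[OF L] in \<open>auto intro: continuous_on_subset\<close>)
  have "(F r - F x) / h = F1 x + h / 2 * F2 (x + s)" "(F x - F l) / k = F1 x - k / 2 * F2 (x - t)"
    using s t hk by (auto simp: h_def k_def field_simps power2_eq_square)
  then have "second_diff l x r F = 1 / ((k + h) / 2) * (h / 2 * F2 (x + s) + k / 2 * F2 (x - t))"
    by (simp add: second_diff_def h_def k_def)
  also have "\<dots> = (h * F2 (x + s) + k * F2 (x - t)) / (k + h)" using hk by (simp add: field_simps)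
  finally show ?thesis using s t by (intro that[of "x - t" "x + s"]) (auto simp: h_def k_def)
qed

lemma second_diff_le:
  assumes x: "l < x" "x < r" and F: "twice_deriv l r F F1 F2"
    and le: "\<And>t. l < t \<Longrightarrow> t < r \<Longrightarrow> F2 t \<le> c"
  shows "second_diff l x r F \<le> c"
proof -
  obtain \<xi> \<zeta> where *: "l < \<xi>" "\<xi> < x" "x < \<zeta>" "\<zeta> < r"
    "second_diff l x r F = ((r - x) * F2 \<zeta> + (x - l) * F2 \<xi>) / (r - l)"
    by (rule second_diff_mean[OF x F])
  have "(r - x) * F2 \<zeta> + (x - l) * F2 \<xi> \<le> (r - x) * c + (x - l) * c"
    using * x by (intro add_mono mult_left_mono le) auto
  also have "\<dots> = c * (r - l)" by (simp add: algebra_simps)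
  finally show ?thesis using * x by (simp add: pos_divide_le_eq)
qed

lemma second_diff_minus: "second_diff l x r (\<lambda>t. - F t) = - second_diff l x r F"
  unfolding second_diff_def by (simp only: minus_diff_minus divide_minus_left mult_minus_right)

text \<open>For unequal cells the first-order variations of \<open>y\<close> on the two sides do not
  cancel; this estimate serves the transition points.\<close>

lemma second_diff_variation:
  assumes x: "l < x" "x < r" and F: "twice_deriv l r F F1 (\<lambda>t. y t / e)" and e: "0 < e"
    and le: "\<And>t. l \<le> t \<Longrightarrow> t \<le> r \<Longrightarrow> \<bar>y t - y x\<bar> \<le> B"
  shows "\<bar>e * second_diff l x r F - y x\<bar> \<le> B"
proof -
  have "y t \<le> y x + B" "- y t \<le> B - y x" if "l < t" "t < r" for t
    using le[of t] that by (auto simp: abs_le_iff)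
  then have "y t / e \<le> (y x + B) / e" "- (y t / e) \<le> (B - y x) / e" if "l < t" "t < r" for t
    using that e divide_right_mono[of "y t" "y x + B" e] divide_right_mono[of "- y t" "B - y x" e] by simp_all
  then have "second_diff l x r F \<le> (y x + B) / e" "second_diff l x r (\<lambda>t. - F t) \<le> (B - y x) / e"
    by (intro second_diff_le[OF x F] second_diff_le[OF x twice_deriv_uminus[OF F]]; blast)+
  then show ?thesis using e unfolding second_diff_minus
    by (auto simp: abs_le_iff pos_le_divide_eq mult.commute)
qed

text \<open>Subtracting \<open>S\<close> leaves a function with second derivative at most
  \<open>K\<close>, and restoring it costs at most \<open>2 * s\<close>. A large part
  \<open>S2\<close> of the second derivative is thus paid for by the size of \<open>S\<close>, not
  of \<open>S2\<close>.\<close>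

lemma symmetric_variation_le:
  assumes h: "0 < \<xi>" "\<xi> \<le> h" and y: "twice_deriv (x - h) (x + h) y y1 y2" and S: "twice_deriv (x - h) (x + h) S S1 S2"
    and y2: "\<And>t. x - h < t \<Longrightarrow> t < x + h \<Longrightarrow> y2 t \<le> K + S2 t" and K: "0 \<le> K"
    and Sb: "\<And>t. x - h \<le> t \<Longrightarrow> t \<le> x + h \<Longrightarrow> 0 \<le> S t \<and> S t \<le> s"
  shows "y (x + \<xi>) + y (x - \<xi>) - 2 * y x \<le> K * h\<^sup>2 + 2 * s"
proof -
  have g: "twice_deriv (x - \<xi>) (x + \<xi>) (\<lambda>t. y t - S t) (\<lambda>t. y1 t - S1 t) (\<lambda>t. y2 t - S2 t)"
    using h by (intro twice_deriv_diff twice_deriv_subset[OF y] twice_deriv_subset[OF S]) auto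
  obtain \<zeta> where z: "0 < \<zeta>" "\<zeta> < \<xi>" "(y (x + \<xi>) - S (x + \<xi>)) + (y (x - \<xi>) - S (x - \<xi>)) - 2 * (y x - S x)
      = \<xi>\<^sup>2 / 2 * ((y2 (x + \<zeta>) - S2 (x + \<zeta>)) + (y2 (x - \<zeta>) - S2 (x - \<zeta>)))"
    by (rule symmetric_second_difference[OF h(1) g])
  have "\<xi>\<^sup>2 / 2 * ((y2 (x + \<zeta>) - S2 (x + \<zeta>)) + (y2 (x - \<zeta>) - S2 (x - \<zeta>))) \<le> \<xi>\<^sup>2 / 2 * (K + K)"
    using y2[of "x + \<zeta>"] y2[of "x - \<zeta>"] z h by (intro mult_left_mono) auto
  also have "\<dots> = K * \<xi>\<^sup>2" by simp
  also have "\<dots> \<le> K * h\<^sup>2" using h K by (intro mult_left_mono power_mono) auto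
  finally show ?thesis
    using z(3) Sb[of "x + \<xi>"] Sb[of "x - \<xi>"] Sb[of x] h by auto
qed

text \<open>Equal cells turn the truncation error into half of a symmetric second difference of
  \<open>y\<close>; the one-sided estimate is then applied to \<open>y\<close> and to
  \<open>- y\<close>.\<close>

lemma uniform_second_diff:
  assumes h: "0 < h" and F: "twice_deriv (x - h) (x + h) F F1 (\<lambda>t. y t / e)" and e: "0 < e"
    and y: "twice_deriv (x - h) (x + h) y y1 y2" and S: "twice_deriv (x - h) (x + h) S S1 S2"
    and y2: "\<And>t. x - h < t \<Longrightarrow> t < x + h \<Longrightarrow> \<bar>y2 t\<bar> \<le> K + S2 t" and K: "0 \<le> K"
    and Sb: "\<And>t. x - h \<le> t \<Longrightarrow> t \<le> x + h \<Longrightarrow> 0 \<le> S t \<and> S t \<le> s"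
  shows "\<bar>e * second_diff (x - h) x (x + h) F - y x\<bar> \<le> K * h\<^sup>2 / 2 + s"
proof -
  obtain \<xi> where x: "0 < \<xi>" "\<xi> < h"
    "F (x + h) + F (x - h) - 2 * F x = h\<^sup>2 / 2 * (y (x + \<xi>) / e + y (x - \<xi>) / e)"
    by (rule symmetric_second_difference[OF h F])
  have "second_diff (x - h) x (x + h) F = (F (x + h) + F (x - h) - 2 * F x) / h\<^sup>2"
    using h by (simp add: second_diff_def field_simps power2_eq_square)
  then have "second_diff (x - h) x (x + h) F = (y (x + \<xi>) / e + y (x - \<xi>) / e) / 2"
    unfolding x(3) using h by simp
  then have eq: "e * second_diff (x - h) x (x + h) F - y x = (y (x + \<xi>) + y (x - \<xi>) - 2 * y x) / 2"
    using e by (simp add: field_simps)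
  have 1: "y (x + \<xi>) + y (x - \<xi>) - 2 * y x \<le> K * h\<^sup>2 + 2 * s"
    by (rule symmetric_variation_le[OF x(1) less_imp_le[OF x(2)] y S _ K Sb]) (use y2 in \<open>auto simp: abs_le_iff\<close>)
  have 2: "- y (x + \<xi>) + - y (x - \<xi>) - 2 * - y x \<le> K * h\<^sup>2 + 2 * s"
    by (rule symmetric_variation_le[OF x(1) less_imp_le[OF x(2)] twice_deriv_uminus[OF y] S _ K Sb])
      (use y2 in \<open>auto simp: abs_le_iff\<close>)
  show ?thesis unfolding eq using 1 2 by (auto simp: abs_le_iff)
qed

text \<open>The function \<open>g\<close>, obtained from \<open>y\<close> by adding \<open>S\<close>
  and \<open>K / 2\<close> times the squared distance to \<open>x\<close>, is convex. Its slopes up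
  to \<open>x + H\<close> are therefore bounded by the slope of the long chord from \<open>x\<close>
  to \<open>x + L\<close>, so an increment over a distance at most \<open>H\<close> is at most the
  fraction \<open>H / L\<close> of a bound for the oscillation over \<open>L\<close>.\<close>

lemma chord_bounds:
  assumes y: "twice_deriv l (x + L) y y1 y2" and S: "twice_deriv l (x + L) S S1 S2"
    and y2: "\<And>t. l < t \<Longrightarrow> t < x + L \<Longrightarrow> - (K + S2 t) \<le> y2 t" and K: "0 \<le> K"
    and Sb: "\<And>t. l \<le> t \<Longrightarrow> t \<le> x + L \<Longrightarrow> 0 \<le> S t \<and> S t \<le> s"
    and G: "\<And>t. l \<le> t \<Longrightarrow> t \<le> x + L \<Longrightarrow> \<bar>y t\<bar> \<le> G"
    and H: "x - l \<le> H" "H \<le> L" "0 < L" "l \<le> x"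
  shows "x \<le> \<xi> \<Longrightarrow> \<xi> \<le> x + H \<Longrightarrow> y \<xi> - y x \<le> s + H / L * (2 * G + s + K * L\<^sup>2 / 2)"
    and "l \<le> \<xi> \<Longrightarrow> \<xi> < x \<Longrightarrow> - (s + K * H\<^sup>2 / 2 + H / L * (2 * G + s + K * L\<^sup>2 / 2)) \<le> y \<xi> - y x"
proof -
  define g where "g t = y t + S t + K / 2 * ((t - x) * (t - x))" for t
  define Q where "Q = 2 * G + s + K * L\<^sup>2 / 2"
  have sq: "twice_deriv l (x + L) (\<lambda>t. (t - x) * (t - x)) (\<lambda>t. 1 * (t - x) + (t - x) * 1) (\<lambda>t. 2)"
    by (auto simp: twice_deriv_def intro!: continuous_intros derivative_eq_intros)
  have gd: "twice_deriv l (x + L) g (\<lambda>t. y1 t + S1 t + K / 2 * (1 * (t - x) + (t - x) * 1)) (\<lambda>t. y2 t + S2 t + K / 2 * 2)"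
    unfolding g_def[abs_def] by (intro twice_deriv_add twice_deriv_cmult y S sq)
  have conv0: "0 \<le> y2 t + S2 t + K / 2 * 2" if "l < t" "t < x + L" for t
    using y2[OF that] by simp
  have conv: "(c - a) * g b \<le> (c - b) * g a + (b - a) * g c"
    if "l \<le> a" "a < b" "b < c" "c \<le> x + L" for a b c
    by (rule three_point_convexity[OF twice_deriv_subset[OF gd that(1,4)] that(2,3)])
      (use conv0 that in auto)
  have Q0: "0 \<le> Q" using G[of x] Sb[of x] H K by (simp add: Q_def)
  have gL: "g (x + L) - g x \<le> Q"
    using G[of "x + L"] G[of x] Sb[of x] Sb[of "x + L"] H by (simp add: g_def Q_def power2_eq_square abs_le_iff)
  have scale: "d * (g (x + L) - g x) \<le> L * (H / L * Q)" if "0 \<le> d" "d \<le> H" for d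
  proof -
    have "d * (g (x + L) - g x) \<le> d * Q" using gL that by (intro mult_left_mono) auto
    also have "\<dots> \<le> H * Q" using that Q0 by (intro mult_right_mono) auto
    finally show ?thesis using H by simp
  qed
  show "y \<xi> - y x \<le> s + H / L * (2 * G + s + K * L\<^sup>2 / 2)" if \<xi>: "x \<le> \<xi>" "\<xi> \<le> x + H"
  proof -
    have "L * g \<xi> \<le> (L - (\<xi> - x)) * g x + (\<xi> - x) * g (x + L)"
    proof (cases "\<xi> = x \<or> \<xi> = x + L")
      case False
      then show ?thesis using conv[of x \<xi> "x + L"] \<xi> H by (simp add: algebra_simps)
    qed auto
    then have "L * (g \<xi> - g x) \<le> (\<xi> - x) * (g (x + L) - g x)" by (simp add: algebra_simps)
    also have "\<dots> \<le> L * (H / L * Q)" using \<xi> by (intro scale) auto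
    finally have "L * (g \<xi> - g x) \<le> L * (H / L * Q)" .
    then have "g \<xi> - g x \<le> H / L * Q" using H(3) by (rule mult_left_le_imp_le)
    moreover have "0 \<le> K / 2 * ((\<xi> - x) * (\<xi> - x))" using K by simp
    ultimately show ?thesis using Sb[of x] Sb[of \<xi>] \<xi> H by (simp add: g_def Q_def)
  qed
  show "- (s + K * H\<^sup>2 / 2 + H / L * (2 * G + s + K * L\<^sup>2 / 2)) \<le> y \<xi> - y x" if \<xi>: "l \<le> \<xi>" "\<xi> < x"
  proof -
    have "L * (g x - g \<xi>) \<le> (x - \<xi>) * (g (x + L) - g x)"
      using conv[of \<xi> x "x + L"] \<xi> H by (simp add: algebra_simps)
    also have "\<dots> \<le> L * (H / L * Q)" using \<xi> H by (intro scale) auto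
    finally have "L * (g x - g \<xi>) \<le> L * (H / L * Q)" .
    then have "g x - g \<xi> \<le> H / L * Q" using H(3) by (rule mult_left_le_imp_le)
    moreover have "K / 2 * ((\<xi> - x) * (\<xi> - x)) \<le> K * H\<^sup>2 / 2"
    proof -
      have "(\<xi> - x) * (\<xi> - x) = (x - \<xi>)\<^sup>2" by (simp add: power2_eq_square algebra_simps)
      also have "\<dots> \<le> H\<^sup>2" using \<xi> H by (intro power_mono) auto
      finally show ?thesis using mult_left_mono[of _ _ "K / 2"] K by fastforce
    qed
    ultimately show ?thesis using Sb[of x] Sb[of \<xi>] \<xi> H by (simp add: g_def Q_def)
  qed
qed

text \<open>For \<open>y\<close> the convexity argument gives an upper bound to the right of
  \<open>x\<close> and a lower bound to the left; \<open>- y\<close> supplies the other two.\<close>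

lemma chord_variation:
  assumes y: "twice_deriv l (x + L) y y1 y2" and S: "twice_deriv l (x + L) S S1 S2"
    and y2: "\<And>t. l < t \<Longrightarrow> t < x + L \<Longrightarrow> \<bar>y2 t\<bar> \<le> K + S2 t" and K: "0 \<le> K"
    and Sb: "\<And>t. l \<le> t \<Longrightarrow> t \<le> x + L \<Longrightarrow> 0 \<le> S t \<and> S t \<le> s"
    and G: "\<And>t. l \<le> t \<Longrightarrow> t \<le> x + L \<Longrightarrow> \<bar>y t\<bar> \<le> G"
    and H: "x - l \<le> H" "H \<le> L" "0 < L" "l \<le> x"
    and \<xi>: "l \<le> \<xi>" "\<xi> \<le> x + H"
  shows "\<bar>y \<xi> - y x\<bar> \<le> s + K * H\<^sup>2 / 2 + H / L * (2 * G + s + K * L\<^sup>2 / 2)"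
proof -
  have y2': "- (K + S2 t) \<le> y2 t" "- (K + S2 t) \<le> - y2 t" if "l < t" "t < x + L" for t
    using y2[OF that] by (auto simp: abs_le_iff)
  have G': "\<bar>- y t\<bar> \<le> G" if "l \<le> t" "t \<le> x + L" for t using G[OF that] by simp
  note c1 = chord_bounds[OF y S y2'(1) K Sb G H]
  note c2 = chord_bounds[OF twice_deriv_uminus[OF y] S y2'(2) K Sb G' H]
  have "0 \<le> K * H\<^sup>2 / 2" using K by simp
  then show ?thesis using c1[of \<xi>] c2[of \<xi>] \<xi> by (cases "x \<le> \<xi>") (auto simp: abs_le_iff)
qed

text \<open>Away from its end point the exponential beats \<open>1 / e\<close>: for
  \<open>z = sqrt (\<alpha> / e) / 4\<close> the bound of \<open>exp z\<close> from below by half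
  the square of \<open>z\<close> yields the constant \<open>32 / \<alpha>\<close>.\<close>

lemma layer_over_param_bounded:
  assumes "0 < \<alpha>" "0 < e" "1 / 4 \<le> t"
  shows "layer \<alpha> e t / e \<le> 32 / \<alpha>"
proof -
  define z where "z = sqrt (\<alpha> / e) / 4"
  have z: "0 < z" "16 * z\<^sup>2 = \<alpha> / e" using assms by (auto simp: z_def power_divide)
  have "layer \<alpha> e t \<le> layer \<alpha> e (1 / 4)" using assms by (intro layer_antimono) auto
  also have "\<dots> = inverse (exp z)" by (simp add: layer_def z_def exp_minus)
  also have "\<dots> \<le> inverse (z\<^sup>2 / 2)"
    using exp_lower_Taylor_quadratic[of z] z by (intro le_imp_inverse_le) auto
  also have "\<dots> = 32 / (16 * z\<^sup>2)" by (simp add: field_simps)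
  also have "\<dots> = 32 * e / \<alpha>" unfolding z(2) by simp
  finally show ?thesis using assms by (simp add: field_simps)
qed

text \<open>Each alternative is decided for the whole interval, since the majorant built from it
  sums over a fixed set of negligible layers. The layers at the two ends are decided
  independently.\<close>

definition tame :: "nat \<Rightarrow> real \<Rightarrow> (nat \<Rightarrow> real) \<Rightarrow> real \<Rightarrow> real \<Rightarrow> real \<Rightarrow> real \<Rightarrow> bool" where
  "tame n \<alpha> \<epsilon> \<delta> \<Lambda> l r \<longleftrightarrow> (\<forall>q\<in>{1..n}.
     ((\<forall>t\<in>{l..r}. layer \<alpha> (\<epsilon> q) t \<le> \<delta>) \<or> (\<forall>t\<in>{l..r}. layer \<alpha> (\<epsilon> q) t / \<epsilon> q \<le> \<Lambda>)) \<and>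
     ((\<forall>t\<in>{l..r}. layer \<alpha> (\<epsilon> q) (1 - t) \<le> \<delta>) \<or> (\<forall>t\<in>{l..r}. layer \<alpha> (\<epsilon> q) (1 - t) / \<epsilon> q \<le> \<Lambda>)))"

lemma tame_reflect:
  assumes "tame n \<alpha> \<epsilon> \<delta> \<Lambda> l r" shows "tame n \<alpha> \<epsilon> \<delta> \<Lambda> (1 - r) (1 - l)"
proof -
  have "(\<forall>t\<in>{1 - r..1 - l}. P t) \<longleftrightarrow> (\<forall>t\<in>{l..r}. P (1 - t))" for P
  proof
    assume *: "\<forall>t\<in>{l..r}. P (1 - t)"
    show "\<forall>t\<in>{1 - r..1 - l}. P t"
    proof
      fix t assume "t \<in> {1 - r..1 - l}"
      then show "P t" using *[rule_format, of "1 - t"] by simp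
    qed
  qed auto
  then show ?thesis using assms unfolding tame_def by simp
qed

section \<open>Truncation estimates under the alternative between negligible and resolved
  layers\<close>

context
  fixes n :: nat and \<alpha> :: real and \<epsilon> :: "nat \<Rightarrow> real" and \<delta> \<Lambda> D :: real
  assumes \<alpha>: "0 < \<alpha>" and pos: "\<And>i. i \<in> {1..n} \<Longrightarrow> 0 < \<epsilon> i"
    and \<delta>: "0 \<le> \<delta>" and \<Lambda>: "1 \<le> \<Lambda>" and D: "0 \<le> D"
begin

abbreviation lay :: "nat \<Rightarrow> real \<Rightarrow> real" where "lay q \<equiv> layer \<alpha> (\<epsilon> q)"

text \<open>\<open>S\<close> is \<open>D / \<alpha>\<close> times the sum of the negligible layers,
  so \<open>S2\<close> reproduces exactly their share of the load while \<open>S\<close> itself is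
  of order \<open>\<delta>\<close>. Each of the at most \<open>2 * n\<close> other layers
  contributes at most \<open>\<Lambda>\<close>.\<close>

lemma tame_majorant:
  assumes tame: "tame n \<alpha> \<epsilon> \<delta> \<Lambda> l r" and lr: "0 \<le> l" "r \<le> 1"
  obtains S S1 S2 where "twice_deriv l r S S1 S2"
    "\<And>t. l \<le> t \<Longrightarrow> t \<le> r \<Longrightarrow> 0 \<le> S t \<and> S t \<le> 2 * n * D / \<alpha> * \<delta>"
    "\<And>t. l \<le> t \<Longrightarrow> t \<le> r \<Longrightarrow> D * (1 + layer_load \<alpha> \<epsilon> {1..n} t) \<le> D * (1 + 2 * n) * \<Lambda> + S2 t"
proof -
  define P where "P = {q\<in>{1..n}. \<forall>t\<in>{l..r}. lay q t \<le> \<delta>}"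
  define R where "R = {q\<in>{1..n}. \<forall>t\<in>{l..r}. lay q (1 - t) \<le> \<delta>}"
  have fin: "finite P" "finite R" by (auto simp: P_def R_def)
  have sub: "P \<subseteq> {1..n}" "R \<subseteq> {1..n}" by (auto simp: P_def R_def)
  have card: "card P \<le> n" "card R \<le> n"
    using card_mono[OF _ sub(1)] card_mono[OF _ sub(2)] by simp_all
  define S where "S t = D / \<alpha> * ((\<Sum>q\<in>P. lay q t) + (\<Sum>q\<in>R. lay q (1 + (-1) * t)))" for t
  define S1 where "S1 t = D / \<alpha> * ((\<Sum>q\<in>P. - sqrt (\<alpha> / \<epsilon> q) * lay q t)
    + (\<Sum>q\<in>R. (-1) * (- sqrt (\<alpha> / \<epsilon> q) * lay q (1 + (-1) * t))))" for t
  define S2 where "S2 t = D / \<alpha> * ((\<Sum>q\<in>P. \<alpha> / \<epsilon> q * lay q t) + (\<Sum>q\<in>R. \<alpha> / \<epsilon> q * lay q (1 + (-1) * t)))" for t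
  have S: "twice_deriv l r S S1 S2"
    unfolding S_def[abs_def] S1_def[abs_def] S2_def[abs_def]
  proof (intro twice_deriv_cmult twice_deriv_add twice_deriv_sum fin)
    fix q assume "q \<in> P" then show "twice_deriv l r (lay q) (\<lambda>t. - sqrt (\<alpha> / \<epsilon> q) * lay q t) (\<lambda>t. \<alpha> / \<epsilon> q * lay q t)"
      using pos \<alpha> by (intro twice_deriv_layer) (auto simp: P_def)
  next
    fix q assume q: "q \<in> R"
    then have "0 < \<epsilon> q" using pos by (auto simp: R_def)
    show "twice_deriv l r (\<lambda>t. lay q (1 + - 1 * t)) (\<lambda>t. - 1 * (- sqrt (\<alpha> / \<epsilon> q) * lay q (1 + - 1 * t)))
        (\<lambda>t. \<alpha> / \<epsilon> q * lay q (1 + - 1 * t))"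
      by (rule twice_deriv_affine[OF twice_deriv_layer[of \<alpha> "\<epsilon> q" "1 - r" "1 - l"]]) (use \<alpha> \<open>0 < \<epsilon> q\<close> in auto)
  qed
  have D\<alpha>: "0 \<le> D / \<alpha>" using D \<alpha> by simp
  have Sb: "0 \<le> S t \<and> S t \<le> 2 * n * D / \<alpha> * \<delta>" if t: "l \<le> t" "t \<le> r" for t
  proof
    have "0 \<le> (\<Sum>q\<in>P. lay q t)" "0 \<le> (\<Sum>q\<in>R. lay q (1 + (-1) * t))"
      by (intro sum_nonneg less_imp_le layer_pos)+
    then show "0 \<le> S t" unfolding S_def using D\<alpha> by (intro mult_nonneg_nonneg) auto
    have "(\<Sum>q\<in>P. lay q t) \<le> card P * \<delta>"
      by (rule sum_bounded_above) (use t in \<open>auto simp: P_def\<close>)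
    also have "\<dots> \<le> n * \<delta>" using card \<delta> by (intro mult_right_mono) auto
    finally have 1: "(\<Sum>q\<in>P. lay q t) \<le> n * \<delta>" .
    have "(\<Sum>q\<in>R. lay q (1 + (-1) * t)) \<le> card R * \<delta>"
      by (rule sum_bounded_above) (use t in \<open>auto simp: R_def\<close>)
    also have "\<dots> \<le> n * \<delta>" using card \<delta> by (intro mult_right_mono) auto
    finally have 2: "(\<Sum>q\<in>R. lay q (1 + (-1) * t)) \<le> n * \<delta>" .
    have "S t \<le> D / \<alpha> * (n * \<delta> + n * \<delta>)"
      unfolding S_def by (intro mult_left_mono add_mono 1 2 D\<alpha>)
    also have "\<dots> = 2 * n * D / \<alpha> * \<delta>" by (simp add: field_simps)
    finally show "S t \<le> 2 * n * D / \<alpha> * \<delta>" .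
  qed
  have S2: "D * (1 + layer_load \<alpha> \<epsilon> {1..n} t) \<le> D * (1 + 2 * n) * \<Lambda> + S2 t"
    if t: "l \<le> t" "t \<le> r" for t
  proof -
    have "layer_load \<alpha> \<epsilon> {1..n} t \<le>
       (\<Sum>q=1..n. 2 * \<Lambda> + ((if q \<in> P then lay q t / \<epsilon> q else 0) + (if q \<in> R then lay q (1 - t) / \<epsilon> q else 0)))"
    proof (rule sum_mono)
      fix q assume q: "q \<in> {1..n}"
      have "lay q t / \<epsilon> q \<le> \<Lambda> + (if q \<in> P then lay q t / \<epsilon> q else 0)"
        using tame q t \<Lambda> by (auto simp: tame_def P_def)
      moreover have "lay q (1 - t) / \<epsilon> q \<le> \<Lambda> + (if q \<in> R then lay q (1 - t) / \<epsilon> q else 0)"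
        using tame q t \<Lambda> by (auto simp: tame_def R_def)
      ultimately show "layers \<alpha> (\<epsilon> q) t / \<epsilon> q \<le> 2 * \<Lambda> + ((if q \<in> P then lay q t / \<epsilon> q else 0) + (if q \<in> R then lay q (1 - t) / \<epsilon> q else 0))"
        unfolding layers_def add_divide_distrib by linarith
    qed
    also have "\<dots> = 2 * n * \<Lambda> + ((\<Sum>q\<in>P. lay q t / \<epsilon> q) + (\<Sum>q\<in>R. lay q (1 - t) / \<epsilon> q))"
    proof -
      have "{1..n} \<inter> P = P" "{1..n} \<inter> R = R" by (auto simp: P_def R_def)
      then show ?thesis by (simp add: sum.distrib sum.inter_restrict[symmetric])
    qed
    finally have "D * (1 + layer_load \<alpha> \<epsilon> {1..n} t)
       \<le> D * (\<Lambda> + (2 * n * \<Lambda> + ((\<Sum>q\<in>P. lay q t / \<epsilon> q) + (\<Sum>q\<in>R. lay q (1 - t) / \<epsilon> q))))"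
      using \<Lambda> D by (intro mult_left_mono) auto
    also have "\<dots> = D * (1 + 2 * n) * \<Lambda> + S2 t"
      unfolding S2_def using \<alpha> by (simp add: sum_distrib_left[symmetric] sum_divide_distrib[symmetric] algebra_simps)
        (simp add: sum_distrib_left field_simps)
    finally show ?thesis .
  qed
  show ?thesis by (rule that[OF S Sb S2])
qed

text \<open>On the tail \<open>\<epsilon> i \<le> \<epsilon> q\<close>, so a negligible layer
  multiplied by \<open>\<epsilon> i / \<epsilon> q\<close> stays below \<open>\<delta>\<close>. This
  is where confining the bound of \<open>y\<close> to the layers \<open>q \<ge> i\<close> pays
  off.\<close>

lemma tame_bound:
  assumes tame: "tame n \<alpha> \<epsilon> \<delta> \<Lambda> l r" and t: "l \<le> t" "t \<le> r" and i: "i \<in> {1..n}"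
    and mono: "\<And>q. q \<in> {i..n} \<Longrightarrow> \<epsilon> i \<le> \<epsilon> q"
  shows "\<epsilon> i * (1 + layer_load \<alpha> \<epsilon> {i..n} t) \<le> (1 + 2 * n) * \<Lambda> * \<epsilon> i + 2 * n * \<delta>"
proof -
  have e: "0 < \<epsilon> i" by (rule pos[OF i])
  have single: "\<epsilon> i * (b / \<epsilon> q) \<le> \<epsilon> i * \<Lambda> + \<delta>" if q: "q \<in> {i..n}" and b: "0 \<le> b" "b \<le> \<delta> \<or> b / \<epsilon> q \<le> \<Lambda>" for q b
    using b(2)
  proof
    assume "b \<le> \<delta>"
    have eq: "0 < \<epsilon> q" using e mono[OF q] by linarith
    have "\<epsilon> i * (b / \<epsilon> q) \<le> b" using mono[OF q] b(1) eq mult_right_mono[of "\<epsilon> i" "\<epsilon> q" b] by (simp add: field_simps)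
    then show ?thesis using \<open>b \<le> \<delta>\<close> e \<Lambda> by (smt (verit) mult_nonneg_nonneg)
  next
    assume "b / \<epsilon> q \<le> \<Lambda>"
    then have "\<epsilon> i * (b / \<epsilon> q) \<le> \<epsilon> i * \<Lambda>" using e by (intro mult_left_mono) auto
    then show ?thesis using \<delta> by linarith
  qed
  have "(\<Sum>q=i..n. \<epsilon> i * (layers \<alpha> (\<epsilon> q) t / \<epsilon> q)) \<le> (\<Sum>q=i..n. 2 * (\<epsilon> i * \<Lambda> + \<delta>))"
  proof (rule sum_mono)
    fix q assume q: "q \<in> {i..n}"
    then have q': "q \<in> {1..n}" using i by auto
    have "\<epsilon> i * (lay q t / \<epsilon> q) \<le> \<epsilon> i * \<Lambda> + \<delta>" "\<epsilon> i * (lay q (1 - t) / \<epsilon> q) \<le> \<epsilon> i * \<Lambda> + \<delta>"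
    proof -
      have "lay q t \<le> \<delta> \<or> lay q t / \<epsilon> q \<le> \<Lambda>"
        "lay q (1 - t) \<le> \<delta> \<or> lay q (1 - t) / \<epsilon> q \<le> \<Lambda>"
        using tame q' t unfolding tame_def by (meson atLeastAtMost_iff)+
      then show "\<epsilon> i * (lay q t / \<epsilon> q) \<le> \<epsilon> i * \<Lambda> + \<delta>" "\<epsilon> i * (lay q (1 - t) / \<epsilon> q) \<le> \<epsilon> i * \<Lambda> + \<delta>"
        by (intro single[OF q less_imp_le[OF layer_pos]]; blast)+
    qed
    then show "\<epsilon> i * (layers \<alpha> (\<epsilon> q) t / \<epsilon> q) \<le> 2 * (\<epsilon> i * \<Lambda> + \<delta>)"
      unfolding layers_def add_divide_distrib distrib_left by linarith
  qed
  also have "\<dots> = real (card {i..n}) * (2 * (\<epsilon> i * \<Lambda> + \<delta>))" by simp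
  also have "\<dots> \<le> real n * (2 * (\<epsilon> i * \<Lambda> + \<delta>))"
    using i e \<Lambda> \<delta> by (intro mult_right_mono) auto
  finally have "\<epsilon> i * (1 + layer_load \<alpha> \<epsilon> {i..n} t) \<le> \<epsilon> i * 1 + real n * (2 * (\<epsilon> i * \<Lambda> + \<delta>))"
    by (simp add: distrib_left sum_distrib_left)
  also have "\<dots> \<le> \<epsilon> i * \<Lambda> + real n * (2 * (\<epsilon> i * \<Lambda> + \<delta>))"
    using e \<Lambda> by (intro add_right_mono mult_left_mono) auto
  finally show ?thesis by (simp add: algebra_simps)
qed

text \<open>\<open>4 * n / \<alpha> + 4 * n\<close> collects the coefficients of
  \<open>\<delta>\<close> in the chord estimate; \<open>33 * (1 + 2 * n)\<close> those of
  \<open>\<Lambda> * H * L\<close>, where 33 is \<open>2 * 16\<close> from the bound of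
  \<open>y\<close> plus two halves from the quadratic terms.\<close>

definition trunc_const :: real where "trunc_const = D * (4 * n / \<alpha> + 4 * n + 33 * (1 + 2 * n))"

lemma trunc_const_nonneg: "0 \<le> trunc_const"
  unfolding trunc_const_def using D \<alpha> by (intro mult_nonneg_nonneg add_nonneg_nonneg) auto

lemma uniform_truncation:
  assumes y: "twice_deriv 0 1 y y1 y2"
    and y2: "\<And>t. t \<in> {0..1} \<Longrightarrow> \<bar>y2 t\<bar> \<le> D * (1 + layer_load \<alpha> \<epsilon> {1..n} t)"
    and F: "twice_deriv 0 1 F F1 (\<lambda>t. y t / e)" and e: "0 < e"
    and h: "0 < h" "0 \<le> x - h" "x + h \<le> 1"
    and tame: "tame n \<alpha> \<epsilon> \<delta> \<Lambda> (x - h) (x + h)"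
  shows "\<bar>e * second_diff (x - h) x (x + h) F - y x\<bar> \<le> trunc_const * (\<delta> + \<Lambda> * h\<^sup>2)"
proof -
  obtain S S1 S2 where S: "twice_deriv (x - h) (x + h) S S1 S2"
    "\<And>t. x - h \<le> t \<Longrightarrow> t \<le> x + h \<Longrightarrow> 0 \<le> S t \<and> S t \<le> 2 * n * D / \<alpha> * \<delta>"
    "\<And>t. x - h \<le> t \<Longrightarrow> t \<le> x + h \<Longrightarrow> D * (1 + layer_load \<alpha> \<epsilon> {1..n} t) \<le> D * (1 + 2 * n) * \<Lambda> + S2 t"
    using tame_majorant[OF tame h(2,3)] by blast
  have "\<bar>e * second_diff (x - h) x (x + h) F - y x\<bar> \<le> D * (1 + 2 * n) * \<Lambda> * h\<^sup>2 / 2 + 2 * n * D / \<alpha> * \<delta>"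
  proof (rule uniform_second_diff[OF h(1) twice_deriv_subset[OF F h(2,3)] e twice_deriv_subset[OF y h(2,3)] S(1) _ _ S(2)])
    fix t assume t: "x - h < t" "t < x + h"
    then show "\<bar>y2 t\<bar> \<le> D * (1 + 2 * n) * \<Lambda> + S2 t" using y2[of t] S(3)[of t] h by auto
  next
    show "0 \<le> D * (1 + 2 * n) * \<Lambda>" using D \<Lambda> by simp
  qed
  also have "\<dots> \<le> trunc_const * (\<delta> + \<Lambda> * h\<^sup>2)"
  proof -
    have a: "0 \<le> D * n / \<alpha> * \<delta>" "0 \<le> D * n * \<delta>" "0 \<le> D * \<delta>" "0 \<le> D * n / \<alpha> * (\<Lambda> * h\<^sup>2)"
      "0 \<le> D * n * (\<Lambda> * h\<^sup>2)" "0 \<le> D * (\<Lambda> * h\<^sup>2)"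
      using D \<alpha> \<delta> \<Lambda> by auto
    have b: "D * (1 + 2 * n) * \<Lambda> * h\<^sup>2 / 2 + 2 * n * D / \<alpha> * \<delta> = D * (\<Lambda> * h\<^sup>2) / 2 + D * n * (\<Lambda> * h\<^sup>2) + 2 * (D * n / \<alpha> * \<delta>)"
      by (simp add: algebra_simps)
    have c: "trunc_const * (\<delta> + \<Lambda> * h\<^sup>2) = 4 * (D * n / \<alpha> * \<delta>) + 70 * (D * n * \<delta>) + 33 * (D * \<delta>)
       + 4 * (D * n / \<alpha> * (\<Lambda> * h\<^sup>2)) + 70 * (D * n * (\<Lambda> * h\<^sup>2)) + 33 * (D * (\<Lambda> * h\<^sup>2))"
      by (simp add: trunc_const_def algebra_simps add_divide_distrib)
    have "X6 / 2 + X5 + 2 * X1 \<le> 4 * X1 + 70 * X2 + 33 * X3 + 4 * X4 + 70 * X5 + 33 * X6"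
      if "0 \<le> X1" "0 \<le> X2" "0 \<le> X3" "0 \<le> X4" "0 \<le> X5" "0 \<le> X6" for X1 X2 X3 X4 X5 X6 :: real
      using that by linarith
    from this[OF a] show ?thesis unfolding b c .
  qed
  finally show ?thesis .
qed

text \<open>Over the length \<open>L\<close> the oscillation of \<open>y\<close> is of order
  \<open>\<delta> + \<Lambda> * \<epsilon> i\<close>, and \<open>\<epsilon> i\<close> is at most 16
  times the square of \<open>L\<close>. Convexity reduces it by the factor \<open>H / L\<close>,
  which gives \<open>\<delta> + \<Lambda> * H * L\<close>. The long chord points away from the
  nearby layers, so they stay negligible or resolved along it.\<close>

lemma left_transition_variation:
  assumes y: "twice_deriv 0 1 y y1 y2" and i: "i \<in> {1..n}"
    and mono: "\<And>q. q \<in> {i..n} \<Longrightarrow> \<epsilon> i \<le> \<epsilon> q"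
    and yb: "\<And>t. t \<in> {0..1} \<Longrightarrow> \<bar>y t\<bar> \<le> D * (\<epsilon> i * (1 + layer_load \<alpha> \<epsilon> {i..n} t))"
    and y2: "\<And>t. t \<in> {0..1} \<Longrightarrow> \<bar>y2 t\<bar> \<le> D * (1 + layer_load \<alpha> \<epsilon> {1..n} t)"
    and H: "0 < H" "x - l \<le> H" "0 \<le> l" "l \<le> x"
    and L: "L = max H (sqrt (\<epsilon> i) / 4)" "x + L \<le> 1"
    and tame: "tame n \<alpha> \<epsilon> \<delta> \<Lambda> l (x + L)"
    and \<xi>: "l \<le> \<xi>" "\<xi> \<le> x + H"
  shows "\<bar>y \<xi> - y x\<bar> \<le> trunc_const * (\<delta> + \<Lambda> * H * L)"
proof -
  define G where "G = D * ((1 + 2 * n) * \<Lambda> * \<epsilon> i + 2 * n * \<delta>)"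
  define s where "s = 2 * n * D / \<alpha> * \<delta>"
  define K where "K = D * (1 + 2 * n) * \<Lambda>"
  have LH: "H \<le> L" "0 < L" using H L by auto
  obtain S S1 S2 where S: "twice_deriv l (x + L) S S1 S2"
    "\<And>t. l \<le> t \<Longrightarrow> t \<le> x + L \<Longrightarrow> 0 \<le> S t \<and> S t \<le> s"
    "\<And>t. l \<le> t \<Longrightarrow> t \<le> x + L \<Longrightarrow> D * (1 + layer_load \<alpha> \<epsilon> {1..n} t) \<le> K + S2 t"
    using tame_majorant[OF tame H(3) L(2)] unfolding s_def K_def by blast
  have "\<bar>y \<xi> - y x\<bar> \<le> s + K * H\<^sup>2 / 2 + H / L * (2 * G + s + K * L\<^sup>2 / 2)"
  proof (rule chord_variation[OF twice_deriv_subset[OF y H(3) L(2)] S(1) _ _ S(2) _ H(2) LH H(4) \<xi>])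
    fix t assume t: "l < t" "t < x + L"
    then show "\<bar>y2 t\<bar> \<le> K + S2 t" using y2[of t] S(3)[of t] H L by auto
  next
    show "0 \<le> K" using D \<Lambda> by (simp add: K_def)
  next
    fix t assume t: "l \<le> t" "t \<le> x + L"
    have "D * (\<epsilon> i * (1 + layer_load \<alpha> \<epsilon> {i..n} t)) \<le> G"
      unfolding G_def using D by (intro mult_left_mono tame_bound[OF tame t i mono])
    then show "\<bar>y t\<bar> \<le> G" using yb[of t] t H L by auto
  qed
  also have "\<dots> \<le> trunc_const * (\<delta> + \<Lambda> * H * L)"
  proof -
    have HL: "0 \<le> H / L" "H / L \<le> 1" using LH H by auto
    have Y: "0 \<le> \<Lambda> * (H * L)" using \<Lambda> H LH by auto
    have e: "H / L * \<epsilon> i \<le> 16 * (H * L)"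
    proof -
      have "\<epsilon> i = sqrt (\<epsilon> i) * sqrt (\<epsilon> i)" using pos[OF i] by simp
      also have "\<dots> \<le> (4 * L) * (4 * L)" using L(1) LH(2) pos[OF i] by (intro mult_mono) simp_all
      finally have "H / L * \<epsilon> i \<le> H / L * (16 * (L * L))" using HL by (intro mult_left_mono) auto
      then show ?thesis using LH by simp
    qed
    have c1: "0 \<le> D * (1 + 2 * n) * \<Lambda>" "0 \<le> s" "0 \<le> n * D * \<delta>" using D \<Lambda> \<delta> \<alpha> by (auto simp: s_def)
    have 1: "K * H\<^sup>2 / 2 \<le> K * (H * L) / 2"
      using c1(1) LH H unfolding K_def power2_eq_square by (intro divide_right_mono mult_left_mono) auto
    have 2: "H / L * (2 * G + s + K * L\<^sup>2 / 2)
       = 2 * (D * (1 + 2 * n) * \<Lambda>) * (H / L * \<epsilon> i) + (H / L) * (4 * (n * D * \<delta>)) + (H / L) * s + K * (H * L) / 2"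
      using LH by (simp add: G_def field_simps power2_eq_square)
    have 3: "2 * (D * (1 + 2 * n) * \<Lambda>) * (H / L * \<epsilon> i) \<le> 2 * (D * (1 + 2 * n) * \<Lambda>) * (16 * (H * L))"
      using e c1(1) by (intro mult_left_mono) auto
    have 4: "(H / L) * (4 * (n * D * \<delta>)) \<le> 1 * (4 * (n * D * \<delta>))" "(H / L) * s \<le> 1 * s"
      using HL c1 by (intro mult_right_mono; simp)+
    have "s + K * H\<^sup>2 / 2 + H / L * (2 * G + s + K * L\<^sup>2 / 2)
      \<le> 2 * s + 4 * (n * D * \<delta>) + 33 * ((D * (1 + 2 * n) * \<Lambda>) * (H * L))"
      unfolding 2 using 1 3 4 by (simp add: K_def)
    also have "\<dots> = D * (4 * n / \<alpha> + 4 * n) * \<delta> + D * (33 * (1 + 2 * n)) * (\<Lambda> * (H * L))"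
      by (simp add: s_def algebra_simps)
    also have "\<dots> \<le> trunc_const * \<delta> + trunc_const * (\<Lambda> * (H * L))"
      unfolding trunc_const_def using D \<delta> \<alpha> Y by (intro add_mono mult_right_mono mult_left_mono) auto
    finally show ?thesis by (simp add: distrib_left mult.assoc)
  qed
  finally show ?thesis .
qed

lemma right_transition_variation:
  assumes y: "twice_deriv 0 1 y y1 y2" and i: "i \<in> {1..n}"
    and mono: "\<And>q. q \<in> {i..n} \<Longrightarrow> \<epsilon> i \<le> \<epsilon> q"
    and yb: "\<And>t. t \<in> {0..1} \<Longrightarrow> \<bar>y t\<bar> \<le> D * (\<epsilon> i * (1 + layer_load \<alpha> \<epsilon> {i..n} t))"
    and y2: "\<And>t. t \<in> {0..1} \<Longrightarrow> \<bar>y2 t\<bar> \<le> D * (1 + layer_load \<alpha> \<epsilon> {1..n} t)"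
    and H: "0 < H" "r - x \<le> H" "r \<le> 1" "x \<le> r"
    and L: "L = max H (sqrt (\<epsilon> i) / 4)" "0 \<le> x - L"
    and tame: "tame n \<alpha> \<epsilon> \<delta> \<Lambda> (x - L) r"
    and \<xi>: "x - H \<le> \<xi>" "\<xi> \<le> r"
  shows "\<bar>y \<xi> - y x\<bar> \<le> trunc_const * (\<delta> + \<Lambda> * H * L)"
proof -
  have "\<bar>y (1 + (-1) * (1 - \<xi>)) - y (1 + (-1) * (1 - x))\<bar> \<le> trunc_const * (\<delta> + \<Lambda> * H * L)"
  proof (rule left_transition_variation[where l = "1 - r" and x = "1 - x" and \<xi> = "1 - \<xi>" and y = "\<lambda>t. y (1 + (-1) * t)",
        OF twice_deriv_affine[OF y, of "-1" 0 1 1] i mono _ _ H(1) _ _ _ L(1)])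
    fix t :: real assume t: "t \<in> {0..1}"
    show "\<bar>y (1 + - 1 * t)\<bar> \<le> D * (\<epsilon> i * (1 + layer_load \<alpha> \<epsilon> {i..n} t))"
      using yb[of "1 - t"] t by (simp add: layers_reflect)
    show "\<bar>y2 (1 + - 1 * t)\<bar> \<le> D * (1 + layer_load \<alpha> \<epsilon> {1..n} t)"
      using y2[of "1 - t"] t by (simp add: layers_reflect)
  next
    show "tame n \<alpha> \<epsilon> \<delta> \<Lambda> (1 - r) (1 - x + L)" using tame_reflect[OF tame] by (simp add: algebra_simps)
  qed (use H L \<xi> in auto)
  then show ?thesis by simp
qed

end

section \<open>The truncation error on the Shishkin mesh\<close>

lemma (in piecewise_uniform_mesh) x_mono: "i \<le> j \<Longrightarrow> j \<le> N \<Longrightarrow> x i \<le> x j"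
proof (induction j rule: dec_induct)
  case (step j)
  then show ?case using x_less[of j] by simp
qed simp

lemma (in piecewise_uniform_mesh) x_range: "j \<le> N \<Longrightarrow> 0 \<le> x j \<and> x j \<le> 1"
  using x_mono[of 0 j] x_mono[of j N] x_0 x_N by simp

lemma (in shishkin) breakpoints_mem:
  "0 \<in> breakpoints" "1 \<in> breakpoints" "k \<in> {1..n} \<Longrightarrow> \<tau> k \<in> breakpoints" "k \<in> {1..n} \<Longrightarrow> 1 - \<tau> k \<in> breakpoints"
  by (auto simp: breakpoints_def)

lemma (in shishkin) card_breakpoints: "card breakpoints \<le> 2 * n + 2"
proof -
  have "card breakpoints \<le> card {0, 1 :: real} + card (\<tau> ` {1..n}) + card ((\<lambda>k. 1 - \<tau> k) ` {1..n})"
    unfolding breakpoints_def by (intro order_trans[OF card_Un_le] add_right_mono card_Un_le)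
  also have "\<dots> \<le> 2 + n + n"
    using card_image_le[of "{1..n}" \<tau>] card_image_le[of "{1..n}" "\<lambda>k. 1 - \<tau> k"] by (intro add_mono) auto
  finally show ?thesis by simp
qed

definition rate :: "nat \<Rightarrow> real" where "rate N = (ln (real N) / real N)\<^sup>2"

text \<open>The power of 4 is the square of the constant relating \<open>H\<close> to
  \<open>sqrt (\<epsilon> q / \<alpha>) * ln N / N\<close> for a resolved layer; the summand
  \<open>32 / \<alpha>\<close> also covers layers at distance at least \<open>1 / 4\<close>.\<close>

definition resolution_const :: "nat \<Rightarrow> real \<Rightarrow> real" where
  "resolution_const n \<alpha> = 4 ^ (2 * n + 4) * (1 + 32 / \<alpha>)"

definition local_const :: "nat \<Rightarrow> real \<Rightarrow> real \<Rightarrow> real" where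
  "local_const n \<alpha> D = trunc_const n \<alpha> D * (exp (2 ^ (n + 2)) + resolution_const n \<alpha>)"

lemma (in shishkin) lnN_ge: "1 \<le> p \<Longrightarrow> 1 \<le> ln (real N)"
proof -
  assume "1 \<le> p"
  then have "(2::nat) ^ 3 \<le> N" unfolding N using n by (intro power_increasing) auto
  then have "8 \<le> real N" by simp
  then have "exp 1 \<le> real N" using exp_le by linarith
  then show ?thesis using N_ge by (subst ln_ge_iff) auto
qed

text \<open>\<Lambda> is scaled so that \<open>\<Lambda> * H^2\<close> is a constant multiple of
  \<open>rate N\<close>. A resolved layer has \<open>H\<close> bounded by a multiple of
  \<open>\<tau> q / 2 ^ p\<close>, hence of \<open>sqrt (\<epsilon> q) * ln N / N\<close>, which
  says that \<open>1 / \<epsilon> q\<close> is at most \<Lambda>.\<close>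

lemma (in shishkin) local_tameness:
  assumes p: "1 \<le> p" and j: "0 < j" "j < N"
  defines "x \<equiv> shishkin_mesh n \<epsilon> \<alpha> N"
  defines "H \<equiv> max (x j - x (j - 1)) (x (j + 1) - x j)"
  defines "\<Lambda> \<equiv> resolution_const n \<alpha> * rate N / H\<^sup>2" and "\<delta> \<equiv> exp (2 ^ (n + 2)) * rate N"
  shows "0 < H" "H \<le> 1 / 2" "1 \<le> \<Lambda>" "32 / \<alpha> \<le> \<Lambda>"
    and "q \<in> {1..n} \<Longrightarrow> lay q (x (j - 1)) \<le> \<delta> \<or> 1 / \<epsilon> q \<le> \<Lambda>"
    and "q \<in> {1..n} \<Longrightarrow> lay q (1 - x (j + 1)) \<le> \<delta> \<or> 1 / \<epsilon> q \<le> \<Lambda>"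
proof -
  interpret m: piecewise_uniform_mesh x N breakpoints "1 / 2 ^ p"
    unfolding x_def by (rule mesh)
  define l r where "l = x (j - 1)" and "r = x (j + 1)"
  have lx: "l < x j" using m.x_less[of "j - 1"] j by (simp add: l_def)
  have xr: "x j < r" using m.x_less[of j] j by (simp add: r_def)
  have rng: "0 \<le> l" "r \<le> 1" using m.x_range[of "j - 1"] m.x_range[of "j + 1"] j by (auto simp: l_def r_def)
  have H: "H = max (x j - l) (r - x j)" by (simp add: H_def l_def r_def)
  show H0: "0 < H" using lx xr by (simp add: H)
  have nbl: "t \<le> l \<or> x j \<le> t" if "t \<in> breakpoints" for t
    using m.no_breakpoint[of "j - 1" t] that j by (simp add: l_def)
  have nbr: "t \<le> x j \<or> r \<le> t" if "t \<in> breakpoints" for t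
    using m.no_breakpoint[of j t] that j by (simp add: r_def)
  have wl: "x j - l \<le> (t - s) / 2 ^ p" if "s \<in> breakpoints" "t \<in> breakpoints" "s \<le> l" "x j \<le> t" for s t
    using m.width_le[of "j - 1" s t] that j by (simp add: l_def)
  have wr: "r - x j \<le> (t - s) / 2 ^ p" if "s \<in> breakpoints" "t \<in> breakpoints" "s \<le> x j" "r \<le> t" for s t
    using m.width_le[of j s t] that j by (simp add: r_def)
  have w1: "x j - l \<le> 1 / 2 ^ p" "r - x j \<le> 1 / 2 ^ p"
    using wl[of 0 1] wr[of 0 1] breakpoints_mem lx xr rng by auto
  then have Hp: "H \<le> 1 / 2 ^ p" by (simp add: H)
  have "(2::real) ^ 1 \<le> 2 ^ p" using p by (intro power_increasing) auto
  then have "1 / 2 ^ p \<le> (1::real) / 2" by (intro divide_left_mono) auto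
  then show "H \<le> 1 / 2" using Hp by linarith
  define \<mu> where "\<mu> = ln (real N) / real N"
  have rate: "rate N = \<mu>\<^sup>2" by (simp add: rate_def \<mu>_def)
  have ln1: "1 \<le> ln (real N)" by (rule lnN_ge[OF p])
  have \<mu>: "1 / real N \<le> \<mu>" "0 < \<mu>" using ln1 N_ge by (auto simp: \<mu>_def divide_right_mono)
  have pN: "1 / 2 ^ p = 2 ^ (n + 1) / real N" by (simp add: N power_add)
  have scale: "4 ^ (2 * n + 4) = ((2::real) ^ (2 * n + 4))\<^sup>2" 
    by (simp add: power2_eq_square flip: power_mult_distrib)
  \<comment> \<open>All widths are of order \<open>1 / N\<close>, which secures
    \<open>1 \<le> \<Lambda>\<close>.\<close>
  have "H \<le> 2 ^ (n + 1) * \<mu>"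
    using Hp mult_left_mono[OF \<mu>(1), of "2 ^ (n + 1)"] unfolding pN by simp
  also have "\<dots> \<le> 2 ^ (2 * n + 4) * \<mu>" using \<mu> by (intro mult_right_mono power_increasing) auto
  finally have "H\<^sup>2 \<le> (2 ^ (2 * n + 4) * \<mu>)\<^sup>2" using H0 by (intro power_mono) auto
  then have HH: "1 \<le> 4 ^ (2 * n + 4) * rate N / H\<^sup>2"
    using H0 by (simp add: rate scale power_mult_distrib)
  have \<Lambda>_eq: "\<Lambda> = (1 + 32 / \<alpha>) * (4 ^ (2 * n + 4) * rate N / H\<^sup>2)"
    by (simp add: \<Lambda>_def resolution_const_def)
  have \<Lambda>: "1 + 32 / \<alpha> \<le> \<Lambda>"
    unfolding \<Lambda>_eq using mult_left_mono[OF HH, of "1 + 32 / \<alpha>"] \<alpha> by simp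
  moreover have "0 < 32 / \<alpha>" using \<alpha> by simp
  ultimately show "1 \<le> \<Lambda>" "32 / \<alpha> \<le> \<Lambda>" by linarith+
  have res: "1 / \<epsilon> q \<le> \<Lambda>" if q: "q \<in> {1..n}" and Hq: "H \<le> 4 * 2 ^ (n - q) * (\<tau> q / 2 ^ p)" for q
  proof -
    have "4 * 2 ^ (n - q) * (\<tau> q / 2 ^ p) \<le> 4 * 2 ^ n * (\<sigma> q / 2 ^ p)"
      using \<tau>_bounds[OF q] by (intro mult_mono divide_right_mono power_increasing) auto
    also have "\<dots> = 4 * 2 ^ n * \<sigma> q * (1 / 2 ^ p)" by simp
    also have "\<dots> = 2 ^ (2 * n + 4) * (sqrt (\<epsilon> q / \<alpha>) * \<mu>)"
    proof -
      have "(2::real) ^ (2 * n) = 2 ^ n * 2 ^ n" by (metis mult_2 power_add)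
      then have "(2::real) ^ (2 * n + 4) = 2 ^ n * 2 ^ n * 16" by (simp only: power_add) simp
      then show ?thesis unfolding pN by (simp add: \<sigma>_def \<mu>_def)
    qed
    finally have "H\<^sup>2 \<le> (2 ^ (2 * n + 4) * (sqrt (\<epsilon> q / \<alpha>) * \<mu>))\<^sup>2"
      using Hq H0 by (intro power_mono) auto
    also have "\<dots> = 4 ^ (2 * n + 4) * (\<epsilon> q / \<alpha> * rate N)"
      using pos[OF q] \<alpha> by (simp add: power_mult_distrib scale rate)
    finally have "1 / \<epsilon> q \<le> 1 / \<alpha> * (4 ^ (2 * n + 4) * rate N / H\<^sup>2)"
      using pos[OF q] \<alpha> H0 by (simp add: field_simps)
    also have "\<dots> \<le> \<Lambda>"
      unfolding \<Lambda>_eq using HH \<alpha> by (intro mult_right_mono) (auto simp: field_simps)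
    finally show ?thesis .
  qed
  have del: "exp (2 ^ (n + 2)) / (real N)\<^sup>2 \<le> \<delta>"
  proof -
    have "(1 / real N)\<^sup>2 \<le> \<mu>\<^sup>2" using \<mu> by (intro power_mono) auto
    then have "exp (2 ^ (n + 2)) * (1 / real N)\<^sup>2 \<le> exp (2 ^ (n + 2)) * \<mu>\<^sup>2" by (intro mult_left_mono) auto
    then show ?thesis by (simp add: \<delta>_def rate power_divide)
  qed
  show "lay q (x (j - 1)) \<le> \<delta> \<or> 1 / \<epsilon> q \<le> \<Lambda>" if q: "q \<in> {1..n}"
  proof -
    have "lay q l \<le> exp (2 ^ (n + 2)) / (real N)\<^sup>2 \<or> H \<le> 4 * 2 ^ (n - q) * (\<tau> q / 2 ^ p)"
      unfolding H
    proof (rule negligible_or_resolved[OF lx xr rng(1) _ _ _ _ w1 q])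
      fix k assume k: "k \<in> {1..n}"
      show "\<tau> k \<le> l \<or> x j \<le> \<tau> k" "\<tau> k \<le> x j \<or> r \<le> \<tau> k" using nbl nbr breakpoints_mem(3)[OF k] by auto
      show "x j \<le> \<tau> k \<Longrightarrow> x j - l \<le> \<tau> k / 2 ^ p" using wl[of 0 "\<tau> k"] breakpoints_mem k rng by simp
      show "r \<le> \<tau> k \<Longrightarrow> r - x j \<le> \<tau> k / 2 ^ p" using wr[of 0 "\<tau> k"] breakpoints_mem k rng lx by simp
    qed
    then show ?thesis using res[OF q] del by (auto simp: l_def)
  qed
  show "lay q (1 - x (j + 1)) \<le> \<delta> \<or> 1 / \<epsilon> q \<le> \<Lambda>" if q: "q \<in> {1..n}"
  proof -
    \<comment> \<open>The layers at the right end are those at the left end for the reflected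
      cells.\<close>
    have "lay q (1 - r) \<le> exp (2 ^ (n + 2)) / (real N)\<^sup>2 \<or>
        max ((1 - x j) - (1 - r)) ((1 - l) - (1 - x j)) \<le> 4 * 2 ^ (n - q) * (\<tau> q / 2 ^ p)"
    proof (rule negligible_or_resolved[OF _ _ _ _ _ _ _ _ _ q])
      fix k assume k: "k \<in> {1..n}"
      show "\<tau> k \<le> 1 - r \<or> 1 - x j \<le> \<tau> k" "\<tau> k \<le> 1 - x j \<or> 1 - l \<le> \<tau> k"
        using nbl[of "1 - \<tau> k"] nbr[of "1 - \<tau> k"] breakpoints_mem(4)[OF k] by auto
      show "1 - x j - (1 - r) \<le> \<tau> k / 2 ^ p" if "1 - x j \<le> \<tau> k"
        using wr[of "1 - \<tau> k" 1] breakpoints_mem k rng that by simp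
      show "1 - l - (1 - x j) \<le> \<tau> k / 2 ^ p" if "1 - l \<le> \<tau> k"
        using wl[of "1 - \<tau> k" 1] breakpoints_mem k rng xr that by simp
    qed (use lx xr rng w1 in auto)
    then show ?thesis using res[OF q] del by (auto simp: r_def H max.commute)
  qed
qed

text \<open>Off the break points the cells are equal and the symmetric estimate applies. At a break
  point \<open>\<Lambda> * H * L\<close> is a multiple of \<open>rate N * (L / H)\<close>, and
  \<open>L \<le> H + sqrt (\<epsilon> i)\<close> produces the extra term.\<close>

lemma (in shishkin) truncation_error:
  assumes p: "1 \<le> p" and j: "0 < j" "j < N" and i: "i \<in> {1..n}" and le1: "\<epsilon> i \<le> 1" and D: "0 \<le> D"
    and y: "twice_deriv 0 1 y y1 y2"
    and F: "twice_deriv 0 1 F F1 (\<lambda>t. y t / \<epsilon> i)"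
    and yb: "\<And>t. t \<in> {0..1} \<Longrightarrow> \<bar>y t\<bar> \<le> D * (\<epsilon> i * (1 + layer_load \<alpha> \<epsilon> {i..n} t))"
    and y2: "\<And>t. t \<in> {0..1} \<Longrightarrow> \<bar>y2 t\<bar> \<le> D * (1 + layer_load \<alpha> \<epsilon> {1..n} t)"
  defines "x \<equiv> shishkin_mesh n \<epsilon> \<alpha> N"
  defines "H \<equiv> max (x j - x (j - 1)) (x (j + 1) - x j)"
  shows "\<bar>\<epsilon> i * second_diff (x (j - 1)) (x j) (x (j + 1)) F - y (x j)\<bar>
    \<le> local_const n \<alpha> D * rate N * (1 + (if x j \<in> breakpoints then sqrt (\<epsilon> i) / H else 0))"
proof -
  interpret m: piecewise_uniform_mesh x N breakpoints "1 / 2 ^ p"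
    unfolding x_def by (rule mesh)
  define \<Lambda> where "\<Lambda> = resolution_const n \<alpha> * rate N / H\<^sup>2"
  define \<delta> where "\<delta> = exp (2 ^ (n + 2)) * rate N"
  define T where "T = trunc_const n \<alpha> D"
  define l r where "l = x (j - 1)" and "r = x (j + 1)"
  note t = local_tameness[OF p j, folded x_def, folded H_def, folded \<Lambda>_def \<delta>_def]
  have H0: "0 < H" and H2: "H \<le> 1 / 2" and \<Lambda>1: "1 \<le> \<Lambda>" and \<Lambda>2: "32 / \<alpha> \<le> \<Lambda>"
    using t(1-4) by auto
  have tl: "lay q l \<le> \<delta> \<or> 1 / \<epsilon> q \<le> \<Lambda>" and tr: "lay q (1 - r) \<le> \<delta> \<or> 1 / \<epsilon> q \<le> \<Lambda>"
    if "q \<in> {1..n}" for q using t(5,6)[OF that] by (auto simp: l_def r_def)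
  have lx: "l < x j" using m.x_less[of "j - 1"] j by (simp add: l_def)
  have xr: "x j < r" using m.x_less[of j] j by (simp add: r_def)
  have rng: "0 \<le> l" "r \<le> 1" using m.x_range[of "j - 1"] m.x_range[of "j + 1"] j by (auto simp: l_def r_def)
  have H: "x j - l \<le> H" "r - x j \<le> H" by (auto simp: H_def l_def r_def)
  have \<delta>0: "0 \<le> \<delta>" by (simp add: \<delta>_def rate_def)
  have R0: "0 \<le> resolution_const n \<alpha>" using \<alpha> by (simp add: resolution_const_def)
  have T0: "0 \<le> T" unfolding T_def by (rule trunc_const_nonneg[OF \<alpha> pos \<delta>0 \<Lambda>1 D])
  have e: "0 < \<epsilon> i" by (rule pos[OF i])
  \<comment> \<open>Layers decrease, so the alternative at the left end of an interval extends to
    all of it.\<close>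
  have near: "(\<forall>t\<in>{l'..r'}. lay q t \<le> \<delta>) \<or> (\<forall>t\<in>{l'..r'}. lay q t / \<epsilon> q \<le> \<Lambda>)"
    if q: "q \<in> {1..n}" and "0 \<le> l'" "lay q l' \<le> \<delta> \<or> 1 / \<epsilon> q \<le> \<Lambda>" for q l' r'
    using that(3)
  proof
    assume "lay q l' \<le> \<delta>"
    then have "lay q t \<le> \<delta>" if "l' \<le> t" for t
      using layer_antimono[of \<alpha> "\<epsilon> q" l' t] \<alpha> pos[OF q] that by simp
    then show ?thesis by simp
  next
    assume L: "1 / \<epsilon> q \<le> \<Lambda>"
    have "lay q t / \<epsilon> q \<le> \<Lambda>" if "l' \<le> t" for t
    proof -
      have "lay q t / \<epsilon> q \<le> 1 / \<epsilon> q"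
        using layer_le_1[of \<alpha> "\<epsilon> q" t] \<alpha> pos[OF q] that \<open>0 \<le> l'\<close> by (intro divide_right_mono) auto
      then show ?thesis using L by linarith
    qed
    then show ?thesis by simp
  qed
  have mirror: "(\<forall>t\<in>{1 - r'..1 - l'}. P t) \<Longrightarrow> (\<forall>t\<in>{l'..r'}. P (1 - t))" for P and l' r' :: real by auto
  show ?thesis
  proof (cases "x j \<in> breakpoints")
    case False
    define h where "h = x j - l"
    have h: "r - x j = h"
      using m.uniform[of "j - 1"] j False by (simp add: h_def l_def r_def)
    then have eqs: "l = x j - h" "r = x j + h" "H = h" by (auto simp: h_def H_def l_def r_def)
    have "tame n \<alpha> \<epsilon> \<delta> \<Lambda> l r"
      unfolding tame_def
    proof (intro ballI conjI)
      fix q assume q: "q \<in> {1..n}"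
      show "(\<forall>t\<in>{l..r}. lay q t \<le> \<delta>) \<or> (\<forall>t\<in>{l..r}. lay q t / \<epsilon> q \<le> \<Lambda>)"
        by (rule near[OF q rng(1) tl[OF q]])
      show "(\<forall>t\<in>{l..r}. lay q (1 - t) \<le> \<delta>) \<or> (\<forall>t\<in>{l..r}. lay q (1 - t) / \<epsilon> q \<le> \<Lambda>)"
        using near[OF q _ tr[OF q], of "1 - l"] rng mirror[of r l "\<lambda>t. lay q t \<le> \<delta>"]
          mirror[of r l "\<lambda>t. lay q t / \<epsilon> q \<le> \<Lambda>"] by auto
    qed
    then have "\<bar>\<epsilon> i * second_diff (x j - h) (x j) (x j + h) F - y (x j)\<bar> \<le> T * (\<delta> + \<Lambda> * h\<^sup>2)"
      unfolding T_def
      by (intro uniform_truncation[OF \<alpha> pos \<delta>0 \<Lambda>1 D y y2 F e]) (use lx rng eqs in auto)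
    also have "T * (\<delta> + \<Lambda> * h\<^sup>2) = local_const n \<alpha> D * rate N"
      using H0 by (simp add: \<Lambda>_def \<delta>_def eqs local_const_def T_def algebra_simps)
    finally show ?thesis using False by (simp add: eqs(1,2)[symmetric] l_def r_def)
  next
    case True
    define L where "L = max H (sqrt (\<epsilon> i) / 4)"
    have "sqrt (\<epsilon> i) \<le> 1" using le1 by simp
    then have "sqrt (\<epsilon> i) / 4 \<le> 1 / 2" by linarith
    then have L2: "L \<le> 1 / 2" using H2 unfolding L_def by (intro max.boundedI)
    have x01: "0 < x j" "x j < 1" using lx xr rng by auto
    then obtain k where k: "k \<in> {1..n}" "x j = \<tau> k \<or> x j = 1 - \<tau> k"
      using True by (auto simp: breakpoints_def)
    have \<tau>4: "\<tau> k \<le> 1 / 4" using \<tau>_bounds[OF k(1)] by simp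
    \<comment> \<open>Along the chord the layers of the opposite end are at distance at least
      \<open>1 / 4\<close>, because the node is within \<open>1 / 4\<close> of its own end and
      \<open>L \<le> 1 / 2\<close>.\<close>
    have far: "lay q t / \<epsilon> q \<le> \<Lambda>" if "q \<in> {1..n}" "1 / 4 \<le> t" for q t
      using layer_over_param_bounded[OF \<alpha> pos[OF that(1)] that(2)] \<Lambda>2 by linarith
    have mono': "\<epsilon> i \<le> \<epsilon> q" if "q \<in> {i..n}" for q using mono[of i q] i that by auto
    have "\<bar>y \<xi> - y (x j)\<bar> \<le> T * (\<delta> + \<Lambda> * H * L)" if \<xi>: "l \<le> \<xi>" "\<xi> \<le> r" for \<xi>
      using k(2)
    proof
      assume xk: "x j = \<tau> k"
      have "tame n \<alpha> \<epsilon> \<delta> \<Lambda> l (x j + L)"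
        unfolding tame_def
      proof (intro ballI conjI)
        fix q assume q: "q \<in> {1..n}"
        show "(\<forall>t\<in>{l..x j + L}. lay q t \<le> \<delta>) \<or> (\<forall>t\<in>{l..x j + L}. lay q t / \<epsilon> q \<le> \<Lambda>)"
          by (rule near[OF q rng(1) tl[OF q]])
        show "(\<forall>t\<in>{l..x j + L}. lay q (1 - t) \<le> \<delta>) \<or> (\<forall>t\<in>{l..x j + L}. lay q (1 - t) / \<epsilon> q \<le> \<Lambda>)"
          using far[OF q] xk \<tau>4 L2 by auto
      qed
      then show ?thesis unfolding T_def
        by (intro left_transition_variation[OF \<alpha> pos \<delta>0 \<Lambda>1 D y i mono' yb y2 H0 H(1) rng(1) _ L_def])
          (use xk \<tau>4 L2 lx \<xi> H in auto)
    next
      assume xk: "x j = 1 - \<tau> k"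
      have "tame n \<alpha> \<epsilon> \<delta> \<Lambda> (x j - L) r"
        unfolding tame_def
      proof (intro ballI conjI)
        fix q assume q: "q \<in> {1..n}"
        show "(\<forall>t\<in>{x j - L..r}. lay q (1 - t) \<le> \<delta>) \<or> (\<forall>t\<in>{x j - L..r}. lay q (1 - t) / \<epsilon> q \<le> \<Lambda>)"
          using near[OF q _ tr[OF q], of "1 - (x j - L)"] rng mirror[of r "x j - L" "\<lambda>t. lay q t \<le> \<delta>"]
            mirror[of r "x j - L" "\<lambda>t. lay q t / \<epsilon> q \<le> \<Lambda>"] by auto
        show "(\<forall>t\<in>{x j - L..r}. lay q t \<le> \<delta>) \<or> (\<forall>t\<in>{x j - L..r}. lay q t / \<epsilon> q \<le> \<Lambda>)"
          using far[OF q] xk \<tau>4 L2 by auto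
      qed
      then show ?thesis unfolding T_def
        by (intro right_transition_variation[OF \<alpha> pos \<delta>0 \<Lambda>1 D y i mono' yb y2 H0 H(2) rng(2) _ L_def])
          (use xk \<tau>4 L2 xr \<xi> H in auto)
    qed
    then have "\<bar>\<epsilon> i * second_diff l (x j) r F - y (x j)\<bar> \<le> T * (\<delta> + \<Lambda> * H * L)"
      by (intro second_diff_variation[OF lx xr twice_deriv_subset[OF F rng] e])
    also have "\<dots> \<le> T * ((exp (2 ^ (n + 2)) + resolution_const n \<alpha>) * rate N * (1 + sqrt (\<epsilon> i) / H))"
    proof (rule mult_left_mono[OF _ T0])
      have s0: "0 \<le> sqrt (\<epsilon> i) / H" using e H0 by simp
      have "L \<le> H + sqrt (\<epsilon> i)" using e H0 by (auto simp: L_def)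
      then have "L / H \<le> (H + sqrt (\<epsilon> i)) / H" using H0 by (intro divide_right_mono) auto
      also have "\<dots> = 1 + sqrt (\<epsilon> i) / H" using H0 by (simp add: add_divide_distrib)
      finally have "resolution_const n \<alpha> * rate N * (L / H) \<le> resolution_const n \<alpha> * rate N * (1 + sqrt (\<epsilon> i) / H)"
        using R0 by (intro mult_left_mono) (auto simp: rate_def)
      moreover have "\<Lambda> * H * L = resolution_const n \<alpha> * rate N * (L / H)"
        using H0 by (simp add: \<Lambda>_def power2_eq_square)
      moreover have "\<delta> * 1 \<le> \<delta> * (1 + sqrt (\<epsilon> i) / H)" using \<delta>0 s0 by (intro mult_left_mono) auto
      ultimately show "\<delta> + \<Lambda> * H * L \<le> (exp (2 ^ (n + 2)) + resolution_const n \<alpha>) * rate N * (1 + sqrt (\<epsilon> i) / H)"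
        unfolding \<open>\<Lambda> * H * L = _\<close> distrib_right[of "exp (2 ^ (n + 2))"] distrib_right[of "exp (2 ^ (n + 2)) * rate N"]
        by (simp only: \<delta>_def[symmetric] mult_1_right add_mono)
    qed
    finally show ?thesis using True by (simp add: local_const_def T_def l_def r_def mult.assoc)
  qed
qed

subsection \<open>Discrete comparison and the barrier\<close>

lemma second_difference_unfold:
  "second_difference x U j = 1 / ((x j - x (j - 1) + (x (j + 1) - x j)) / 2) *
     ((U (j + 1) - U j) / (x (j + 1) - x j) - (U j - U (j - 1)) / (x j - x (j - 1)))"
  by (simp only: second_difference_def Let_def add_diff_cancel_right')

lemma second_difference_eq:
  "second_difference x (\<lambda>j. F (x j)) j = second_diff (x (j - 1)) (x j) (x (j + 1)) F"
  by (simp only: second_difference_unfold second_diff_def)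

lemma second_difference_diff:
  "second_difference x (\<lambda>j. U j - V j) j = second_difference x U j - second_difference x V j"
proof -
  have "(U (j + 1) - V (j + 1) - (U j - V j)) / h = (U (j + 1) - U j) / h - (V (j + 1) - V j) / h"
    "(U j - V j - (U (j - 1) - V (j - 1))) / h = (U j - U (j - 1)) / h - (V j - V (j - 1)) / h" for h :: real
    by (simp_all add: diff_divide_distrib)
  moreover have "c * ((P - P') - (Q - Q')) = c * (P - Q) - c * (P' - Q')" for c P P' Q Q' :: real
    by (simp add: algebra_simps)
  ultimately show ?thesis by (simp only: second_difference_unfold)
qed

lemma second_difference_cmult: "second_difference x (\<lambda>j. c * U j) j = c * second_difference x U j"
proof -
  have "(c * U (j + 1) - c * U j) / h = c * ((U (j + 1) - U j) / h)"
    "(c * U j - c * U (j - 1)) / h = c * ((U j - U (j - 1)) / h)" for h :: real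
    by (simp_all add: right_diff_distrib)
  then show ?thesis by (simp only: second_difference_unfold right_diff_distrib mult.left_commute)
qed

lemma second_difference_at_min:
  assumes "x (j - 1) < x j" "x j < x (j + 1)" "U j \<le> U (j - 1)" "U j \<le> U (j + 1)"
  shows "0 \<le> second_difference x U j"
proof -
  have "(U j - U (j - 1)) / (x j - x (j - 1)) \<le> 0" using assms by (intro divide_nonpos_pos) auto
  moreover have "0 \<le> (U (j + 1) - U j) / (x (j + 1) - x j)" using assms by simp
  ultimately show ?thesis unfolding second_difference_unfold using assms(1,2) by (intro mult_nonneg_nonneg) simp_all
qed

context reaction_matrix
begin

text \<open>The continuous argument again, with the minimum over the finite product of components
  and nodes.\<close>

lemma discrete_max_principle:
  assumes eps: "\<And>i. i \<in> {1..n} \<Longrightarrow> 0 < \<epsilon> i"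
    and x: "\<And>j. j < N \<Longrightarrow> x j < x (Suc j)" "\<And>j. j \<le> N \<Longrightarrow> x j \<in> {0..1}"
    and bd: "\<And>i. i \<in> {1..n} \<Longrightarrow> 0 \<le> V i 0" "\<And>i. i \<in> {1..n} \<Longrightarrow> 0 \<le> V i N"
    and L: "\<And>i j. i \<in> {1..n} \<Longrightarrow> 0 < j \<Longrightarrow> j < N \<Longrightarrow>
      0 \<le> - \<epsilon> i * second_difference x (V i) j + (\<Sum>k=1..n. A i k (x j) * V k j)"
    and i: "i \<in> {1..n}" and j: "j \<le> N"
  shows "0 \<le> V i j"
proof (rule ccontr)
  assume neg: "\<not> 0 \<le> V i j"
  define P where "P = {1..n} \<times> {0..N}"
  have P: "finite P" "P \<noteq> {}" using n by (auto simp: P_def)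
  define k where "k = arg_min_on (\<lambda>(i, j). V i j) P"
  obtain I J where IJ: "k = (I, J)" by (cases k)
  have "k \<in> P" unfolding k_def by (rule arg_min_if_finite(1)[OF P])
  then have I: "I \<in> {1..n}" and J: "J \<le> N" by (auto simp: P_def IJ)
  have mn: "V I J \<le> V a b" if "a \<in> {1..n}" "b \<le> N" for a b
    using arg_min_least[OF P, of "(a, b)" "\<lambda>(i, j). V i j"] that unfolding k_def[symmetric] IJ by (simp add: P_def)
  then have sk: "V I J < 0" using neg i j by (meson not_le_imp_less order_le_less_trans)
  then have "J \<noteq> 0" "J \<noteq> N" using bd[OF I] by (metis not_le)+
  then have J': "0 < J" "J < N" using J by auto
  have "0 \<le> second_difference x (V I) J"
    by (rule second_difference_at_min) (use x(1)[of "J - 1"] x(1)[of J] J' mn I in auto)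
  then have "0 \<le> \<epsilon> I * second_difference x (V I) J" using eps[OF I] by simp
  moreover have "(\<Sum>k=1..n. A I k (x J) * V k J) < 0"
    by (rule row_min_bound) (use x(2)[OF J] I J sk mn in auto)
  ultimately show False using L[OF I J'] by simp
qed

lemma discrete_comparison:
  assumes eps: "\<And>i. i \<in> {1..n} \<Longrightarrow> 0 < \<epsilon> i"
    and x: "\<And>j. j < N \<Longrightarrow> x j < x (Suc j)" "\<And>j. j \<le> N \<Longrightarrow> x j \<in> {0..1}"
    and bd: "\<And>i. i \<in> {1..n} \<Longrightarrow> \<bar>V i 0\<bar> \<le> W i 0" "\<And>i. i \<in> {1..n} \<Longrightarrow> \<bar>V i N\<bar> \<le> W i N"
    and L: "\<And>i j. i \<in> {1..n} \<Longrightarrow> 0 < j \<Longrightarrow> j < N \<Longrightarrow>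
      \<bar>- \<epsilon> i * second_difference x (V i) j + (\<Sum>k=1..n. A i k (x j) * V k j)\<bar>
      \<le> - \<epsilon> i * second_difference x (W i) j + (\<Sum>k=1..n. A i k (x j) * W k j)"
    and i: "i \<in> {1..n}" and j: "j \<le> N"
  shows "\<bar>V i j\<bar> \<le> W i j"
proof -
  have *: "0 \<le> W i j - c * V i j" if c: "c = 1 \<or> c = -1" for c
  proof (rule discrete_max_principle[where \<epsilon> = \<epsilon> and x = x and V = "\<lambda>i j. W i j - c * V i j", OF eps x _ _ _ i j])
    fix i assume i: "i \<in> {1..n}"
    show "0 \<le> W i 0 - c * V i 0" "0 \<le> W i N - c * V i N" using bd[OF i] c by (auto simp: abs_le_iff)
    fix j assume j: "0 < j" "j < N"
    have "- \<epsilon> i * second_difference x (\<lambda>j. W i j - c * V i j) j + (\<Sum>k=1..n. A i k (x j) * (W k j - c * V k j))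
      = (- \<epsilon> i * second_difference x (W i) j + (\<Sum>k=1..n. A i k (x j) * W k j))
        - c * (- \<epsilon> i * second_difference x (V i) j + (\<Sum>k=1..n. A i k (x j) * V k j))"
      unfolding second_difference_diff second_difference_cmult
      by (simp add: algebra_simps sum_subtractf sum_distrib_left)
    then show "0 \<le> - \<epsilon> i * second_difference x (\<lambda>j. W i j - c * V i j) j + (\<Sum>k=1..n. A i k (x j) * (W k j - c * V k j))"
      using L[OF i j] c by (auto simp: abs_le_iff)
  qed
  from *[of 1] *[of "-1"] show ?thesis by (simp add: abs_le_iff)
qed

end

text \<open>On one side of its kink the function is a layer with \<alpha> = 1 and values at most 1,
  so its second derivative is at most \<open>1 / e\<close>.\<close>

lemma exp_kink_second_diff_away:
  assumes x: "l < x" "x < r" and e: "0 < e" and t: "t \<le> l \<or> r \<le> t"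
  shows "second_diff l x r (\<lambda>z. exp (- \<bar>z - t\<bar> / sqrt e)) \<le> 1 / e"
proof -
  define \<sigma> where "\<sigma> = (if t \<le> l then 1 else - 1 :: real)"
  have ab: "\<bar>z - t\<bar> = \<sigma> * (z - t)" if "l \<le> z" "z \<le> r" for z using t that x by (auto simp: \<sigma>_def)
  \<comment> \<open>The interval is chosen long enough to contain all distances to
    \<open>t\<close>.\<close>
  have lay: "twice_deriv 0 (r - l + \<bar>l - t\<bar> + \<bar>r - t\<bar>) (layer 1 e) (\<lambda>t. - sqrt (1 / e) * layer 1 e t) (\<lambda>t. 1 / e * layer 1 e t)"
    using e by (intro twice_deriv_layer) auto
  have "twice_deriv l r (\<lambda>z. layer 1 e (- \<sigma> * t + \<sigma> * z)) (\<lambda>z. \<sigma> * (- sqrt (1 / e) * layer 1 e (- \<sigma> * t + \<sigma> * z)))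
     (\<lambda>z. 1 / e * layer 1 e (- \<sigma> * t + \<sigma> * z))"
    by (rule twice_deriv_affine[OF lay]) (use t x in \<open>auto simp: \<sigma>_def\<close>)
  then have "second_diff l x r (\<lambda>z. layer 1 e (- \<sigma> * t + \<sigma> * z)) \<le> 1 / e"
  proof (rule second_diff_le[OF x])
    fix z assume z: "l < z" "z < r"
    have "layer 1 e (- \<sigma> * t + \<sigma> * z) \<le> 1" using ab[of z] z e by (intro layer_le_1) (auto simp: algebra_simps)
    then show "1 / e * layer 1 e (- \<sigma> * t + \<sigma> * z) \<le> 1 / e" using e by (simp add: field_simps)
  qed
  moreover have "layer 1 e (- \<sigma> * t + \<sigma> * z) = exp (- \<bar>z - t\<bar> / sqrt e)" if "l \<le> z" "z \<le> r" for z
    unfolding layer_def ab[OF that] by (simp add: real_sqrt_divide algebra_simps diff_divide_distrib)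
  ultimately show ?thesis using x by (simp add: second_diff_def)
qed

lemma exp_minus_le_quadratic:
  assumes "0 \<le> (v::real)" shows "exp (- v) \<le> 1 - v + v\<^sup>2 / 2"
proof (cases "v = 0")
  case False
  then have v: "0 < v" using assms by simp
  have "continuous_on {0..v} (\<lambda>t. exp (- t))" by (intro continuous_intros)
  moreover have "((\<lambda>t. exp (- t)) has_real_derivative - exp (- t)) (at t)" "((\<lambda>t. - exp (- t)) has_real_derivative exp (- t)) (at t)" for t :: real
    by (auto intro!: derivative_eq_intros)
  ultimately obtain \<xi> where "0 < \<xi>" "exp (- v) = exp (- 0) + v * (- exp (- 0)) + v\<^sup>2 / 2 * exp (- \<xi>)"
    using taylor_second_order[OF v, of "\<lambda>t. exp (- t)" "\<lambda>t. - exp (- t)" "\<lambda>t. exp (- t)"] by metis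
  moreover have "v\<^sup>2 / 2 * exp (- \<xi>) \<le> v\<^sup>2 / 2 * 1" using calculation(1) by (intro mult_left_mono) auto
  ultimately show ?thesis by simp
qed simp

text \<open>The slope jumps by \<open>- 2 / sqrt e\<close> at the kink. Division by the mean cell
  width, which is at most \<open>H\<close>, gives the negative term; the quadratic remainder of the
  exponential gives \<open>1 / e\<close>.\<close>

lemma exp_kink_second_diff_at:
  assumes x: "l < x" "x < r" and e: "0 < e" and H: "x - l \<le> H" "r - x \<le> H"
  shows "second_diff l x r (\<lambda>z. exp (- \<bar>z - x\<bar> / sqrt e)) \<le> 1 / e - 2 / (sqrt e * H)"
proof -
  define s h k where "s = sqrt e" and "h = r - x" and "k = x - l"
  have s: "0 < s" "e = s * s" using e by (auto simp: s_def)
  have hk: "0 < h" "0 < k" "h \<le> H" "k \<le> H" using x H by (auto simp: h_def k_def)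
  have le: "(exp (- v / s) - 1) / v \<le> - 1 / s + v / (2 * (s * s))" if "0 < v" for v
  proof -
    have "exp (- (v / s)) - 1 \<le> - (v / s) + (v / s)\<^sup>2 / 2"
      using exp_minus_le_quadratic[of "v / s"] that s by simp
    also have "\<dots> = v * (- 1 / s + v / (2 * (s * s)))" using s by (simp add: power2_eq_square field_simps)
    finally have "exp (- (v / s)) - 1 \<le> v * (- 1 / s + v / (2 * (s * s)))" .
    then show ?thesis using that by (simp add: pos_divide_le_eq mult.commute)
  qed
  have "second_diff l x r (\<lambda>z. exp (- \<bar>z - x\<bar> / sqrt e)) =
     1 / ((k + h) / 2) * ((exp (- h / s) - 1) / h + (exp (- k / s) - 1) / k)"
  proof -
    have "exp (- \<bar>r - x\<bar> / sqrt e) = exp (- h / s)" "exp (- \<bar>l - x\<bar> / sqrt e) = exp (- k / s)"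
      "exp (- \<bar>x - x\<bar> / sqrt e) = 1"
      using x by (auto simp: h_def k_def s_def)
    moreover have "p - (1 - q) / k = p + (q - 1) / k" for p q by (simp add: diff_divide_distrib)
    ultimately show ?thesis unfolding second_diff_def h_def[symmetric] k_def[symmetric] by (simp only:)
  qed
  also have "\<dots> \<le> 1 / ((k + h) / 2) * ((- 1 / s + h / (2 * (s * s))) + (- 1 / s + k / (2 * (s * s))))"
    using hk le by (intro mult_left_mono add_mono) auto
  also have "\<dots> = 1 / e - 4 / (s * (k + h))"
  proof -
    have inner: "(- 1 / s + h / (2 * (s * s))) + (- 1 / s + k / (2 * (s * s))) = - 2 / s + (k + h) / (2 * (s * s))"
      by (simp add: add_divide_distrib)
    have outer: "1 / (t / 2) * (- 2 / s + t / (2 * (s * s))) = 1 / (s * s) - 4 / (s * t)" if "0 < t" for t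
      using that s(1) by (simp add: field_simps)
    show ?thesis unfolding inner s(2) by (rule outer) (use hk in simp)
  qed
  also have "\<dots> \<le> 1 / e - 2 / (s * H)"
  proof -
    have "4 / (s * (H + H)) \<le> 4 / (s * (k + h))" using hk s by (intro divide_left_mono mult_left_mono add_mono) auto
    moreover have "4 / (s * (H + H)) = 2 / (s * H)" using hk s by (simp add: field_simps)
    ultimately show ?thesis by linarith
  qed
  finally show ?thesis by (simp add: s_def)
qed

text \<open>A kink of width \<open>sqrt e\<close> in the barrier compensates the lower consistency order at a break point.\<close>

definition kinks :: "real set \<Rightarrow> real \<Rightarrow> real \<Rightarrow> real" where
  "kinks Z e z = (\<Sum>t\<in>Z. exp (- \<bar>z - t\<bar> / sqrt e))"

lemma kinks_bounds: "0 \<le> e \<Longrightarrow> 0 \<le> kinks Z e z \<and> kinks Z e z \<le> card Z"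
proof
  assume "0 \<le> e"
  have "kinks Z e z \<le> (\<Sum>t\<in>Z. 1)" unfolding kinks_def using \<open>0 \<le> e\<close> by (intro sum_mono) simp
  then show "kinks Z e z \<le> card Z" by simp
qed (simp add: kinks_def sum_nonneg)

lemma second_diff_sum:
  "second_diff l x r (\<lambda>z. \<Sum>t\<in>Z. F t z) = (\<Sum>t\<in>Z. second_diff l x r (F t))"
proof -
  have "(\<Sum>t\<in>Z. second_diff l x r (F t)) = 1 / ((x - l + (r - x)) / 2) *
     ((\<Sum>t\<in>Z. (F t r - F t x) / (r - x)) - (\<Sum>t\<in>Z. (F t x - F t l) / (x - l)))"
    by (simp only: second_diff_def sum_distrib_left[symmetric] sum_subtractf)
  also have "\<dots> = second_diff l x r (\<lambda>z. \<Sum>t\<in>Z. F t z)"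
    by (simp only: second_diff_def sum_divide_distrib[symmetric] sum_subtractf)
  finally show ?thesis by simp
qed

text \<open>Every kink costs at most \<open>e * (1 / e) = 1\<close>, and only the one at
  \<open>x\<close> itself brings the gain. As no break point lies inside a cell, these are the only
  two cases.\<close>

lemma second_diff_kinks:
  assumes Z: "finite Z" and x: "l < x" "x < r" and e: "0 < e" and H: "x - l \<le> H" "r - x \<le> H"
    and nb: "\<And>t. t \<in> Z \<Longrightarrow> t \<le> l \<or> x \<le> t" "\<And>t. t \<in> Z \<Longrightarrow> t \<le> x \<or> r \<le> t"
  shows "(if x \<in> Z then 2 * (sqrt e / H) else 0) - card Z \<le> - e * second_diff l x r (kinks Z e)"
proof -
  have e': "e / sqrt e = sqrt e" using e by (simp add: real_div_sqrt)
  have "e * second_diff l x r (kinks Z e) = (\<Sum>t\<in>Z. e * second_diff l x r (\<lambda>z. exp (- \<bar>z - t\<bar> / sqrt e)))"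
    unfolding kinks_def[abs_def] second_diff_sum sum_distrib_left ..
  also have "\<dots> \<le> (\<Sum>t\<in>Z. 1 - (if x = t then 2 * (sqrt e / H) else 0))"
  proof (rule sum_mono)
    fix t assume t: "t \<in> Z"
    show "e * second_diff l x r (\<lambda>z. exp (- \<bar>z - t\<bar> / sqrt e)) \<le> 1 - (if x = t then 2 * (sqrt e / H) else 0)"
    proof (cases "x = t")
      case True
      have "e * second_diff l x r (\<lambda>z. exp (- \<bar>z - x\<bar> / sqrt e)) \<le> e * (1 / e - 2 / (sqrt e * H))"
        using exp_kink_second_diff_at[OF x e H] e by (intro mult_left_mono) auto
      also have "\<dots> = 1 - 2 * (e / sqrt e / H)" using e by (simp add: right_diff_distrib)
      finally show ?thesis using True unfolding e' by simp
    next
      case False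
      then have "t \<le> l \<or> r \<le> t" using nb[OF t] by force
      then have "e * second_diff l x r (\<lambda>z. exp (- \<bar>z - t\<bar> / sqrt e)) \<le> e * (1 / e)"
        using exp_kink_second_diff_away[OF x e] e by (intro mult_left_mono) auto
      then show ?thesis using False e by simp
    qed
  qed
  also have "\<dots> = card Z - (if x \<in> Z then 2 * (sqrt e / H) else 0)"
    using Z by (simp add: sum_subtractf sum.delta')
  finally show ?thesis by simp
qed

section \<open>The error bound for the discrete solution\<close>

context reaction_data
begin

text \<open>There are at most \<open>2 * n + 2\<close> kinks. Each may cost 1 in the difference term
  and \<open>n * a\<close> in the row of the reaction matrix; the level outweighs these losses and
  leaves 1.\<close>

definition barrier_level :: real where "barrier_level = (1 + (2 * n + 2) * (1 + n * a)) / \<alpha>"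
definition error_const :: real where
  "error_const = local_const n \<alpha> curvature_bound * (barrier_level + (2 * n + 2))"

lemma error_bound:
  assumes sh: "shishkin n \<epsilon> \<alpha> p N" and p: "1 \<le> p" and le1: "\<And>i. i \<in> {1..n} \<Longrightarrow> \<epsilon> i \<le> 1"
    and u: "\<And>i. i \<in> {1..n} \<Longrightarrow> twice_deriv 0 1 (u i) (u1 i) (\<lambda>x. ((\<Sum>j=1..n. A i j x * u j x) - f i x) / \<epsilon> i)"
    and u1: "\<And>i. i \<in> {1..n} \<Longrightarrow> continuous_on {0..1} (u1 i)"
    and u_end: "\<And>i t. i \<in> {1..n} \<Longrightarrow> t = 0 \<or> t = 1 \<Longrightarrow> \<bar>u i t\<bar> \<le> a"
  defines "x \<equiv> shishkin_mesh n \<epsilon> \<alpha> N"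
  assumes U: "discrete_solution n \<epsilon> A f (\<lambda>i. u i 0) (\<lambda>i. u i 1) N x U"
    and i: "i \<in> {1..n}" and j: "j \<le> N"
  shows "\<bar>U i j - u i (x j)\<bar> \<le> error_const * rate N"
proof -
  interpret shishkin n \<epsilon> \<alpha> p N by (rule sh)
  interpret m: piecewise_uniform_mesh x N breakpoints "1 / 2 ^ p"
    unfolding x_def by (rule mesh)
  define y where "y i x = (\<Sum>j=1..n. A i j x * u j x) - f i x" for i x
  define y1 where "y1 i x = (\<Sum>j=1..n. A1 i j x * u j x + A i j x * u1 j x) - f1 i x" for i x
  define y2 where "y2 i x = (\<Sum>j=1..n. A2 i j x * u j x + 2 * A1 i j x * u1 j x + A i j x * (y j x / \<epsilon> j)) - f2 i x" for i x
  have u': "twice_deriv 0 1 (u i) (u1 i) (\<lambda>x. y i x / \<epsilon> i)" if "i \<in> {1..n}" for i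
    using u[OF that] by (simp add: y_def)
  note facts = pos le1 mono y_def y1_def y2_def u' u1 u_end
  have y_d: "twice_deriv 0 1 (y i) (y1 i) (y2 i)" if "i \<in> {1..n}" for i
    by (rule y_deriv[OF facts that])
  have y_b: "\<bar>y i t\<bar> \<le> curvature_bound * (\<epsilon> i * (1 + layer_load \<alpha> \<epsilon> {i..n} t))"
    if "i \<in> {1..n}" "t \<in> {0..1}" for i t
    by (rule y_layer_bound[OF facts that])
  have y2_b: "\<bar>y2 i t\<bar> \<le> curvature_bound * (1 + layer_load \<alpha> \<epsilon> {1..n} t)"
    if "i \<in> {1..n}" "t \<in> {0..1}" for i t
    by (rule y2_layer_bound[OF facts that])
  define \<kappa> where "\<kappa> = local_const n \<alpha> curvature_bound * rate N"
  have \<kappa>0: "0 \<le> \<kappa>"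
  proof -
    have "0 \<le> trunc_const n \<alpha> curvature_bound"
      by (rule trunc_const_nonneg[where \<delta> = 0 and \<Lambda> = 1, OF \<alpha> pos]) (use bounds_nonneg in auto)
    then show ?thesis using \<alpha> by (simp add: \<kappa>_def local_const_def resolution_const_def rate_def)
  qed
  \<comment> \<open>The kinks have the width of the component they belong to, so each row also meets
    kinks of other widths; these enter only through their size.\<close>
  define W where "W i j = \<kappa> * (barrier_level + kinks breakpoints (\<epsilon> i) (x j))" for i j
  have bl0: "0 \<le> barrier_level" using \<alpha> a_pos by (simp add: barrier_level_def)
  have W0: "0 \<le> W i j" if "i \<in> {1..n}" for i j
    using \<kappa>0 bl0 kinks_bounds[of "\<epsilon> i" breakpoints "x j"] pos[OF that] by (simp add: W_def)
  have "\<bar>U i j - u i (x j)\<bar> \<le> W i j"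
  proof (rule discrete_comparison[where \<epsilon> = \<epsilon> and x = x and V = "\<lambda>i j. U i j - u i (x j)" and W = W, OF pos m.x_less _ _ _ _ i j])
    fix j assume "j \<le> N" then show "x j \<in> {0..1}" using m.x_range by simp
  next
    fix i assume i: "i \<in> {1..n}"
    show "\<bar>U i 0 - u i (x 0)\<bar> \<le> W i 0" "\<bar>U i N - u i (x N)\<bar> \<le> W i N"
      using U i W0[OF i] by (auto simp: discrete_solution_def m.x_0 m.x_N)
  next
    fix i j assume i: "i \<in> {1..n}" and j: "0 < j" "j < N"
    have e: "0 < \<epsilon> i" by (rule pos[OF i])
    have xj: "x j \<in> {0..1}" using m.x_range[of j] j by simp
    have less: "x (j - 1) < x j" "x j < x (j + 1)" using m.x_less[of "j - 1"] m.x_less[of j] j by auto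
    let ?\<Delta> = "second_diff (x (j - 1)) (x j) (x (j + 1))"
    let ?K = "?\<Delta> (kinks breakpoints (\<epsilon> i))" and ?R = "\<Sum>k=1..n. A i k (x j) * (barrier_level + kinks breakpoints (\<epsilon> k) (x j))"
    let ?L = "- \<epsilon> i * second_difference x (\<lambda>j. U i j - u i (x j)) j + (\<Sum>k=1..n. A i k (x j) * (U k j - u k (x j)))"
    let ?M = "- \<epsilon> i * second_difference x (W i) j + (\<Sum>k=1..n. A i k (x j) * W k j)"
    define H where "H = max (x j - x (j - 1)) (x (j + 1) - x j)"
    define J where "J = (if x j \<in> breakpoints then sqrt (\<epsilon> i) / H else 0)"
    have J0: "0 \<le> J" using less by (simp add: J_def H_def e less_imp_le)
    have "?L
      = (- \<epsilon> i * second_difference x (U i) j + (\<Sum>k=1..n. A i k (x j) * U k j) - f i (x j))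
        + (\<epsilon> i * second_difference x (\<lambda>j. u i (x j)) j - y i (x j))"
      unfolding second_difference_diff y_def by (simp add: algebra_simps sum_subtractf)
    also have "- \<epsilon> i * second_difference x (U i) j + (\<Sum>k=1..n. A i k (x j) * U k j) - f i (x j) = 0"
      using U i j by (simp add: discrete_solution_def)
    also have "0 + (\<epsilon> i * second_difference x (\<lambda>j. u i (x j)) j - y i (x j))
       = \<epsilon> i * ?\<Delta> (u i) - y i (x j)"
      by (simp only: second_difference_eq add_0)
    finally have res: "?L
       = \<epsilon> i * ?\<Delta> (u i) - y i (x j)" .
    have "\<bar>\<epsilon> i * ?\<Delta> (u i) - y i (x j)\<bar> \<le> \<kappa> * (1 + J)"
      unfolding \<kappa>_def J_def H_def x_def
      by (rule truncation_error[OF p j i le1[OF i] less_imp_le[OF bounds_nonneg(5)] y_d[OF i] u'[OF i] y_b[OF i] y2_b[OF i]])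
    also have "\<dots> \<le> ?M"
    proof -
      define c where "c = real (card breakpoints)"
      have c: "c \<le> 2 * n + 2" using card_breakpoints unfolding c_def by (metis of_nat_mono of_nat_add of_nat_mult of_nat_numeral)
      have "second_difference x (W i) j = \<kappa> * ?K"
        unfolding W_def[abs_def] second_difference_cmult second_difference_eq[symmetric]
        by (simp add: second_difference_def)
      \<comment> \<open>The kinks yield \<open>2 * J\<close>, more than the \<open>J\<close> needed
        for the truncation error.\<close>
      moreover have "2 * J - c \<le> - \<epsilon> i * ?K"
      proof -
        have "(if x j \<in> breakpoints then 2 * (sqrt (\<epsilon> i) / H) else 0) - card breakpoints
           \<le> - \<epsilon> i * ?K"
          by (rule second_diff_kinks[OF m.finite_Z less e])
            (use m.no_breakpoint[of "j - 1"] m.no_breakpoint[of j] j in \<open>auto simp: H_def\<close>)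
        then show ?thesis by (simp add: J_def c_def split: if_splits)
      qed
      moreover have "1 + c \<le> ?R"
      proof -
        have "(\<Sum>k=1..n. A i k (x j) * barrier_level - a * c) \<le> ?R"
        proof (rule sum_mono)
          fix k assume k: "k \<in> {1..n}"
          have kb: "0 \<le> kinks breakpoints (\<epsilon> k) (x j)" "kinks breakpoints (\<epsilon> k) (x j) \<le> c"
            using kinks_bounds[of "\<epsilon> k" breakpoints "x j"] pos[OF k] by (auto simp: c_def)
          have "- A i k (x j) * kinks breakpoints (\<epsilon> k) (x j) \<le> a * c"
            using bound[OF xj i k] kb a_pos by (intro mult_mono) auto
          then show "A i k (x j) * barrier_level - a * c \<le> A i k (x j) * (barrier_level + kinks breakpoints (\<epsilon> k) (x j))"
            by (simp add: distrib_left)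
        qed
        also have "(\<Sum>k=1..n. A i k (x j) * barrier_level - a * c) = (\<Sum>k=1..n. A i k (x j)) * barrier_level - n * a * c"
          by (simp add: sum_subtractf sum_distrib_right)
        finally have "(\<Sum>k=1..n. A i k (x j)) * barrier_level - n * a * c
            \<le> ?R" .
        moreover have "\<alpha> * barrier_level \<le> (\<Sum>k=1..n. A i k (x j)) * barrier_level"
          using rowsum[OF xj i] \<eta> bl0 by (intro mult_right_mono) auto
        moreover have "\<alpha> * barrier_level = 1 + (2 * n + 2) * (1 + n * a)" using \<alpha> by (simp add: barrier_level_def)
        moreover have "c * (1 + n * a) \<le> (2 * n + 2) * (1 + n * a)" using c a_pos by (intro mult_right_mono) auto
        moreover have "c * (1 + n * a) = c + n * a * c" by (simp add: algebra_simps)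
        ultimately show ?thesis by linarith
      qed
      ultimately have "\<kappa> * (1 + 2 * J) \<le> \<kappa> * (- \<epsilon> i * ?K
          + ?R)"
        using \<kappa>0 by (intro mult_left_mono) auto
      also have "\<dots> = ?M"
      proof -
        have "\<kappa> * (- \<epsilon> i * X + Y) = - \<epsilon> i * (\<kappa> * X) + \<kappa> * Y" for X Y by (simp add: algebra_simps)
        moreover have "\<kappa> * ?R = (\<Sum>k=1..n. A i k (x j) * W k j)"
          by (simp add: W_def sum_distrib_left mult.left_commute)
        ultimately show ?thesis unfolding \<open>second_difference x (W i) j = _\<close> by simp
      qed
      finally show ?thesis using J0 \<kappa>0 by (smt (verit) mult_left_mono)
    qed
    finally show "\<bar>?L\<bar>
      \<le> ?M"
      unfolding res .
  qed
  also have "W i j \<le> \<kappa> * (barrier_level + (2 * n + 2))"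
  proof -
    have "kinks breakpoints (\<epsilon> i) (x j) \<le> card breakpoints" using kinks_bounds[of "\<epsilon> i"] pos[OF i] by simp
    also have "\<dots> \<le> real (2 * n + 2)" using card_breakpoints by (simp only: of_nat_le_iff)
    finally show ?thesis unfolding W_def using \<kappa>0 by (intro mult_left_mono) auto
  qed
  finally show ?thesis by (simp add: error_const_def \<kappa>_def mult.commute mult.left_commute)
qed

end

section \<open>Uniform bounds for the data and regularity of the solution\<close>

lemma continuous_bounded_unit:
  assumes "continuous_on {0..1} (g :: real \<Rightarrow> real)"
  shows "\<exists>B. \<forall>x\<in>{0..1}. \<bar>g x\<bar> \<le> B"
proof -
  have "bounded (g ` {0..1})" using assms by (intro compact_imp_bounded compact_continuous_image) auto
  then show ?thesis by (auto simp: bounded_iff)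
qed

abbreviation bounded_by :: "real \<Rightarrow> (real \<Rightarrow> real) \<Rightarrow> (real \<Rightarrow> real) \<Rightarrow> (real \<Rightarrow> real) \<Rightarrow> bool" where
  "bounded_by B g g1 g2 \<equiv> \<forall>x\<in>{0..1}. \<bar>g x\<bar> \<le> B \<and> \<bar>g1 x\<bar> \<le> B \<and> \<bar>g2 x\<bar> \<le> B"

lemma C_diff_on_2_bounded:
  assumes "C_diff_on 2 g {0..1}"
  shows "\<exists>g1 g2. twice_deriv 0 1 g g1 g2 \<and> (\<exists>B. bounded_by B g g1 g2)"
proof -
  obtain g1 g2 where g: "\<forall>x\<in>{0..1}. (g has_real_derivative g1 x) (at x within {0..1})"
    "\<forall>x\<in>{0..1}. (g1 has_real_derivative g2 x) (at x within {0..1})" "continuous_on {0..1} g2"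
    using assms by (auto simp: numeral_2_eq_2)
  have c: "continuous_on {0..1} g" "continuous_on {0..1} g1"
    using g(1,2) by (auto intro!: DERIV_continuous_on)
  have "(g has_real_derivative g1 t) (at t) \<and> (g1 has_real_derivative g2 t) (at t)" if "t \<in> {0<..<1}" for t
  proof -
    have "at t within {0..1} = at t" using that by (intro at_within_interior) simp
    then show ?thesis using g(1,2)[rule_format, of t] that by simp
  qed
  then have "twice_deriv 0 1 g g1 g2" using c(1) by (simp add: twice_deriv_def)
  moreover obtain B0 B1 B2 where B: "\<forall>x\<in>{0..1}. \<bar>g x\<bar> \<le> B0" "\<forall>x\<in>{0..1}. \<bar>g1 x\<bar> \<le> B1" "\<forall>x\<in>{0..1}. \<bar>g2 x\<bar> \<le> B2"
    using c g(3) continuous_bounded_unit by meson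
  have "\<forall>x\<in>{0..1}. \<bar>g x\<bar> \<le> max B0 (max B1 B2) \<and> \<bar>g1 x\<bar> \<le> max B0 (max B1 B2) \<and> \<bar>g2 x\<bar> \<le> max B0 (max B1 B2)"
    using B by (simp add: le_max_iff_disj)
  ultimately show ?thesis by blast
qed

lemma finite_common_bound:
  assumes "finite I" "\<And>i. i \<in> I \<Longrightarrow> \<exists>B::real. P i B"
    and "\<And>i B B'. P i B \<Longrightarrow> B \<le> B' \<Longrightarrow> P i B'"
  shows "\<exists>B. \<forall>i\<in>I. P i B"
  using assms(1,2)
proof (induction I rule: finite_induct)
  case (insert i I)
  obtain B where "\<forall>i\<in>I. P i B" using insert by auto
  moreover obtain B' where "P i B'" using insert.prems by auto
  ultimately have "\<forall>k\<in>insert i I. P k (max B B')"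
    using assms(3)[of _ B "max B B'"] assms(3)[of i B' "max B B'"] by auto
  then show ?case by blast
qed simp

text \<open>By compactness each row sum attains its minimum. The slack is written as
  \<open>1 / B\<close>, so that decreasing it means increasing \<open>B\<close> and finitely many
  rows can share one bound.\<close>

lemma row_sum_slack:
  fixes A :: "nat \<Rightarrow> nat \<Rightarrow> real \<Rightarrow> real"
  assumes n: "1 \<le> n" and A: "\<And>i j. i \<in> {1..n} \<Longrightarrow> j \<in> {1..n} \<Longrightarrow> continuous_on {0..1} (A i j)"
    and gt: "\<And>i x. i \<in> {1..n} \<Longrightarrow> x \<in> {0..1} \<Longrightarrow> \<alpha> < (\<Sum>j=1..n. A i j x)"
  obtains \<eta> :: real where "0 < \<eta>" "\<And>i x. i \<in> {1..n} \<Longrightarrow> x \<in> {0..1} \<Longrightarrow> \<alpha> + \<eta> \<le> (\<Sum>j=1..n. A i j x)"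
proof -
  have "\<exists>B>0. \<forall>x\<in>{0..1}. \<alpha> + 1 / B \<le> (\<Sum>j=1..n. A i j x)" if i: "i \<in> {1..n}" for i
  proof -
    have "continuous_on {0..1} (\<lambda>x. \<Sum>j=1..n. A i j x)" by (intro continuous_on_sum A i)
    then obtain z where z: "z \<in> {0..1}" "\<And>x. x \<in> {0..1} \<Longrightarrow> (\<Sum>j=1..n. A i j z) \<le> (\<Sum>j=1..n. A i j x)"
      using continuous_attains_inf[of "{0..1::real}" "\<lambda>x. \<Sum>j=1..n. A i j x"] by auto
    have "0 < 1 / ((\<Sum>j=1..n. A i j z) - \<alpha>)" using gt[OF i z(1)] by simp
    then show ?thesis using z(2) by (intro exI[of _ "1 / ((\<Sum>j=1..n. A i j z) - \<alpha>)"]) auto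
  qed
  moreover have "B' > 0 \<and> (\<forall>x\<in>{0..1}. \<alpha> + 1 / B' \<le> (\<Sum>j=1..n. A i j x))"
    if "B > 0 \<and> (\<forall>x\<in>{0..1}. \<alpha> + 1 / B \<le> (\<Sum>j=1..n. A i j x))" "B \<le> B'" for i and B B' :: real
  proof -
    have "1 / B' \<le> 1 / B" using that by (intro divide_left_mono) auto
    then show ?thesis using that by force
  qed
  ultimately have "\<exists>B. \<forall>i\<in>{1..n}. B > 0 \<and> (\<forall>x\<in>{0..1}. \<alpha> + 1 / B \<le> (\<Sum>j=1..n. A i j x))"
    by (intro finite_common_bound finite_atLeastAtMost)
  then obtain B where B: "\<And>i. i \<in> {1..n} \<Longrightarrow> B > 0 \<and> (\<forall>x\<in>{0..1}. \<alpha> + 1 / B \<le> (\<Sum>j=1..n. A i j x))"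
    by blast
  show ?thesis
  proof (rule that[of "1 / B"])
    show "0 < 1 / B" using B[of 1] n by simp
  qed (use B in blast)
qed

text \<open>The equation extends \<open>u''\<close>, hence \<open>u'\<close>, continuously to the end points.\<close>

lemma bvp_solution_regular:
  assumes u: "bvp_solution n \<epsilon> A f g\<^sub>0 g\<^sub>1 u" and pos: "\<And>i. i \<in> {1..n} \<Longrightarrow> 0 < \<epsilon> i"
    and A: "\<And>i j. i \<in> {1..n} \<Longrightarrow> j \<in> {1..n} \<Longrightarrow> continuous_on {0..1} (A i j)"
    and f: "\<And>i. i \<in> {1..n} \<Longrightarrow> continuous_on {0..1} (f i)"
  shows "\<exists>u1. \<forall>i\<in>{1..n}. twice_deriv 0 1 (u i) (u1 i) (\<lambda>x. ((\<Sum>j=1..n. A i j x * u j x) - f i x) / \<epsilon> i)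
     \<and> continuous_on {0..1} (u1 i)"
proof -
  obtain u' u'' where d: "\<And>i x. i \<in> {1..n} \<Longrightarrow> x \<in> {0<..<1} \<Longrightarrow> (u i has_real_derivative u' i x) (at x) \<and>
        (u' i has_real_derivative u'' i x) (at x) \<and> - \<epsilon> i * u'' i x + (\<Sum>j=1..n. A i j x * u j x) = f i x"
    using u unfolding bvp_solution_def by blast
  have uc: "continuous_on {0..1} (u i)" if "i \<in> {1..n}" for i using u that by (simp add: bvp_solution_def)
  define r where "r i x = ((\<Sum>j=1..n. A i j x * u j x) - f i x) / \<epsilon> i" for i x
  have "\<exists>v. twice_deriv 0 1 (u i) v (r i) \<and> continuous_on {0..1} v" if i: "i \<in> {1..n}" for i
  proof -
    have "continuous_on {0..1} (r i)"
      unfolding r_def[abs_def] using pos[OF i] by (intro continuous_intros A f uc i) auto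
    then obtain P where P: "\<And>x. x \<in> {0..1} \<Longrightarrow> (P has_vector_derivative r i x) (at x within {0..1})"
      using antiderivative_continuous by blast
    then have P1: "(P has_real_derivative r i x) (at x within {0..1})" if "x \<in> {0..1}" for x
      using that by (simp add: has_real_derivative_iff_has_vector_derivative)
    have Pc: "continuous_on {0..1} P" by (rule DERIV_continuous_on) (rule P1)
    have P2: "(P has_real_derivative r i x) (at x)" if "x \<in> {0<..<1}" for x
    proof -
      have "at x within {0..1} = at x" using that by (intro at_within_interior) simp
      then show ?thesis using P1[of x] that by simp
    qed
    have eq: "u'' i x = r i x" if "x \<in> {0<..<1}" for x
      using d[OF i that] pos[OF i] by (simp add: r_def field_simps)
    \<comment> \<open>The antiderivative \<open>P\<close> of the extended second derivative differs
      from \<open>u'\<close> by a constant on the open interval; the constant is read off at an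
      arbitrary interior point.\<close>
    have const: "u' i x - P x = u' i (1/2) - P (1/2)" if x: "x \<in> {0<..<1}" for x
    proof (rule DERIV_isconst3[where a = 0 and b = 1 and f = "\<lambda>x. u' i x - P x"])
      fix z :: real assume z: "z \<in> {0<..<1}"
      then show "((\<lambda>x. u' i x - P x) has_real_derivative 0) (at z)"
        using d[OF i z] P2[OF z] eq[OF z] by (auto intro!: derivative_eq_intros)
    qed (use x in auto)
    define v where "v x = P x + (u' i (1/2) - P (1/2))" for x
    have "(u i has_real_derivative v x) (at x)" if "x \<in> {0<..<1}" for x
    proof -
      have "v x = u' i x" using const[OF that] by (simp add: v_def)
      then show ?thesis using d[OF i that] by simp
    qed
    moreover have "(v has_real_derivative r i x) (at x)" if "x \<in> {0<..<1}" for x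
      unfolding v_def[abs_def] using P2[OF that] by (auto intro!: derivative_eq_intros)
    moreover have "continuous_on {0..1} v" unfolding v_def[abs_def] by (intro continuous_intros Pc)
    ultimately show ?thesis using uc[OF i] unfolding twice_deriv_def by blast
  qed
  then have "\<exists>u1. \<forall>i\<in>{1..n}. twice_deriv 0 1 (u i) (u1 i) (r i) \<and> continuous_on {0..1} (u1 i)"
    by (intro bchoice) blast
  then show ?thesis unfolding r_def[abs_def] .
qed

theorem theorem3:
  fixes n :: nat
  assumes "n \<ge> 1"
  shows "\<exists>m::nat. \<forall>(A :: nat \<Rightarrow> nat \<Rightarrow> real \<Rightarrow> real) (f :: nat \<Rightarrow> real \<Rightarrow> real) (\<alpha> :: real)
      (g\<^sub>0 :: nat \<Rightarrow> real) (g\<^sub>1 :: nat \<Rightarrow> real).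
    (\<forall>i\<in>{1..n}. \<forall>j\<in>{1..n}. C_diff_on m (A i j) {0..1}) \<and>
    (\<forall>i\<in>{1..n}. C_diff_on m (f i) {0..1}) \<and>
    admissible_matrix n A \<alpha> \<longrightarrow>
    (\<exists>C>0. \<forall>(\<epsilon> :: nat \<Rightarrow> real) (p :: nat) (N :: nat) (u :: nat \<Rightarrow> real \<Rightarrow> real)
        (U :: nat \<Rightarrow> nat \<Rightarrow> real).
      admissible_parameters n \<epsilon> \<alpha> \<and> p \<ge> 1 \<and> N = 2 ^ (n + p + 1) \<and>
      bvp_solution n \<epsilon> A f g\<^sub>0 g\<^sub>1 u \<and>
      discrete_solution n \<epsilon> A f (\<lambda>i. u i 0) (\<lambda>i. u i 1) N (shishkin_mesh n \<epsilon> \<alpha> N) U \<longrightarrow>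
      (MAX i\<in>{1..n}. MAX j\<in>{0..N}. \<bar>U i j - u i (shishkin_mesh n \<epsilon> \<alpha> N j)\<bar>)
        \<le> C * real N powi (-2) * ln (real N) ^ 3)"
proof (rule exI[of _ 2], intro allI impI, elim conjE)
  \<comment> \<open>Smoothness of order 2 suffices: \<open>y2\<close> contains two derivatives of
    the data, and those of the solution come from the equation.\<close>
  fix A :: "nat \<Rightarrow> nat \<Rightarrow> real \<Rightarrow> real" and f :: "nat \<Rightarrow> real \<Rightarrow> real" and \<alpha> :: real and g\<^sub>0 g\<^sub>1 :: "nat \<Rightarrow> real"
  assume A: "\<forall>i\<in>{1..n}. \<forall>j\<in>{1..n}. C_diff_on 2 (A i j) {0..1}"
    and f: "\<forall>i\<in>{1..n}. C_diff_on 2 (f i) {0..1}" and adm: "admissible_matrix n A \<alpha>"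
  \<comment> \<open>The index conditions stand inside the existential quantifiers so that choice
    yields functions of all natural indices.\<close>
  have "\<forall>i j. \<exists>g1 g2. i \<in> {1..n} \<and> j \<in> {1..n} \<longrightarrow> twice_deriv 0 1 (A i j) g1 g2 \<and>
      (\<exists>B. bounded_by B (A i j) g1 g2)"
    using A C_diff_on_2_bounded by blast
  then obtain A1 A2 where A12: "\<And>i j. i \<in> {1..n} \<Longrightarrow> j \<in> {1..n} \<Longrightarrow> twice_deriv 0 1 (A i j) (A1 i j) (A2 i j) \<and>
      (\<exists>B. bounded_by B (A i j) (A1 i j) (A2 i j))"
    by metis
  have "\<forall>i. \<exists>g1 g2. i \<in> {1..n} \<longrightarrow> twice_deriv 0 1 (f i) g1 g2 \<and>
      (\<exists>B. bounded_by B (f i) g1 g2)"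
    using f C_diff_on_2_bounded by blast
  then obtain f1 f2 where f12: "\<And>i. i \<in> {1..n} \<Longrightarrow> twice_deriv 0 1 (f i) (f1 i) (f2 i) \<and>
      (\<exists>B. bounded_by B (f i) (f1 i) (f2 i))"
    by metis
  have "\<exists>B. \<forall>ij\<in>{1..n} \<times> {1..n}. bounded_by B (A (fst ij) (snd ij)) (A1 (fst ij) (snd ij)) (A2 (fst ij) (snd ij))"
    by (rule finite_common_bound) (use A12 in \<open>fastforce intro: order_trans\<close>)+
  then obtain B1 where B1: "\<And>i j x. i \<in> {1..n} \<Longrightarrow> j \<in> {1..n} \<Longrightarrow> x \<in> {0..1} \<Longrightarrow> \<bar>A i j x\<bar> \<le> B1 \<and> \<bar>A1 i j x\<bar> \<le> B1 \<and> \<bar>A2 i j x\<bar> \<le> B1"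
    by fastforce
  have "\<exists>B. \<forall>i\<in>{1..n}. bounded_by B (f i) (f1 i) (f2 i)"
    by (rule finite_common_bound) (use f12 in \<open>fastforce intro: order_trans\<close>)+
  then obtain B2 where B2: "\<And>i x. i \<in> {1..n} \<Longrightarrow> x \<in> {0..1} \<Longrightarrow> \<bar>f i x\<bar> \<le> B2 \<and> \<bar>f1 i x\<bar> \<le> B2 \<and> \<bar>f2 i x\<bar> \<le> B2"
    by blast
  have "\<exists>B. \<forall>i\<in>{1..n}. \<bar>g\<^sub>0 i\<bar> \<le> B \<and> \<bar>g\<^sub>1 i\<bar> \<le> B"
  proof (rule finite_common_bound)
    show "\<exists>B. \<bar>g\<^sub>0 i\<bar> \<le> B \<and> \<bar>g\<^sub>1 i\<bar> \<le> B" for i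
      by (rule exI[of _ "max \<bar>g\<^sub>0 i\<bar> \<bar>g\<^sub>1 i\<bar>"]) simp
  qed auto
  then obtain B3 where B3: "\<And>i. i \<in> {1..n} \<Longrightarrow> \<bar>g\<^sub>0 i\<bar> \<le> B3 \<and> \<bar>g\<^sub>1 i\<bar> \<le> B3" by blast
  \<comment> \<open>The boundary vectors are included, so the constants depend on the problem data
    but not on \<open>\<epsilon>\<close> or \<open>N\<close>.\<close>
  define a where "a = max B1 (max B2 B3)"
  have aB: "B1 \<le> a" "B2 \<le> a" "B3 \<le> a" by (auto simp: a_def)
  have Ac: "continuous_on {0..1} (A i j)" if "i \<in> {1..n}" "j \<in> {1..n}" for i j
    using A12[OF that] by (auto simp: twice_deriv_def)
  have fc: "continuous_on {0..1} (f i)" if "i \<in> {1..n}" for i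
    using f12[OF that] by (auto simp: twice_deriv_def)
  obtain \<eta> where \<eta>: "0 < \<eta>" "\<And>i x. i \<in> {1..n} \<Longrightarrow> x \<in> {0..1} \<Longrightarrow> \<alpha> + \<eta> \<le> (\<Sum>j=1..n. A i j x)"
    using row_sum_slack[of n A \<alpha>] assms Ac adm unfolding admissible_matrix_def by metis
  interpret reaction_data n A \<alpha> \<eta> a A1 A2 f f1 f2
  proof
    show "1 \<le> n" by (rule assms)
    show "0 < \<alpha>" using adm by (simp add: admissible_matrix_def)
    show "0 < \<eta>" by (rule \<eta>(1))
    show "A i j x \<le> 0" if "x \<in> {0..1}" "i \<in> {1..n}" "j \<in> {1..n}" "i \<noteq> j" for x i j
      using adm that unfolding admissible_matrix_def by blast
    show "\<alpha> + \<eta> \<le> (\<Sum>j=1..n. A i j x)" if "x \<in> {0..1}" "i \<in> {1..n}" for x i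
      by (rule \<eta>(2)[OF that(2,1)])
    show "\<bar>A i j x\<bar> \<le> a" if "x \<in> {0..1}" "i \<in> {1..n}" "j \<in> {1..n}" for x i j
      using B1[OF that(2,3,1)] aB by linarith
    show "\<bar>A1 i j x\<bar> \<le> a" "\<bar>A2 i j x\<bar> \<le> a" if "i \<in> {1..n}" "j \<in> {1..n}" "x \<in> {0..1}" for x i j
      using B1[OF that] aB by linarith+
    show "\<bar>f i x\<bar> \<le> a" "\<bar>f1 i x\<bar> \<le> a" "\<bar>f2 i x\<bar> \<le> a" if "i \<in> {1..n}" "x \<in> {0..1}" for x i
      using B2[OF that] aB by linarith+
  qed (use A12 f12 in auto)
  show "\<exists>C>0. \<forall>(\<epsilon> :: nat \<Rightarrow> real) (p :: nat) (N :: nat) (u :: nat \<Rightarrow> real \<Rightarrow> real)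
        (U :: nat \<Rightarrow> nat \<Rightarrow> real).
      admissible_parameters n \<epsilon> \<alpha> \<and> p \<ge> 1 \<and> N = 2 ^ (n + p + 1) \<and>
      bvp_solution n \<epsilon> A f g\<^sub>0 g\<^sub>1 u \<and>
      discrete_solution n \<epsilon> A f (\<lambda>i. u i 0) (\<lambda>i. u i 1) N (shishkin_mesh n \<epsilon> \<alpha> N) U \<longrightarrow>
      (MAX i\<in>{1..n}. MAX j\<in>{0..N}. \<bar>U i j - u i (shishkin_mesh n \<epsilon> \<alpha> N j)\<bar>)
        \<le> C * real N powi (-2) * ln (real N) ^ 3"
  \<comment> \<open>The absolute value and the added 1 make the constant positive whatever the sign
    of \<open>error_const\<close>.\<close>
  proof (rule exI[of _ "\<bar>error_const\<bar> + 1"], intro conjI allI impI)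
    fix \<epsilon> :: "nat \<Rightarrow> real" and p N :: nat and u :: "nat \<Rightarrow> real \<Rightarrow> real" and U :: "nat \<Rightarrow> nat \<Rightarrow> real"
    assume *: "admissible_parameters n \<epsilon> \<alpha> \<and> p \<ge> 1 \<and> N = 2 ^ (n + p + 1) \<and>
      bvp_solution n \<epsilon> A f g\<^sub>0 g\<^sub>1 u \<and>
      discrete_solution n \<epsilon> A f (\<lambda>i. u i 0) (\<lambda>i. u i 1) N (shishkin_mesh n \<epsilon> \<alpha> N) U"
    then have p: "1 \<le> p" and bvp: "bvp_solution n \<epsilon> A f g\<^sub>0 g\<^sub>1 u" and N: "N = 2 ^ (n + p + 1)" and par: "0 < \<epsilon> 1" "strict_mono_on {1..n} \<epsilon>" "\<epsilon> n \<le> 1"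
      by (auto simp: admissible_parameters_def)
    have mono: "\<epsilon> i \<le> \<epsilon> j" if "i \<in> {1..n}" "j \<in> {1..n}" "i \<le> j" for i j
    proof (cases "i = j")
      case False
      then show ?thesis using strict_mono_onD[OF par(2) that(1,2)] that(3) by simp
    qed simp
    have pos: "0 < \<epsilon> i" if "i \<in> {1..n}" for i
    proof -
      have "\<epsilon> 1 \<le> \<epsilon> i" using that by (intro mono) auto
      then show ?thesis using par(1) by linarith
    qed
    have le1: "\<epsilon> i \<le> 1" if "i \<in> {1..n}" for i
    proof -
      have "\<epsilon> i \<le> \<epsilon> n" using that by (intro mono) auto
      then show ?thesis using par(3) by linarith
    qed
    interpret sh: shishkin n \<epsilon> \<alpha> p N
      by unfold_locales (use pos mono N \<alpha> n in auto)
    obtain u1 where u1: "\<And>i. i \<in> {1..n} \<Longrightarrow> twice_deriv 0 1 (u i) (u1 i) (\<lambda>x. ((\<Sum>j=1..n. A i j x * u j x) - f i x) / \<epsilon> i)"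
      "\<And>i. i \<in> {1..n} \<Longrightarrow> continuous_on {0..1} (u1 i)"
      using bvp_solution_regular[OF bvp pos Ac fc] by blast
    have u_end: "\<bar>u i t\<bar> \<le> a" if "i \<in> {1..n}" "t = 0 \<or> t = 1" for i t
      using * that B3[of i] aB by (auto simp: bvp_solution_def)
    have ln1: "1 \<le> ln (real N)" by (rule sh.lnN_ge[OF p])
    have "\<bar>U i j - u i (shishkin_mesh n \<epsilon> \<alpha> N j)\<bar> \<le> (\<bar>error_const\<bar> + 1) * real N powi (-2) * ln (real N) ^ 3"
      if i: "i \<in> {1..n}" and j: "j \<le> N" for i j
    proof -
      have "\<bar>U i j - u i (shishkin_mesh n \<epsilon> \<alpha> N j)\<bar> \<le> error_const * rate N"
        by (rule error_bound[OF sh.shishkin_axioms p le1 u1 u_end _ i j]) (use * in auto)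
      also have "\<dots> \<le> (\<bar>error_const\<bar> + 1) * rate N" by (intro mult_right_mono) (auto simp: rate_def)
      also have "rate N \<le> real N powi (-2) * ln (real N) ^ 3"
      proof -
        \<comment> \<open>The bound with the squared logarithm is relaxed to the third power by
          \<open>ln N \<ge> 1\<close>.\<close>
        have "ln (real N) ^ 2 \<le> ln (real N) ^ 3" using ln1 by (intro power_increasing) auto
        then have "ln (real N) ^ 2 / (real N)\<^sup>2 \<le> ln (real N) ^ 3 / (real N)\<^sup>2" by (intro divide_right_mono) auto
        then show ?thesis by (simp add: rate_def power_divide power_int_minus field_simps)
      qed
      then have "(\<bar>error_const\<bar> + 1) * rate N \<le> (\<bar>error_const\<bar> + 1) * (real N powi (-2) * ln (real N) ^ 3)"
        by (intro mult_left_mono) auto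
      finally show ?thesis by (simp add: mult.assoc)
    qed
    then show "(MAX i\<in>{1..n}. MAX j\<in>{0..N}. \<bar>U i j - u i (shishkin_mesh n \<epsilon> \<alpha> N j)\<bar>)
        \<le> (\<bar>error_const\<bar> + 1) * real N powi (-2) * ln (real N) ^ 3"
      using assms by (simp add: Max_le_iff)
  qed simp
qed

end
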